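(* Let $F$ be an entire function from the Laguerre–Pólya class $\mathscr{LP}$-I with $F(0)\neq0$, and let $F(z)=\sum_{k=0}^{\infty}f_kz^k$ be its Taylor series. 1. Let $\psi$ be a generic function from the Stieltjes class $\mathbf{S}$, and let $$F_{\psi}(z)=\sum_{k=0}^{\infty}\psi(k+1)f_kz^k.$$ Then $F_{\psi}$ is a Hurwitz stable entire function. 2. Let $\psi$ be a generic function from the Stieltjes class $\mathbf{S}^{-1}$, and let $$F_{\psi}^{-}(z)=\sum_{k=0}^{\infty}\psi(k)f_kz^k.$$ (a) If $\psi(0)\neq0$, then $F_{\psi}^{-}$ is a Hurwitz stable entire function. (b) If $\psi(0)=0$, then $F_{\psi}^{-}$ has a simple root at $z=0$, and $z^{-1}F_{\psi}^{-}(z)$ is a Hurwitz stable entire function.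
   Context: Laguerre–Pólya class $\mathscr{LP}$-I: the class of all entire functions $F$ (rational, i.e. polynomial, or transcendental) representable in the form $$F(z)=Cz^{m}e^{\alpha z}\prod_{\nu=1}^{\infty}(1+\delta_{\nu}z),$$ where $C$ is a non-zero real number, $m\ge0$ is an integer, $\alpha\ge0$, $\delta_{\nu}\ge0$ and $\sum_{\nu=1}^{\infty}\delta_{\nu}<\infty$. Hurwitz stability: an entire function $\Phi$ is called Hurwitz stable if it grows not more than exponentially, i.e. $\limsup_{z\to\infty}|z|^{-1}\ln|\Phi(z)|<\infty$, and (1) all roots of $\Phi$ lie in the open left half-plane $\{z:\operatorname{Re}z<0\}$; (2) $h_{\Phi}(0)\ge h_{\Phi}(\pi)$, where $h_{\Phi}(\theta)=\limsup_{r\to\infty}r^{-1}\ln|\Phi(re^{i\theta})|$ is the indicator function of $\Phi$. Stieltjes classes: let $\psi$ be holomorphic in $\mathbb{C}\setminus(-\infty,0]$. Then $\psi\in\mathbf{S}$ if $\psi(x)>0$ for $0<x<\infty$ and $\operatorname{Im}\psi(z)\le 0$ whenever $\operatorname{Im}z\ge 0$; and $\psi\in\mathbf{S}^{-1}$ if $\psi(x)>0$ for $0<x<\infty$ and $\operatorname{Im}\psi(z)\ge 0$ whenever $\operatorname{Im}z\ge0$ (with $z$ in the domain of $\psi$). Functions from these classes are assumed to be non-constant. For $\psi\in\mathbf{S}^{-1}$, the value $\psi(0)$ is defined as $\lim_{t\to+0}\psi(t)$, which exists and satisfies $0\le\psi(0)<\infty$. Special and generic functions: $\psi\in\mathbf{S}$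 is special if $\psi(z)=a+\frac{b}{z}$ with constants $a\ge0$, $b>0$; $\psi\in\mathbf{S}^{-1}$ is special if $\psi(z)=a+bz$ with constants $a\ge0$, $b>0$. A function of $\mathbf{S}$ or $\mathbf{S}^{-1}$ that is not special is called generic. Both Taylor series converge for all $z\in\mathbb{C}$, so $F_\psi$ and $F_\psi^-$ are entire functions.
   Formalization: In part 2(b) F is additionally assumed non-constant: for a constant F = C ≠ 0 and ψ(0) = 0 the function F_ψ^- is identically zero, so it has no simple root at 0 and the printed claim fails. *)

theory Defs
  imports "HOL-Complex_Analysis.Complex_Analysis"
begin

definition laguerre_polya_I :: "(complex \<Rightarrow> complex) set" where
  "laguerre_polya_I = {F. F holomorphic_on UNIV \<and>
     (\<exists>(C::real) (m::nat) (\<alpha>::real) (\<delta>::nat \<Rightarrow> real).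
        C \<noteq> 0 \<and> \<alpha> \<ge> 0 \<and> (\<forall>\<nu>. \<delta> \<nu> \<ge> 0) \<and> summable \<delta> \<and>
        (\<forall>z. F z = of_real C * z ^ m * exp (of_real \<alpha> * z)
                     * prodinf (\<lambda>\<nu>. 1 + of_real (\<delta> \<nu>) * z)))}"

text \<open>
  The logarithm of the modulus takes the value \<open>-\<infinity>\<close> at zeros. The convention
  \<open>ln 0 = 0\<close> of the real logarithm would give wrong upper limits for functions
  with infinitely many zeros on a ray.
\<close>

definition ln_modulus :: "complex \<Rightarrow> ereal" where
  "ln_modulus w = (if w = 0 then -\<infinity> else ereal (ln (norm w)))"

definition at_most_exponential_growth :: "(complex \<Rightarrow> complex) \<Rightarrow> bool" where
  "at_most_exponential_growth \<Phi> \<longleftrightarrow>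
     Limsup at_infinity (\<lambda>z. ln_modulus (\<Phi> z) / ereal (norm z)) < \<infinity>"

definition indicator_fn :: "(complex \<Rightarrow> complex) \<Rightarrow> real \<Rightarrow> ereal" where
  "indicator_fn \<Phi> \<theta> =
     Limsup at_top (\<lambda>r::real. ln_modulus (\<Phi> (of_real r * cis \<theta>)) / ereal r)"

definition hurwitz_stable :: "(complex \<Rightarrow> complex) \<Rightarrow> bool" where
  "hurwitz_stable \<Phi> \<longleftrightarrow>
     \<Phi> holomorphic_on UNIV \<and>
     at_most_exponential_growth \<Phi> \<and>
     (\<forall>z. \<Phi> z = 0 \<longrightarrow> Re z < 0) \<and>
     indicator_fn \<Phi> 0 \<ge> indicator_fn \<Phi> pi"

text \<open>
  Elements of the Stieltjes classes are functions on the slit plane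
  \<open>- \<real>\<^sub>\<le>\<^sub>0\<close>; the values of the total HOL function on the slit are never used.
\<close>

definition stieltjes :: "(complex \<Rightarrow> complex) set" where
  "stieltjes = {\<psi>. \<psi> holomorphic_on (- \<real>\<^sub>\<le>\<^sub>0) \<and>
     \<not> \<psi> constant_on (- \<real>\<^sub>\<le>\<^sub>0) \<and>
     (\<forall>x::real. x > 0 \<longrightarrow> \<psi> (of_real x) \<in> \<real> \<and> Re (\<psi> (of_real x)) > 0) \<and>
     (\<forall>z \<in> - \<real>\<^sub>\<le>\<^sub>0. Im z \<ge> 0 \<longrightarrow> Im (\<psi> z) \<le> 0)}"

definition stieltjes_inv :: "(complex \<Rightarrow> complex) set" where
  "stieltjes_inv = {\<psi>. \<psi> holomorphic_on (- \<real>\<^sub>\<le>\<^sub>0) \<and>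
     \<not> \<psi> constant_on (- \<real>\<^sub>\<le>\<^sub>0) \<and>
     (\<forall>x::real. x > 0 \<longrightarrow> \<psi> (of_real x) \<in> \<real> \<and> Re (\<psi> (of_real x)) > 0) \<and>
     (\<forall>z \<in> - \<real>\<^sub>\<le>\<^sub>0. Im z \<ge> 0 \<longrightarrow> Im (\<psi> z) \<ge> 0)}"

definition special_stieltjes :: "(complex \<Rightarrow> complex) \<Rightarrow> bool" where
  "special_stieltjes \<psi> \<longleftrightarrow>
     (\<exists>(a::real) (b::real). a \<ge> 0 \<and> b > 0 \<and>
        (\<forall>z \<in> - \<real>\<^sub>\<le>\<^sub>0. \<psi> z = of_real a + of_real b / z))"

definition special_stieltjes_inv :: "(complex \<Rightarrow> complex) \<Rightarrow> bool" where
  "special_stieltjes_inv \<psi> \<longleftrightarrow>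
     (\<exists>(a::real) (b::real). a \<ge> 0 \<and> b > 0 \<and>
        (\<forall>z \<in> - \<real>\<^sub>\<le>\<^sub>0. \<psi> z = of_real a + of_real b * z))"

definition value_at_0 :: "(complex \<Rightarrow> complex) \<Rightarrow> complex" where
  "value_at_0 \<psi> = Lim (at_right 0) (\<lambda>t::real. \<psi> (of_real t))"

definition multiplier :: "(complex \<Rightarrow> complex) \<Rightarrow> (nat \<Rightarrow> complex) \<Rightarrow> complex \<Rightarrow> complex" where
  "multiplier \<psi> f z = (\<Sum>k. \<psi> (of_nat (k + 1)) * f k * z ^ k)"

definition multiplier_inv :: "(complex \<Rightarrow> complex) \<Rightarrow> (nat \<Rightarrow> complex) \<Rightarrow> complex \<Rightarrow> complex" where
  "multiplier_inv \<psi> f z =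
     (\<Sum>k. (if k = 0 then value_at_0 \<psi> else \<psi> (of_nat k)) * f k * z ^ k)"

definition simple_root :: "(complex \<Rightarrow> complex) \<Rightarrow> complex \<Rightarrow> bool" where
  "simple_root \<Phi> a \<longleftrightarrow> \<Phi> a = 0 \<and> isolated_zero \<Phi> a \<and> zorder \<Phi> a = 1"

end

theory Submission
  imports Defs "HOL-Computational_Algebra.Fundamental_Theorem_Algebra" "HOL-Probability.Helly_Selection"
    "HOL-Real_Asymp.Real_Asymp"
begin

text \<open>
  Only the roots are difficult; growth and the indicator condition follow from the Taylor
  coefficients of \<open>F\<close> having one sign. In the model case \<open>\<psi>(x) = 1 / (x + t)\<close> one has
  \<open>F\<^sub>\<psi>(z) = \<integral>\<^sub>0\<^sup>1 x\<^sup>t F(x z) dx\<close>. For \<open>Re z \<ge> 0\<close> and \<open>Im z > 0\<close> the modulus of \<open>F(x z)\<close> increases in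
  \<open>x\<close>, and its argument is increasing and concave. The primitive of \<open>x\<^sup>t F(x z)\<close> is therefore a
  curve of decreasing curvature, which stays on one side of its tangent at the end point. This gives
  \<open>Im (F\<^sub>\<psi>(z) / F(z)) \<le> 0\<close>, strictly if \<open>t > 0\<close>. The required properties of \<open>z F'(x z) / F(x z)\<close>
  are inherited from polynomials with negative roots. A general \<open>\<psi>\<close> is a superposition of model cases
  by Herglotz' representation theorem, and \<open>\<psi>\<close> is special exactly if the measure is concentrated at
  \<open>t = 0\<close>. For the class \<open>S\<^sup>-\<^sup>1\<close> the function \<open>\<phi>(z) = (\<psi>(z) - \<psi>(0)) / z\<close> belongs to \<open>S\<close>, one has
  \<open>F\<^sub>\<psi>\<^sup>-(z) = \<psi>(0) F(z) + z (F')\<^sub>\<phi>(z)\<close>, and dividing by \<open>z F'(z)\<close> both terms have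
  non-positive imaginary part.
\<close>

section \<open>Limits of polynomials with negative roots\<close>

text \<open>Absence of roots is not inherited by sums of functions. The condition that F_psi(z) /
  F(z) lies in the closed lower half-plane is, since the denominator does not depend on psi; this is
  why the estimates are made for quotients. The boundary case cannot be avoided: F = exp and psi(z)
  = 1/z give (exp z - 1) / z, with roots 2 pi i k on the imaginary axis. So equality has to be
  traced back through the integral to the measure. Strict inequalities are also lost when
  polynomials converge to F. They are recovered from lower bounds that hold along the whole
  sequence, or by arguing with the limit itself. The quotients are used only for Re z >= 0 and Im z
  > 0: on the half-line from 0 to infinity the positive coefficients suffice, and the fourth
  quadrant follows by conjugation. A constant F has zero logarithmic derivative, so its curve does
  not turn at all; it is treated apart.\<close>

definition neg_rooted :: "complex poly set" where
  "neg_rooted = {p. poly p 0 \<in> \<real>\<^sub>\<ge>\<^sub>0 \<and> (\<forall>z. poly p z = 0 \<longrightarrow> z \<in> \<real>\<^sub>\<le>\<^sub>0 - {0})}"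

text \<open>Indexed by \<open>d = -1 / x\<close> for the roots \<open>x\<close>, so that the value
  at \<open>0\<close> is \<open>1\<close>, the derivative at \<open>0\<close> is
  \<open>sum_mset A\<close>, and an entry \<open>d = 0\<close> is a harmless factor
  \<open>1\<close>. Vanishing parameters of a Laguerre-Polya product can then stay in the
  multiset.\<close>

definition linprod :: "real multiset \<Rightarrow> complex poly" where
  "linprod A = (\<Prod>d\<in>#A. [:1, of_real d:])"

lemma linprod_add: "linprod (add_mset d A) = [:1, of_real d:] * linprod A"
  and linprod_empty [simp]: "linprod {#} = 1"
  by (auto simp: linprod_def)

lemma poly_linprod_add [simp]:
  "poly (linprod (add_mset d A)) z = (1 + z * of_real d) * poly (linprod A) z"
  unfolding linprod_add poly_mult by simp

lemma poly_linprod_0 [simp]: "poly (linprod A) 0 = 1"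
  by (induction A) auto

lemma neg_rooted_smult_linprod:
  assumes "c > 0" "\<And>d. d \<in># A \<Longrightarrow> d \<ge> 0"
  shows "smult (of_real c) (linprod A) \<in> neg_rooted"
proof -
  have "z \<in> \<real>\<^sub>\<le>\<^sub>0 - {0}" if "poly (linprod A) z = 0" for z
    using that assms(2)
  proof (induction A)
    case (add d A)
    show ?case
    proof (cases "1 + z * of_real d = 0")
      case True
      have "d \<noteq> 0" using True by auto
      with add.prems(2)[of d] have "d > 0" by auto
      have "z = of_real (- 1 / d)"
        using True \<open>d > 0\<close> by (simp add: field_simps add_eq_0_iff)
      moreover have "- 1 / d \<le> 0" using \<open>d > 0\<close> by simp
      ultimately have "z \<in> \<real>\<^sub>\<le>\<^sub>0" by (simp only: nonpos_Reals_of_real_iff)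
      thus ?thesis using True by auto
    qed (use add in auto)
  qed auto
  thus ?thesis using assms(1) by (auto simp: neg_rooted_def)
qed

lemma neg_rooted_factor:
  assumes "p \<in> neg_rooted"
  obtains c A where "c > 0" "\<And>d. d \<in># A \<Longrightarrow> d > 0" "p = smult (of_real c) (linprod A)"
proof -
  have p0: "poly p 0 \<noteq> 0" using assms by (auto simp: neg_rooted_def)
  hence "p \<noteq> 0" by auto
  have eq: "smult (lead_coeff p) (\<Prod>x\<in>#proots p. [:-x, 1:]) = p"
    by (rule complex_poly_decompose_multiset)
  have roots: "x \<in> \<real>\<^sub>\<le>\<^sub>0 - {0}" if "x \<in># proots p" for x
    using that assms \<open>p \<noteq> 0\<close> by (auto simp: neg_rooted_def)
  define A where "A = image_mset (\<lambda>x. - 1 / Re x) (proots p)"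
  \<comment> \<open>A monic factor with root \<open>x\<close> is \<open>-x\<close> times the factor
    with \<open>d = -1 / x\<close>. The collected constant need not be computed: it is identified
    below as the value at \<open>0\<close>, which is positive.\<close>
  have "(\<Prod>x\<in>#R. [:-x, 1:]) = smult (\<Prod>x\<in>#R. -x) (linprod (image_mset (\<lambda>x. - 1 / Re x) R))"
    if "\<And>x. x \<in># R \<Longrightarrow> x \<in> \<real>\<^sub>\<le>\<^sub>0 - {0}" for R
    using that
  proof (induction R)
    case (add x R)
    have "x \<in> \<real>\<^sub>\<le>\<^sub>0 - {0}" using add.prems[of x] by auto
    then obtain r where r: "x = of_real r" "r < 0"
      by (auto elim!: nonpos_Reals_cases simp: less_le)
    have "[:-x, 1:] = smult (-x) [:1, of_real (- 1 / Re x):]"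
      using r by simp
    moreover have "(\<Prod>x\<in>#R. [:-x, 1:]) = smult (\<Prod>x\<in>#R. -x) (linprod (image_mset (\<lambda>x. - 1 / Re x) R))"
      by (rule add.IH) (use add.prems in auto)
    ultimately show ?case by (simp add: linprod_add mult_ac del: smult_pCons)
  qed auto
  from this[of "proots p"] roots have "(\<Prod>x\<in>#proots p. [:-x, 1:]) = smult (\<Prod>x\<in>#proots p. -x) (linprod A)"
    by (simp add: A_def)
  with eq obtain c where c: "p = smult c (linprod A)" by (metis smult_smult)
  have "c = poly p 0" by (subst c) simp
  moreover have "poly p 0 \<in> \<real>\<^sub>\<ge>\<^sub>0" using assms by (auto simp: neg_rooted_def)
  ultimately obtain r where r: "c = of_real r" "r > 0" using p0
    by (auto elim!: nonneg_Reals_cases simp: less_le)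
  have "d > 0" if d: "d \<in># A" for d
  proof -
    obtain x where x: "x \<in># proots p" "d = -1 / Re x" using d by (auto simp: A_def)
    with roots[of x] show ?thesis
      by (auto elim!: nonpos_Reals_cases simp: less_le divide_less_0_iff)
  qed
  with r c that show ?thesis by blast
qed

lemma norm_one_plus_ge_1:
  assumes "d \<ge> 0" "Re z \<ge> 0"
  shows "norm (1 + z * of_real d) \<ge> 1"
proof -
  have "1 \<le> Re (1 + z * of_real d)" using assms by simp
  also have "\<dots> \<le> norm (1 + z * of_real d)" by (rule complex_Re_le_cmod)
  finally show ?thesis .
qed

lemma norm_linprod_ge_1:
  assumes "\<And>d. d \<in># A \<Longrightarrow> d \<ge> 0" "Re z \<ge> 0"
  shows "norm (poly (linprod A) z) \<ge> 1"
  using assms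
proof (induction A)
  case (add d A)
  have "1 * 1 \<le> norm (1 + z * of_real d) * norm (poly (linprod A) z)"
    using add.prems by (intro mult_mono norm_one_plus_ge_1 add.IH) auto
  thus ?case by (simp add: norm_mult)
qed auto

lemma norm_linprod_le:
  assumes "\<And>d. d \<in># A \<Longrightarrow> d \<ge> 0"
  shows "norm (poly (linprod A) z) \<le> exp (sum_mset A * norm z)"
  using assms
proof (induction A)
  case (add d A)
  have "norm (1 + z * of_real d) \<le> 1 + d * norm z"
    using norm_triangle_ineq[of 1 "z * of_real d"] add.prems[of d] by (simp add: norm_mult mult_ac)
  also have "\<dots> \<le> exp (d * norm z)" by (rule exp_ge_add_one_self)
  finally have "norm (1 + z * of_real d) \<le> exp (d * norm z)" .
  hence "norm (1 + z * of_real d) * norm (poly (linprod A) z) \<le> exp (d * norm z) * exp (sum_mset A * norm z)"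
    using add.prems by (intro mult_mono add.IH) auto
  also have "\<dots> = exp (sum_mset (add_mset d A) * norm z)" by (simp add: exp_add distrib_right)
  finally show ?case by (simp add: norm_mult)
qed auto

lemma coeff_linprod_nonneg:
  assumes "\<And>d. d \<in># A \<Longrightarrow> d \<ge> 0"
  shows "coeff (linprod A) k \<in> \<real>\<^sub>\<ge>\<^sub>0"
  using assms
proof (induction A arbitrary: k)
  case empty
  show ?case by (cases k) (auto simp: one_pCons)
next
  case (add d A)
  show ?case using add
    by (cases k) (auto simp: linprod_add intro!: nonneg_Reals_add_I nonneg_Reals_mult_I)
qed

lemma pderiv_linprod:
  assumes "poly (linprod A) z \<noteq> 0"
  shows "poly (pderiv (linprod A)) z = poly (linprod A) z * (\<Sum>d\<in>#A. of_real d / (1 + of_real d * z))"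
  using assms
proof (induction A)
  case (add d A)
  define u where "u = 1 + z * of_real d"
  have u: "u \<noteq> 0" and nz: "poly (linprod A) z \<noteq> 0" using add.prems unfolding u_def by auto
  have "poly (pderiv (linprod (add_mset d A))) z =
      of_real d * poly (linprod A) z + u * poly (pderiv (linprod A)) z"
    unfolding linprod_add pderiv_mult u_def by (simp add: pderiv_pCons algebra_simps)
  also have "\<dots> = u * poly (linprod A) z * (of_real d / u + (\<Sum>d\<in>#A. of_real d / (1 + of_real d * z)))"
    using u by (simp add: add.IH[OF nz] field_simps)
  finally show ?case by (simp add: u_def mult.commute)
qed auto

lemma sum_mset_Re: "Re (\<Sum>d\<in>#A. f d) = (\<Sum>d\<in>#A. Re (f d))"
  and sum_mset_Im: "Im (\<Sum>d\<in>#A. f d) = (\<Sum>d\<in>#A. Im (f d))"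
  by (induction A) auto

lemma sum_mset_mono': "(\<And>x. x \<in># A \<Longrightarrow> f x \<le> (g x :: real)) \<Longrightarrow> (\<Sum>x\<in>#A. f x) \<le> (\<Sum>x\<in>#A. g x)"
  by (induction A) (auto intro: add_mono)

text \<open>With w = 1 + d x z, the product of z and the conjugate of w is z + d x |z|^2. Its
  imaginary part is exactly \<open>Im z\<close>, so the imaginary part of the quotient depends on
  \<open>x\<close> only through the modulus of w.\<close>

lemma log_deriv_term:
  fixes d x :: real
  assumes "d \<ge> 0" "x \<ge> 0" "Re z \<ge> 0" "Im z > 0"
  shows "Re (z * (of_real d / (1 + of_real d * (of_real x * z)))) \<ge> 0"
    and "Im (z * (of_real d / (1 + of_real d * (of_real x * z)))) = d * Im z / (norm (1 + of_real (d * x) * z))\<^sup>2"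
    and "norm (1 + of_real (d * x) * z) \<ge> 1"
proof -
  define w where "w = 1 + of_real (d * x) * z"
  have w: "norm w \<ge> 1" using norm_one_plus_ge_1[of "d * x" z] assms by (simp add: w_def mult.commute)
  thus "norm (1 + of_real (d * x) * z) \<ge> 1" by (simp add: w_def)
  have *: "z * (of_real d / (1 + of_real d * (of_real x * z))) = of_real (d / (norm w)\<^sup>2) * (z * cnj w)"
  proof -
    have "w \<noteq> 0" using w by auto
    have "z * (of_real d / (1 + of_real d * (of_real x * z))) = z * of_real d / w"
      by (simp add: w_def mult_ac)
    also have "\<dots> = of_real d * (z * cnj w) / (w * cnj w)"
      using \<open>w \<noteq> 0\<close> by (simp add: field_simps)
    also have "w * cnj w = of_real ((norm w)\<^sup>2)" by (simp only: complex_norm_square)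
    finally show ?thesis by simp
  qed
  have Re_mult: "Re (of_real a * u) = a * Re u" for a u by simp
  have "Re (z * cnj w) = Re z + d * x * (norm z)\<^sup>2"
    unfolding cmod_power2 by (simp add: w_def algebra_simps power2_eq_square)
  thus "Re (z * (of_real d / (1 + of_real d * (of_real x * z)))) \<ge> 0"
    using assms unfolding * Re_mult by simp
  have Im_mult: "Im (of_real a * u) = a * Im u" for a u by simp
  have "Im (z * cnj w) = Im z"
    by (simp add: w_def algebra_simps)
  hence "Im (of_real (d / (norm w)\<^sup>2) * (z * cnj w)) = d / (norm w)\<^sup>2 * Im z"
    by (simp only: Im_mult)
  thus "Im (z * (of_real d / (1 + of_real d * (of_real x * z)))) = d * Im z / (norm (1 + of_real (d * x) * z))\<^sup>2"
    unfolding * by (simp only: w_def times_divide_eq_left)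
qed

lemma sum_mset_pos:
  fixes f :: "'a \<Rightarrow> real"
  shows "A \<noteq> {#} \<Longrightarrow> (\<And>x. x \<in># A \<Longrightarrow> f x > 0) \<Longrightarrow> (\<Sum>x\<in>#A. f x) > 0"
proof (induction A)
  case (add x A)
  thus ?case by (cases "A = {#}") (auto intro!: add_pos_pos)
qed auto

text \<open>A Gauss-Lucas argument for the logarithmic derivative, the sum of d / (1 + d z). Off the
  real axis every term has imaginary part of sign opposite to \<open>Im z\<close>; at real z >= 0
  every term is positive. Hence the sum can vanish only at negative real numbers.\<close>

lemma neg_rooted_pderiv:
  assumes "p \<in> neg_rooted" "pderiv p \<noteq> 0"
  shows "pderiv p \<in> neg_rooted"
proof -
  obtain c A where A: "c > 0" "\<And>d. d \<in># A \<Longrightarrow> d > 0" "p = smult (of_real c) (linprod A)"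
    using neg_rooted_factor[OF assms(1)] by metis
  have "A \<noteq> {#}" using assms(2) A(3) by (auto simp: pderiv_smult)
  have "poly (pderiv p) 0 = of_real c * (\<Sum>d\<in>#A. of_real d)"
    unfolding A(3) pderiv_smult by (simp add: pderiv_linprod)
  also have "(\<Sum>d\<in>#A. complex_of_real d) = of_real (\<Sum>d\<in>#A. d)" by (induction A) auto
  finally have 1: "poly (pderiv p) 0 \<in> \<real>\<^sub>\<ge>\<^sub>0"
    using sum_mset_pos[OF \<open>A \<noteq> {#}\<close>, of "\<lambda>x. x"] A by (simp flip: of_real_mult)
  have 2: "z \<in> \<real>\<^sub>\<le>\<^sub>0 - {0}" if z: "poly (pderiv p) z = 0" for z
  proof (cases "poly (linprod A) z = 0")
    case True
    with assms(1) show ?thesis by (auto simp: neg_rooted_def A(3))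
  next
    case False
    have nz: "1 + of_real d * z \<noteq> 0" if "d \<in># A" for d
      using multi_member_split[OF that] False by (auto simp: mult.commute)
    have S: "(\<Sum>d\<in>#A. of_real d / (1 + of_real d * z)) = 0"
      using z False A(1) by (simp add: A(3) pderiv_smult pderiv_linprod)
    show ?thesis
    proof (rule ccontr)
      assume z': "z \<notin> \<real>\<^sub>\<le>\<^sub>0 - {0}"
      have im: "Im (of_real d / (1 + of_real d * z)) = - Im z * (d\<^sup>2 / (norm (1 + of_real d * z))\<^sup>2)" for d
        by (simp add: Im_divide cmod_power2) (simp add: power2_eq_square)
      have "0 = (\<Sum>d\<in>#A. Im (of_real d / (1 + of_real d * z)))"
        using arg_cong[OF S, of Im] by (simp only: sum_mset_Im zero_complex.simps)
      also have "\<dots> = - Im z * (\<Sum>d\<in>#A. d\<^sup>2 / (norm (1 + of_real d * z))\<^sup>2)"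
        unfolding im by (simp add: sum_mset_distrib_left)
      finally have "Im z = 0"
        using sum_mset_pos[OF \<open>A \<noteq> {#}\<close>, of "\<lambda>d. d\<^sup>2 / (norm (1 + of_real d * z))\<^sup>2"] A(2) nz
        by force
      with z' have Re: "Re z \<ge> 0" by (auto simp: complex_nonpos_Reals_iff complex_eq_iff)
      have re: "Re (of_real d / (1 + of_real d * z)) > 0" if "d \<in># A" for d
      proof -
        have "d > 0" using A(2) that by auto
        have "z = of_real (Re z)" using \<open>Im z = 0\<close> by (auto simp: complex_eq_iff)
        hence "1 + of_real d * z = of_real (1 + d * Re z)" by (metis of_real_1 of_real_add of_real_mult)
        hence "Re (of_real d / (1 + of_real d * z)) = d / (1 + d * Re z)"
          by (simp only: of_real_divide[symmetric] Re_complex_of_real)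
        thus ?thesis using \<open>d > 0\<close> Re by (simp add: add_pos_nonneg)
      qed
      have "0 < (\<Sum>d\<in>#A. Re (of_real d / (1 + of_real d * z)))"
        by (rule sum_mset_pos[OF \<open>A \<noteq> {#}\<close>]) (use re in blast)
      also have "\<dots> = 0"
        using arg_cong[OF S, of Re] by (simp only: sum_mset_Re zero_complex.simps)
      finally show False by simp
    qed
  qed
  from 1 2 show ?thesis by (auto simp: neg_rooted_def)
qed

section \<open>Limits of polynomials with negative roots: growth and logarithmic derivative\<close>

text \<open>Convergence of all derivatives is demanded only pointwise, which makes closure under
  differentiation immediate from the polynomial case.\<close>

definition LPplus :: "(complex \<Rightarrow> complex) set" where
  "LPplus = {G. G holomorphic_on UNIV \<and> G 0 \<noteq> 0 \<and>
     (\<exists>p. (\<forall>n. p n \<in> neg_rooted) \<and>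
        (\<forall>k z. (\<lambda>n. poly ((pderiv ^^ k) (p n)) z) \<longlonglongrightarrow> (deriv ^^ k) G z))}"

lemma LPplus_approx:
  assumes "G \<in> LPplus"
  shows "\<exists>c A. (\<forall>n. c n > 0) \<and> (\<forall>n d. d \<in># A n \<longrightarrow> d > 0) \<and>
    (\<forall>k z. (\<lambda>n. of_real (c n) * poly ((pderiv ^^ k) (linprod (A n))) z) \<longlonglongrightarrow> (deriv ^^ k) G z)"
proof -
  obtain p where p: "\<And>n. p n \<in> neg_rooted"
    "\<And>k z. (\<lambda>n. poly ((pderiv ^^ k) (p n)) z) \<longlonglongrightarrow> (deriv ^^ k) G z"
    using assms by (auto simp: LPplus_def)
  have "\<forall>n. \<exists>cA. fst cA > 0 \<and> (\<forall>d. d \<in># snd cA \<longrightarrow> d > 0) \<and> p n = smult (of_real (fst cA)) (linprod (snd cA))"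
    using neg_rooted_factor[OF p(1)] by (metis fst_conv snd_conv)
  then obtain cA where cA: "\<And>n. fst (cA n) > 0" "\<And>n d. d \<in># snd (cA n) \<Longrightarrow> d > 0"
    "\<And>n. p n = smult (of_real (fst (cA n))) (linprod (snd (cA n)))"
    by metis
  show ?thesis
    by (rule exI[of _ "\<lambda>n. fst (cA n)"], rule exI[of _ "\<lambda>n. snd (cA n)"])
       (use cA(1,2) p(2) in \<open>auto simp: cA(3) higher_pderiv_smult\<close>)
qed

lemma LPplus_deriv:
  assumes "G \<in> LPplus" "deriv G 0 \<noteq> 0"
  shows "deriv G \<in> LPplus"
proof -
  obtain p where p: "\<And>n. p n \<in> neg_rooted"
    "\<And>k z. (\<lambda>n. poly ((pderiv ^^ k) (p n)) z) \<longlonglongrightarrow> (deriv ^^ k) G z"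
    using assms by (auto simp: LPplus_def)
  have "(\<lambda>n. poly (pderiv (p n)) 0) \<longlonglongrightarrow> deriv G 0" using p(2)[of 1 0] by simp
  \<comment> \<open>Early approximants may be constant, and \<open>neg_rooted\<close> does not
    contain the zero polynomial. Only finitely many indices are affected, so they are cut
    off.\<close>
  hence "eventually (\<lambda>n. poly (pderiv (p n)) 0 \<noteq> 0) sequentially"
    using assms(2) tendsto_imp_eventually_ne by blast
  then obtain N where N: "\<And>n. n \<ge> N \<Longrightarrow> poly (pderiv (p n)) 0 \<noteq> 0"
    by (auto simp: eventually_sequentially)
  have "pderiv (p (n + N)) \<in> neg_rooted" for n
    by (rule neg_rooted_pderiv[OF p(1)]) (use N[of "n + N"] in auto)
  moreover have "(\<lambda>n. poly ((pderiv ^^ k) (pderiv (p (n + N)))) z) \<longlonglongrightarrow> (deriv ^^ k) (deriv G) z" for k z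
    using LIMSEQ_ignore_initial_segment[OF p(2)[of "Suc k" z], of N] by (simp add: funpow_swap1)
  moreover have "deriv G holomorphic_on UNIV"
    using assms by (auto simp: LPplus_def intro: holomorphic_deriv)
  ultimately show ?thesis using assms(2)
    by (auto simp: LPplus_def intro!: exI[of _ "\<lambda>n. pderiv (p (n + N))"])
qed

lemma coeff_0_higher_pderiv: "poly ((pderiv ^^ k) p) 0 = fact k * coeff p k"
  by (simp add: poly_0_coeff_0 coeff_higher_pderiv pochhammer_fact)

lemma LPplus_higher_deriv_0:
  assumes "G \<in> LPplus"
  shows "(deriv ^^ k) G 0 \<in> \<real>\<^sub>\<ge>\<^sub>0"
proof -
  obtain c A where "\<forall>n. c n > 0" "\<forall>n d. d \<in># A n \<longrightarrow> d > 0"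
    "\<forall>k z. (\<lambda>n. of_real (c n) * poly ((pderiv ^^ k) (linprod (A n))) z) \<longlonglongrightarrow> (deriv ^^ k) G z"
    using LPplus_approx[OF assms] by (elim exE conjE) (rule that)
  note cA = this[rule_format]
  have A_nonneg: "d \<ge> 0" if "d \<in># A n" for d n using cA(2)[OF that] by simp
  have "of_real (c n) * poly ((pderiv ^^ k) (linprod (A n))) 0 \<in> \<real>\<^sub>\<ge>\<^sub>0" for n
  proof -
    have "complex_of_real (c n) \<in> \<real>\<^sub>\<ge>\<^sub>0" using cA(1)[of n] by simp
    moreover have "(fact k :: complex) \<in> \<real>\<^sub>\<ge>\<^sub>0"
      by (metis nonneg_Reals_of_nat_I of_nat_fact)
    ultimately show ?thesis
      unfolding coeff_0_higher_pderiv
      by (intro nonneg_Reals_mult_I coeff_linprod_nonneg[OF A_nonneg])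
  qed
  thus ?thesis
    by (intro Lim_in_closed_set[OF closed_nonneg_Reals_complex _ _ cA(3)]) auto
qed

lemma LPplus_0:
  assumes "G \<in> LPplus"
  obtains c where "c > 0" "G 0 = of_real c"
proof -
  have "G 0 \<in> \<real>\<^sub>\<ge>\<^sub>0" "G 0 \<noteq> 0" using LPplus_higher_deriv_0[OF assms, of 0] assms by (auto simp: LPplus_def)
  with that show ?thesis by (auto elim!: nonneg_Reals_cases simp: less_le)
qed

text \<open>Non-vanishing alone could be lost in the limit. In the right half-plane every factor has
  modulus at least \<open>1\<close>, which yields a lower bound by the value at \<open>0\<close>,
  and that bound survives.\<close>

lemma LPplus_norm_ge:
  assumes "G \<in> LPplus" "Re z \<ge> 0"
  shows "norm (G z) \<ge> norm (G 0)"
proof -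
  obtain c A where "\<forall>n. c n > 0" "\<forall>n d. d \<in># A n \<longrightarrow> d > 0"
    "\<forall>k z. (\<lambda>n. of_real (c n) * poly ((pderiv ^^ k) (linprod (A n))) z) \<longlonglongrightarrow> (deriv ^^ k) G z"
    using LPplus_approx[OF assms(1)] by (elim exE conjE) (rule that)
  note cA = this[rule_format]
  have A_nonneg: "d \<ge> 0" if "d \<in># A n" for d n using cA(2)[OF that] by simp
  have lim: "(\<lambda>n. norm (of_real (c n) * poly (linprod (A n)) z)) \<longlonglongrightarrow> norm (G z)" for z
    using tendsto_norm[OF cA(3)[of 0 z]] by simp
  show ?thesis
  proof (rule LIMSEQ_le[OF lim lim], intro exI allI impI)
    fix n
    have "c n * 1 \<le> c n * norm (poly (linprod (A n)) z)"
      by (rule mult_left_mono[OF norm_linprod_ge_1[OF A_nonneg assms(2)] less_imp_le[OF cA(1)]])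
    thus "norm (of_real (c n) * poly (linprod (A n)) 0) \<le> norm (of_real (c n) * poly (linprod (A n)) z)"
      using cA(1)[of n] by (simp add: norm_mult)
  qed
qed

lemma LPplus_nonzero: "G \<in> LPplus \<Longrightarrow> Re z \<ge> 0 \<Longrightarrow> G z \<noteq> 0"
  using LPplus_norm_ge[of G z] by (auto simp: LPplus_def)

lemma pderiv_linprod_0: "poly (pderiv (linprod A)) 0 = of_real (sum_mset A)"
proof -
  have "(\<Sum>d\<in>#A. complex_of_real d) = of_real (sum_mset A)" by (induction A) auto
  thus ?thesis by (simp add: pderiv_linprod)
qed

text \<open>The logarithmic derivative of a product at \<open>0\<close> is the sum of its
  \<open>d\<close>, and forming it cancels the unknown constants \<open>c n\<close>. The limit
  serves as a bound for the exponential type of \<open>G\<close>.\<close>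

lemma LPplus_sum_tendsto:
  assumes "G 0 \<noteq> 0" "\<And>n. c n > 0"
    "\<And>k z. (\<lambda>n. of_real (c n) * poly ((pderiv ^^ k) (linprod (A n))) z) \<longlonglongrightarrow> (deriv ^^ k) G z"
  shows "(\<lambda>n. sum_mset (A n)) \<longlonglongrightarrow> Re (deriv G 0 / G 0)"
proof -
  have "(\<lambda>n. (of_real (c n) * poly ((pderiv ^^ 1) (linprod (A n))) 0) / (of_real (c n) * poly ((pderiv ^^ 0) (linprod (A n))) 0))
      \<longlonglongrightarrow> ((deriv ^^ 1) G 0) / ((deriv ^^ 0) G 0)"
    by (intro tendsto_divide assms(3)) (use assms(1) in auto)
  hence "(\<lambda>n. complex_of_real (sum_mset (A n))) \<longlonglongrightarrow> deriv G 0 / G 0"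
    using assms(2)[THEN less_imp_neq] by (simp add: pderiv_linprod_0)
  from tendsto_Re[OF this] show ?thesis by simp
qed

lemma LPplus_norm_le:
  assumes "G \<in> LPplus"
  shows "norm (G z) \<le> norm (G 0) * exp (Re (deriv G 0 / G 0) * norm z)"
proof -
  obtain c A where "\<forall>n. c n > 0" "\<forall>n d. d \<in># A n \<longrightarrow> d > 0"
    "\<forall>k z. (\<lambda>n. of_real (c n) * poly ((pderiv ^^ k) (linprod (A n))) z) \<longlonglongrightarrow> (deriv ^^ k) G z"
    using LPplus_approx[OF assms(1)] by (elim exE conjE) (rule that)
  note cA = this[rule_format]
  have A_nonneg: "d \<ge> 0" if "d \<in># A n" for d n using cA(2)[OF that] by simp
  have "G 0 \<noteq> 0" using assms by (auto simp: LPplus_def)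
  have lim: "(\<lambda>n. norm (of_real (c n) * poly (linprod (A n)) z)) \<longlonglongrightarrow> norm (G z)" for z
    using tendsto_norm[OF cA(3)[of 0 z]] by simp
  have "(\<lambda>n. norm (of_real (c n) * poly (linprod (A n)) 0) * exp (sum_mset (A n) * norm z))
      \<longlonglongrightarrow> norm (G 0) * exp (Re (deriv G 0 / G 0) * norm z)"
    by (rule tendsto_mult[OF lim tendsto_exp[OF tendsto_mult[OF
          LPplus_sum_tendsto[OF \<open>G 0 \<noteq> 0\<close> cA(1,3)] tendsto_const]]])
  from lim[of z] this show ?thesis
  proof (rule LIMSEQ_le, intro exI allI impI)
    fix n
    show "norm (of_real (c n) * poly (linprod (A n)) z)
         \<le> norm (of_real (c n) * poly (linprod (A n)) 0) * exp (sum_mset (A n) * norm z)"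
    proof -
      have "norm (poly (linprod (A n)) z) \<le> exp (sum_mset (A n) * norm z)"
        by (rule norm_linprod_le[OF A_nonneg])
      thus ?thesis using cA(1)[of n] by (simp add: norm_mult)
    qed
  qed
qed

text \<open>\<open>q\<close> is the derivative of ln G(x z) in \<open>x\<close>: its real part
  governs the modulus, its imaginary part the speed of the argument. The first two claims hold for
  each factor and pass to the limit; the strict one needs a bound of its own.\<close>

lemma LPplus_log_deriv:
  fixes x y :: real
  assumes G: "G \<in> LPplus" and z: "Re z \<ge> 0" "Im z > 0" and x: "x \<ge> 0"
  defines "q \<equiv> \<lambda>x. z * deriv G (of_real x * z) / G (of_real x * z)"
  shows "Re (q x) \<ge> 0"
    and "x \<le> y \<Longrightarrow> Im (q y) \<le> Im (q x)"
    and "deriv G 0 \<noteq> 0 \<Longrightarrow> Im (q x) > 0"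
proof -
  obtain c A where "\<forall>n. c n > 0" "\<forall>n d. d \<in># A n \<longrightarrow> d > 0"
    "\<forall>k z. (\<lambda>n. of_real (c n) * poly ((pderiv ^^ k) (linprod (A n))) z) \<longlonglongrightarrow> (deriv ^^ k) G z"
    using LPplus_approx[OF G] by (elim exE conjE) (rule that)
  note cA = this[rule_format]
  have A_nonneg: "d \<ge> 0" if "d \<in># A n" for d n using cA(2)[OF that] by simp
  have "G 0 \<noteq> 0" using G by (auto simp: LPplus_def)
  define S where "S n x = (\<Sum>d\<in>#A n. z * (of_real d / (1 + of_real d * (of_real x * z))))" for n and x :: real
  have S: "(\<lambda>n. S n x) \<longlonglongrightarrow> q x" if x: "x \<ge> 0" for x
  proof -
    have nz: "poly (linprod (A n)) (of_real x * z) \<noteq> 0" for n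
    proof -
      have "norm (poly (linprod (A n)) (of_real x * z)) \<ge> 1"
        using x z by (intro norm_linprod_ge_1[OF A_nonneg]) auto
      thus ?thesis by auto
    qed
    have "(\<lambda>n. z * (of_real (c n) * poly ((pderiv ^^ 1) (linprod (A n))) (of_real x * z)) / (of_real (c n) * poly ((pderiv ^^ 0) (linprod (A n))) (of_real x * z)))
      \<longlonglongrightarrow> z * ((deriv ^^ 1) G (of_real x * z)) / ((deriv ^^ 0) G (of_real x * z))"
      by (rule tendsto_divide[OF tendsto_mult[OF tendsto_const cA(3)] cA(3)]) (use LPplus_nonzero[OF G] x z in auto)
    moreover have "z * (of_real (c n) * poly ((pderiv ^^ 1) (linprod (A n))) (of_real x * z)) / (of_real (c n) * poly ((pderiv ^^ 0) (linprod (A n))) (of_real x * z)) = S n x" for n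
    proof -
      define T where "T = (\<Sum>d\<in>#A n. of_real d / (1 + of_real d * (of_real x * z)))"
      have "S n x = z * T" by (simp add: S_def T_def sum_mset_distrib_left)
      moreover have "poly (pderiv (linprod (A n))) (of_real x * z) = poly (linprod (A n)) (of_real x * z) * T"
        unfolding T_def by (rule pderiv_linprod[OF nz])
      ultimately show ?thesis using nz[of n] cA(1)[of n] by simp
    qed
    ultimately show ?thesis by (simp add: q_def)
  qed
  have "Re (S n x) \<ge> 0" for n
  proof -
    have "0 = (\<Sum>d\<in>#A n. 0::real)" by simp
    also have "\<dots> \<le> Re (S n x)" unfolding S_def sum_mset_Re
      by (rule sum_mset_mono') (rule log_deriv_term(1)[OF A_nonneg x z])
    finally show ?thesis .
  qed
  with tendsto_Re[OF S[OF x]] show "Re (q x) \<ge> 0"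
    by (intro tendsto_lowerbound[of "\<lambda>n. Re (S n x)"]) auto
  have im: "Im (S n x) = (\<Sum>d\<in>#A n. d * Im z / (norm (1 + of_real (d * x) * z))\<^sup>2)" if "x \<ge> 0" for n x
  proof -
    have "image_mset (\<lambda>d. Im (z * (of_real d / (1 + of_real d * (of_real x * z))))) (A n) =
        image_mset (\<lambda>d. d * Im z / (norm (1 + of_real (d * x) * z))\<^sup>2) (A n)"
      by (rule image_mset_cong, rule log_deriv_term(2)[OF A_nonneg that z])
    thus ?thesis unfolding S_def sum_mset_Im by simp
  qed
  show "Im (q y) \<le> Im (q x)" if "x \<le> y"
  proof -
    have y: "y \<ge> 0" using that x by simp
    show ?thesis
    proof (rule LIMSEQ_le[OF tendsto_Im[OF S[OF y]] tendsto_Im[OF S[OF x]]], intro exI allI impI)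
      fix n
      show "Im (S n y) \<le> Im (S n x)"
        unfolding im[OF x] im[OF y]
      proof (rule sum_mset_mono')
        fix d assume d: "d \<in># A n"
        have "d > 0" using cA(2) d by auto
        \<comment> \<open>Since \<open>Re z\<close> is non-negative, this polynomial in
          \<open>t\<close> has non-negative coefficients and is therefore increasing for t >=
          0.\<close>
        have *: "(norm (1 + of_real (d * t) * z))\<^sup>2 = 1 + 2 * d * t * Re z + (d * t * norm z)\<^sup>2" for t
          unfolding power_mult_distrib cmod_power2 by (simp add: algebra_simps power2_eq_square)
        have "(norm (1 + of_real (d * x) * z))\<^sup>2 \<le> (norm (1 + of_real (d * y) * z))\<^sup>2"
          unfolding * using x y z \<open>d > 0\<close> that
          by (intro add_mono power_mono mult_right_mono mult_left_mono) auto
        moreover have "norm (1 + of_real (d * x) * z) \<ge> 1"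
          using log_deriv_term(3)[of d x z] \<open>d > 0\<close> x z by auto
        ultimately show "d * Im z / (norm (1 + of_real (d * y) * z))\<^sup>2 \<le> d * Im z / (norm (1 + of_real (d * x) * z))\<^sup>2"
          using z \<open>d > 0\<close> by (intro divide_left_mono mult_pos_pos) (auto intro!: zero_less_power)
      qed
    qed
  qed
  show "Im (q x) > 0" if d0: "deriv G 0 \<noteq> 0"
  proof -
    \<comment> \<open>Every denominator is replaced by the common larger value 1 + s x |z|, where s
      is the sum of all \<open>d\<close>. This bounds the imaginary part from below in terms of s
      alone, and s converges to the positive number \<open>B\<close>.\<close>
    define B where "B = Re (deriv G 0 / G 0)"
    obtain g0 where g0: "g0 > 0" "G 0 = of_real g0" using LPplus_0[OF G] .
    have "deriv G 0 \<in> \<real>\<^sub>\<ge>\<^sub>0" using LPplus_higher_deriv_0[OF G, of 1] by simp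
    then obtain g1 where g1: "g1 > 0" "deriv G 0 = of_real g1"
      using d0 by (auto elim!: nonneg_Reals_cases simp: less_le)
    have B: "B > 0" using g0 g1 by (simp add: B_def)
    define s where "s n = sum_mset (A n)" for n
    have s: "s \<longlonglongrightarrow> B" unfolding s_def B_def
      by (rule LPplus_sum_tendsto[OF \<open>G 0 \<noteq> 0\<close> cA(1,3)])
    have s0: "s n \<ge> 0" for n
      using sum_mset_mono'[of "A n" "\<lambda>_. 0" "\<lambda>x. x"] A_nonneg[of _ n] by (simp add: s_def)
    have 1: "0 < B * Im z / (1 + B * x * norm z)\<^sup>2"
      using B z x by (intro divide_pos_pos mult_pos_pos zero_less_power add_pos_nonneg) auto
    have "(\<lambda>n. s n * Im z / (1 + s n * x * norm z)\<^sup>2) \<longlonglongrightarrow> B * Im z / (1 + B * x * norm z)\<^sup>2"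
      using 1 by (intro tendsto_intros s) auto
    from this tendsto_Im[OF S[OF x]] have "B * Im z / (1 + B * x * norm z)\<^sup>2 \<le> Im (q x)"
    proof (rule LIMSEQ_le, intro exI allI impI)
      fix n
      have "s n * Im z / (1 + s n * x * norm z)\<^sup>2 = (\<Sum>d\<in>#A n. d * (Im z / (1 + s n * x * norm z)\<^sup>2))"
      proof -
        have "sum_mset M * y = (\<Sum>d\<in>#M. d * y)" for M and y :: real
          by (induction M) (auto simp: distrib_right)
        thus ?thesis unfolding s_def times_divide_eq_right[symmetric] by blast
      qed
      also have "\<dots> \<le> Im (S n x)" unfolding im[OF x]
      proof (rule sum_mset_mono')
        fix d assume d: "d \<in># A n"
        have "d > 0" using cA(2) d by auto
        obtain A' where A': "A n = add_mset d A'" using multi_member_split[OF d] by auto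
        have "sum_mset A' \<ge> 0"
          using sum_mset_mono'[of A' "\<lambda>_. 0" "\<lambda>x. x"] A_nonneg[of _ n] A' by simp
        hence ds: "d \<le> s n" by (simp add: s_def A')
        have "norm (1 + of_real (d * x) * z) \<le> 1 + norm (of_real (d * x) * z)"
          using norm_triangle_ineq[of 1] by (metis norm_one)
        also have "\<dots> = 1 + d * x * norm z" using \<open>d > 0\<close> x by (simp add: norm_mult)
        also have "\<dots> \<le> 1 + s n * x * norm z" using x ds by (intro add_mono mult_right_mono) auto
        finally have "norm (1 + of_real (d * x) * z) \<le> 1 + s n * x * norm z" .
        moreover have "norm (1 + of_real (d * x) * z) \<ge> 1"
          using log_deriv_term(3)[of d x z] \<open>d > 0\<close> x z by simp
        ultimately have "Im z / (1 + s n * x * norm z)\<^sup>2 \<le> Im z / (norm (1 + of_real (d * x) * z))\<^sup>2"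
          using z by (intro divide_left_mono mult_pos_pos power_mono zero_less_power) auto
        thus "d * (Im z / (1 + s n * x * norm z)\<^sup>2) \<le> d * Im z / (norm (1 + of_real (d * x) * z))\<^sup>2"
          unfolding times_divide_eq_right[symmetric] using \<open>d > 0\<close>
          by (intro mult_left_mono) simp_all
      qed
      finally show "s n * Im z / (1 + s n * x * norm z)\<^sup>2 \<le> Im (S n x)" .
    qed
    with 1 show ?thesis by simp
  qed
qed

section \<open>Polynomial approximation of Laguerre-Polya functions\<close>

lemma norm_power_diff_le:
  fixes a b :: complex
  assumes "norm a \<le> M" "norm b \<le> M"
  shows "norm (a ^ Suc n - b ^ Suc n) \<le> real (Suc n) * norm (a - b) * M ^ n"
proof (induction n)
  case (Suc n)
  have M: "M \<ge> 0" using assms norm_ge_zero order_trans by blast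
  have "a ^ Suc (Suc n) - b ^ Suc (Suc n) = a * (a ^ Suc n - b ^ Suc n) + (a - b) * b ^ Suc n"
    by (simp add: algebra_simps)
  hence "norm (a ^ Suc (Suc n) - b ^ Suc (Suc n)) \<le>
      norm a * norm (a ^ Suc n - b ^ Suc n) + norm (a - b) * norm b ^ Suc n"
    using norm_triangle_ineq[of "a * (a ^ Suc n - b ^ Suc n)" "(a - b) * b ^ Suc n"]
    by (simp only: norm_mult norm_power)
  also have "\<dots> \<le> M * (real (Suc n) * norm (a - b) * M ^ n) + norm (a - b) * M ^ Suc n"
    by (intro add_mono mult_mono Suc.IH power_mono assms mult_nonneg_nonneg) (use M in auto)
  also have "\<dots> = real (Suc (Suc n)) * norm (a - b) * M ^ Suc n" by (simp add: algebra_simps)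
  finally show ?case .
qed auto

text \<open>With v = w / (n + 1), both sides are powers of bases bounded by exp |v|, and the bases 1
  + v and exp v differ by a Taylor remainder of size |v|^2 exp |v|. Telescoping adds n + 1 such
  errors, which leaves a factor 1 / (n + 1).\<close>

lemma exp_limit_bound:
  fixes w :: complex
  shows "norm ((1 + w / of_nat (Suc n)) ^ Suc n - exp w) \<le> (norm w)\<^sup>2 * exp (norm w) / real (Suc n)"
proof -
  define v where "v = w / of_nat (Suc n)"
  have nv: "norm v = norm w / real (Suc n)" unfolding v_def norm_divide norm_of_nat ..
  have "norm (1 + v) \<le> exp (norm v)"
    using norm_triangle_ineq[of 1 v] order_trans[OF _ exp_ge_add_one_self[of "norm v"]] by simp
  moreover have "norm (exp v) \<le> exp (norm v)" by (rule norm_exp)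
  ultimately have "norm ((1 + v) ^ Suc n - exp v ^ Suc n) \<le> real (Suc n) * norm (1 + v - exp v) * exp (norm v) ^ n"
    by (rule norm_power_diff_le)
  also have "\<dots> \<le> real (Suc n) * ((norm v)\<^sup>2 * exp (norm v)) * exp (norm v) ^ n"
    using Taylor_exp_field[of v 1]
    by (intro mult_right_mono mult_left_mono) (simp_all add: norm_minus_commute power2_eq_square mult_ac)
  also have "\<dots> = real (Suc n) * (norm v)\<^sup>2 * exp (norm v) ^ Suc n" by simp
  also have "exp (norm v) ^ Suc n = exp (norm w)"
    unfolding exp_of_nat_mult[symmetric] nv by simp
  also have "real (Suc n) * (norm v)\<^sup>2 = (norm w)\<^sup>2 / real (Suc n)"
    unfolding nv by (simp add: power2_eq_square)
  also have "exp v ^ Suc n = exp w"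
    unfolding exp_of_nat_mult[symmetric] v_def by (simp del: of_nat_Suc)
  finally show ?thesis by (simp add: v_def)
qed

lemma exp_uniform_limit:
  fixes \<alpha> :: complex
  shows "uniform_limit (cball 0 R) (\<lambda>n z. (1 + \<alpha> * z / of_nat (Suc n)) ^ Suc n) (\<lambda>z. exp (\<alpha> * z)) sequentially"
proof (rule uniform_limitI)
  fix \<epsilon> :: real assume "\<epsilon> > 0"
  define K where "K = (norm \<alpha> * R)\<^sup>2 * exp (norm \<alpha> * R)"
  have "(\<lambda>n. K / real (Suc n)) \<longlonglongrightarrow> 0" by real_asymp
  hence "eventually (\<lambda>n. K / real (Suc n) < \<epsilon>) sequentially" using \<open>\<epsilon> > 0\<close> by (rule order_tendstoD)
  thus "eventually (\<lambda>n. \<forall>z\<in>cball 0 R. dist ((1 + \<alpha> * z / of_nat (Suc n)) ^ Suc n) (exp (\<alpha> * z)) < \<epsilon>) sequentially"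
  proof eventually_elim
    case (elim n)
    show ?case
    proof
      fix z assume "z \<in> cball (0::complex) R"
      hence "norm (\<alpha> * z) \<le> norm \<alpha> * R" by (simp add: norm_mult mult_left_mono)
      hence "(norm (\<alpha> * z))\<^sup>2 * exp (norm (\<alpha> * z)) \<le> K"
        unfolding K_def by (intro mult_mono power_mono) auto
      hence "(norm (\<alpha> * z))\<^sup>2 * exp (norm (\<alpha> * z)) / real (Suc n) \<le> K / real (Suc n)"
        by (intro divide_right_mono) auto
      thus "dist ((1 + \<alpha> * z / of_nat (Suc n)) ^ Suc n) (exp (\<alpha> * z)) < \<epsilon>"
        using exp_limit_bound[of "\<alpha> * z" n] elim unfolding dist_norm by linarith
    qed
  qed
qed

lemma prod_uniform_limit:
  fixes \<delta> :: "nat \<Rightarrow> real"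
  assumes \<delta>: "\<And>\<nu>. \<delta> \<nu> \<ge> 0" "summable \<delta>"
  shows "uniform_limit (cball 0 R) (\<lambda>n z. \<Prod>\<nu><n. 1 + of_real (\<delta> \<nu>) * z) (\<lambda>z. prodinf (\<lambda>\<nu>. 1 + of_real (\<delta> \<nu>) * z :: complex)) sequentially"
proof -
  have "uniformly_convergent_on (cball 0 R) (\<lambda>n z. \<Prod>\<nu><n. 1 + of_real (\<delta> \<nu>) * (z::complex))"
  proof (rule uniformly_convergent_on_prod)
    show "uniformly_convergent_on (cball 0 R) (\<lambda>N z. \<Sum>\<nu><N. norm (of_real (\<delta> \<nu>) * (z::complex)))"
    proof (rule Weierstrass_m_test')
      show "norm (norm (of_real (\<delta> \<nu>) * z)) \<le> \<delta> \<nu> * R" if "z \<in> cball (0::complex) R" for \<nu> z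
        using that \<delta>(1)[of \<nu>] by (simp add: norm_mult mult_left_mono)
      show "summable (\<lambda>\<nu>. \<delta> \<nu> * R)" using \<delta>(2) by (rule summable_mult2)
    qed
  qed (auto intro!: continuous_intros)
  then obtain l where l: "uniform_limit (cball 0 R) (\<lambda>n z. \<Prod>\<nu><n. 1 + of_real (\<delta> \<nu>) * (z::complex)) l sequentially"
    by (auto simp: uniformly_convergent_on_def)
  have "l z = prodinf (\<lambda>\<nu>. 1 + of_real (\<delta> \<nu>) * z)" if z: "z \<in> cball 0 R" for z
  proof -
    have "summable (\<lambda>\<nu>. norm (1 + of_real (\<delta> \<nu>) * z - 1))"
      using \<delta> by (simp add: norm_mult summable_mult2)
    hence "convergent_prod (\<lambda>\<nu>. 1 + of_real (\<delta> \<nu>) * z)"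
      by (intro abs_convergent_prod_imp_convergent_prod summable_imp_abs_convergent_prod)
    hence "(\<lambda>n. \<Prod>\<nu>\<le>n. 1 + of_real (\<delta> \<nu>) * z) \<longlonglongrightarrow> prodinf (\<lambda>\<nu>. 1 + of_real (\<delta> \<nu>) * z)"
      by (rule convergent_prod_LIMSEQ)
    \<comment> \<open>Shifted by one, because the partial products converging to
      \<open>prodinf\<close> include the index \<open>n\<close>.\<close>
    moreover have "(\<lambda>n. \<Prod>\<nu><Suc n. 1 + of_real (\<delta> \<nu>) * z) \<longlonglongrightarrow> l z"
      by (rule LIMSEQ_Suc, rule tendsto_uniform_limitI[OF l z])
    ultimately show ?thesis
      unfolding lessThan_Suc_atMost using LIMSEQ_unique by blast
  qed
  thus ?thesis by (intro iffD1[OF uniform_limit_cong' l]) auto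
qed

lemma linprod_replicate: "linprod (replicate_mset n d) = [:1, of_real d:] ^ n"
  by (induction n) (auto simp: linprod_add)

lemma linprod_plus: "linprod (A + B) = linprod A * linprod B"
  by (simp add: linprod_def)

lemma linprod_image_mset_set: "linprod (image_mset \<delta> (mset_set {..<n::nat})) = (\<Prod>\<nu><n. [:1, of_real (\<delta> \<nu>):])"
  by (simp add: linprod_def image_mset.compositionality o_def prod_unfold_prod_mset)

lemma deriv_poly_funpow: "(deriv ^^ k) (poly p) = poly ((pderiv ^^ k) (p :: complex poly))"
proof (induction k)
  case (Suc k)
  have "deriv (poly q) = poly (pderiv q)" for q :: "complex poly"
    by (rule ext, rule DERIV_imp_deriv, rule poly_DERIV)
  with Suc show ?case by simp
qed auto

text \<open>Since \<open>F 0\<close> is non-zero, the exponent \<open>m\<close> is \<open>0\<close>.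
  The constant \<open>C\<close> may be negative and is split off, because members of
  \<open>LPplus\<close> are positive at \<open>0\<close>.\<close>

lemma laguerre_polya_I_imp_LPplus:
  assumes "F \<in> laguerre_polya_I" "F 0 \<noteq> 0"
  obtains C :: real and G where "C \<noteq> 0" "G \<in> LPplus" "\<And>z. F z = of_real C * G z"
proof -
  obtain C m \<alpha> \<delta> where hol: "F holomorphic_on UNIV" and C: "C \<noteq> 0" and \<alpha>: "\<alpha> \<ge> 0"
    and \<delta>: "\<And>\<nu>. \<delta> \<nu> \<ge> 0" "summable \<delta>"
    and F: "\<And>z. F z = of_real C * z ^ m * exp (of_real \<alpha> * z) * prodinf (\<lambda>\<nu>. 1 + of_real (\<delta> \<nu>) * z)"
    using assms(1) unfolding laguerre_polya_I_def by blast
  have m: "m = 0" using assms(2) F[of 0] by (cases m) auto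
  define G where "G z = exp (of_real \<alpha> * z) * prodinf (\<lambda>\<nu>. 1 + of_real (\<delta> \<nu>) * z)" for z :: complex
  have FG: "F z = of_real C * G z" for z using F[of z] by (simp add: m G_def)
  have "G = (\<lambda>z. F z / of_real C)" using FG C by auto
  hence G_hol: "G holomorphic_on UNIV" using hol C by (auto intro!: holomorphic_intros)
  \<comment> \<open>The exponential is approximated by \<open>Suc n\<close> equal factors, that is
    by a multiple negative root tending to infinity (if \<alpha> > 0); the other entries give the
    partial product.\<close>
  define A where "A n = replicate_mset (Suc n) (\<alpha> / real (Suc n)) + image_mset \<delta> (mset_set {..<n})" for n
  have A: "d \<ge> 0" if "d \<in># A n" for d n
    using that \<alpha> \<delta>(1) by (auto simp: A_def split: if_splits)
  have A_poly: "poly (linprod (A n)) = (\<lambda>z. (1 + of_real \<alpha> * z / of_nat (Suc n)) ^ Suc n * (\<Prod>\<nu><n. 1 + of_real (\<delta> \<nu>) * z))" for n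
    unfolding A_def linprod_plus linprod_replicate linprod_image_mset_set
    by (rule ext) (simp add: poly_prod mult_ac del: power_Suc of_nat_Suc)
  have ul: "uniform_limit (cball 0 R) (\<lambda>n. poly (linprod (A n))) G sequentially" for R
    unfolding A_poly G_def
  proof (rule uniform_lim_mult[OF exp_uniform_limit prod_uniform_limit[OF \<delta>]])
    show "bounded ((\<lambda>z. exp (complex_of_real \<alpha> * z)) ` cball 0 R)"
      by (intro compact_imp_bounded compact_continuous_image continuous_intros) auto
    have "continuous_on (cball 0 R) (\<lambda>z. prodinf (\<lambda>\<nu>. 1 + of_real (\<delta> \<nu>) * (z::complex)))"
      by (rule uniform_limit_theorem[OF _ prod_uniform_limit[OF \<delta>]]) (auto intro!: always_eventually continuous_intros)
    thus "bounded ((\<lambda>z. prodinf (\<lambda>\<nu>. 1 + of_real (\<delta> \<nu>) * (z::complex))) ` cball 0 R)"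
      by (intro compact_imp_bounded compact_continuous_image) auto
  qed
  \<comment> \<open>Locally uniform convergence of holomorphic functions carries over to all
    derivatives.\<close>
  have lim: "(\<lambda>n. poly ((pderiv ^^ k) (linprod (A n))) z) \<longlonglongrightarrow> (deriv ^^ k) G z" for k z
  proof -
    have "uniform_limit (ball 0 (norm z + 1)) (\<lambda>n. poly (linprod (A n))) G sequentially"
      by (rule uniform_limit_on_subset[OF ul[of "norm z + 1"]]) auto
    moreover have "poly (linprod (A n)) holomorphic_on ball 0 (norm z + 1)" for n
      unfolding A_poly by (intro holomorphic_intros) (simp del: of_nat_Suc)
    ultimately have "(\<lambda>n. (deriv ^^ k) (poly (linprod (A n))) z) \<longlonglongrightarrow> (deriv ^^ k) G z"
      by (rule higher_deriv_complex_uniform_limit[OF _ always_eventually[OF allI]]) auto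
    thus ?thesis by (simp only: deriv_poly_funpow)
  qed
  have "linprod (A n) \<in> neg_rooted" for n
    using neg_rooted_smult_linprod[of 1 "A n"] A by simp
  moreover have "G 0 \<noteq> 0" using FG[of 0] assms(2) by auto
  ultimately have "G \<in> LPplus" using G_hol lim
    by (auto simp: LPplus_def intro!: exI[of _ "\<lambda>n. linprod (A n)"])
  with C FG that show ?thesis by blast
qed

section \<open>The model kernel\<close>

text \<open>\<open>H\<close> is the imaginary part of a plane curve with tangent vector \<open>x\<^sup>t g(x)\<close>, whose curvature
  \<open>Im q / (x\<^sup>t |g|)\<close> decreases, so that its osculating circles are nested. In the proof, \<open>- D x\<close> is
  the height of the lowest point of the osculating circle at \<open>x\<close>.\<close>

lemma curve_below_tangent:
  fixes g q :: "real \<Rightarrow> complex" and H :: "real \<Rightarrow> real" and t :: real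
  assumes t: "t \<ge> 0"
    and g: "\<And>x. x > 0 \<Longrightarrow> (g has_vector_derivative q x * g x) (at x)"
    and gnz: "\<And>x. x > 0 \<Longrightarrow> g x \<noteq> 0"
    and Re_q: "\<And>x. x > 0 \<Longrightarrow> Re (q x) \<ge> 0"
    and Im_q: "\<And>x. x > 0 \<Longrightarrow> Im (q x) > 0"
    and Im_q_mono: "\<And>x y. 0 < x \<Longrightarrow> x \<le> y \<Longrightarrow> Im (q y) \<le> Im (q x)"
    and Im_q_diff: "\<And>x. x > 0 \<Longrightarrow> \<exists>d. ((\<lambda>x. Im (q x)) has_real_derivative d) (at x)"
    and H: "\<And>x. x > 0 \<Longrightarrow> (H has_real_derivative x powr t * Im (g x)) (at x)"
    and H0: "(H \<longlongrightarrow> 0) (at_right 0)"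
    and g1: "g 1 = 1"
  shows "H 1 \<le> 0" and "t > 0 \<Longrightarrow> H 1 < 0"
proof -
  define N where "N x = norm (g x) - Re (g x)" for x
  \<comment> \<open>The tangent vector has length x^t |g| and turns at speed
    \<open>Im (q x)\<close>, so the radius of curvature is x^t |g| / Im q. The centre of the
    osculating circle has height H + x^t Re g / Im q; subtracting the radius gives
    \<open>- D x\<close>.\<close>
  define D where "D x = x powr t * N x / Im (q x) - H x" for x
  have N_nonneg: "N x \<ge> 0" for x using complex_Re_le_cmod[of "g x"] by (simp add: N_def)
  have Re_g: "((\<lambda>x. Re (g x)) has_real_derivative Re (q x) * Re (g x) - Im (q x) * Im (g x)) (at x)"
    and Im_g: "((\<lambda>x. Im (g x)) has_real_derivative Re (q x) * Im (g x) + Im (q x) * Re (g x)) (at x)"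
    if "x > 0" for x
    using g[OF that] unfolding has_vector_derivative_complex_iff by simp_all
  have norm_g: "((\<lambda>x. norm (g x)) has_real_derivative Re (q x) * norm (g x)) (at x)" if "x > 0" for x
  proof -
    have pos: "(Re (g x))\<^sup>2 + (Im (g x))\<^sup>2 > 0"
      using gnz[OF that] by (simp add: complex_neq_0)
    have "((\<lambda>x. sqrt ((Re (g x))\<^sup>2 + (Im (g x))\<^sup>2)) has_real_derivative
        (inverse (sqrt ((Re (g x))\<^sup>2 + (Im (g x))\<^sup>2)) / 2) *
        (2 * Re (g x) * (Re (q x) * Re (g x) - Im (q x) * Im (g x)) +
         2 * Im (g x) * (Re (q x) * Im (g x) + Im (q x) * Re (g x)))) (at x)"
      by (rule DERIV_chain2[where f = sqrt and g = "\<lambda>x. (Re (g x))\<^sup>2 + (Im (g x))\<^sup>2", OF DERIV_real_sqrt[OF pos]])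
         (rule derivative_eq_intros Re_g Im_g that | simp)+
    also have "(inverse (sqrt ((Re (g x))\<^sup>2 + (Im (g x))\<^sup>2)) / 2) *
        (2 * Re (g x) * (Re (q x) * Re (g x) - Im (q x) * Im (g x)) +
         2 * Im (g x) * (Re (q x) * Im (g x) + Im (q x) * Re (g x)))
        = Re (q x) * (((Re (g x))\<^sup>2 + (Im (g x))\<^sup>2) / sqrt ((Re (g x))\<^sup>2 + (Im (g x))\<^sup>2))"
    proof -
      have n: "2 * Re (g x) * (Re (q x) * Re (g x) - Im (q x) * Im (g x)) +
           2 * Im (g x) * (Re (q x) * Im (g x) + Im (q x) * Re (g x)) =
         2 * (Re (q x) * ((Re (g x))\<^sup>2 + (Im (g x))\<^sup>2))"
        by (simp add: algebra_simps power2_eq_square)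
      have "inverse r / 2 * (2 * (a * s)) = a * (s / r)" for r s a :: real
        by (cases "r = 0") (simp_all add: field_simps)
      thus ?thesis unfolding n .
    qed
    also have "((Re (g x))\<^sup>2 + (Im (g x))\<^sup>2) / sqrt ((Re (g x))\<^sup>2 + (Im (g x))\<^sup>2) = norm (g x)"
      using pos by (simp add: real_div_sqrt cmod_def)
    finally show ?thesis by (simp add: cmod_def)
  qed
  have N: "(N has_real_derivative Re (q x) * N x + Im (q x) * Im (g x)) (at x)" if "x > 0" for x
    unfolding N_def
    by (rule derivative_eq_intros norm_g Re_g that)+ (simp add: algebra_simps)
  \<comment> \<open>The summand Im q * Im g in the derivative of \<open>N\<close> cancels the
    derivative of \<open>H\<close>. Three non-negative terms remain; the bound keeps the one with
    the factor \<open>t\<close>, from which strictness is drawn later.\<close>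
  have D: "\<exists>d. (D has_real_derivative d) (at x) \<and> d \<ge> t * x powr (t - 1) * N x / Im (q x)"
    if x: "x > 0" for x
  proof -
    obtain b' where b': "((\<lambda>x. Im (q x)) has_real_derivative b') (at x)"
      using Im_q_diff[OF x] by blast
    have "-b' \<ge> 0"
      by (rule mono_on_imp_deriv_nonneg[of "{0<..}" "\<lambda>x. - Im (q x)" _ x])
         (use x Im_q_mono DERIV_minus[OF b'] in \<open>auto intro!: mono_onI simp: interior_open\<close>)
    define e where "e = (t * x powr (t - 1) * N x + x powr t * (Re (q x) * N x + Im (q x) * Im (g x))) / Im (q x)
        - x powr t * N x * b' / (Im (q x))\<^sup>2 - x powr t * Im (g x)"
    have "(D has_real_derivative e) (at x)"
      unfolding D_def e_def
      by (rule DERIV_cong[OF DERIV_diff[OF DERIV_divide[OF DERIV_mult[OF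
            has_real_derivative_powr[OF x] N[OF x]] b'] H[OF x]]])
         (use Im_q[OF x] in \<open>simp_all add: field_simps power2_eq_square\<close>)
    moreover have "e = t * x powr (t - 1) * N x / Im (q x) + x powr t * Re (q x) * N x / Im (q x)
        + x powr t * N x * (-b') / (Im (q x))\<^sup>2"
      using Im_q[OF x] unfolding e_def by (simp add: field_simps)
    moreover have "x powr t * Re (q x) * N x / Im (q x) \<ge> 0"
      using Im_q[OF x] Re_q[OF x] N_nonneg[of x] by simp
    moreover have "x powr t * N x * (-b') / (Im (q x))\<^sup>2 \<ge> 0"
      using N_nonneg[of x] \<open>-b' \<ge> 0\<close> by (intro divide_nonneg_nonneg mult_nonneg_nonneg) auto
    ultimately show ?thesis by (intro exI[of _ e]) auto
  qed
  have D_mono: "D x \<le> D y" if "0 < x" "x \<le> y" for x y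
  proof (rule DERIV_nonneg_imp_nondecreasing[OF \<open>x \<le> y\<close>])
    fix s assume "x \<le> s" "s \<le> y"
    hence s: "s > 0" using that by simp
    with D[OF s] show "\<exists>d. (D has_real_derivative d) (at s) \<and> 0 \<le> d"
      using N_nonneg[of s] Im_q[OF s] t by (meson divide_nonneg_pos mult_nonneg_nonneg order_trans powr_ge_zero)
  qed
  \<comment> \<open>No limit of \<open>D\<close> at \<open>0\<close> is needed:
    \<open>D y \<ge> D x \<ge> - H x\<close> for small \<open>x\<close>, and \<open>H\<close> tends
    to \<open>0\<close>.\<close>
  have D_nonneg: "D y \<ge> 0" if "y > 0" for y
  proof (rule tendsto_lowerbound[of "\<lambda>x. D y + H x"])
    have "((\<lambda>x. D y + H x) \<longlongrightarrow> D y + 0) (at_right 0)" by (intro tendsto_intros H0)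
    thus "((\<lambda>x. D y + H x) \<longlongrightarrow> D y) (at_right 0)" by simp
    have "eventually (\<lambda>x::real. x \<in> {0<..<y}) (at_right 0)"
      using that by (intro eventually_at_right_real)
    thus "eventually (\<lambda>x. 0 \<le> D y + H x) (at_right 0)"
    proof eventually_elim
      case (elim x)
      have "0 \<le> x powr t * N x / Im (q x)"
        using N_nonneg[of x] Im_q[of x] elim by simp
      thus ?case using D_mono[of x y] elim by (simp add: D_def)
    qed
  qed auto
  have D1: "D 1 = - H 1" by (simp add: D_def N_def g1)
  with D_nonneg[of 1] show "H 1 \<le> 0" by simp
  \<comment> \<open>If \<open>D\<close> vanished at \<open>1\<close>, monotonicity would make it
    vanish on the whole unit interval, and for \<open>t > 0\<close> its derivative would force
    \<open>N\<close> to be \<open>0\<close> there. Then \<open>g\<close> would stay on the positive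
    real axis, although \<open>Im (q x) > 0\<close> makes it turn.\<close>
  show "H 1 < 0" if "t > 0"
  proof (rule ccontr)
    assume "\<not> H 1 < 0"
    with D1 D_nonneg[of 1] have "D 1 = 0" by simp
    have D_zero: "D x = 0" if "x \<in> {0<..<1}" for x
      using D_mono[of x 1] D_nonneg[of x] that \<open>D 1 = 0\<close> by simp
    have N_zero: "N x = 0" if x: "x \<in> {0<..<1}" for x
    proof -
      have x0: "x > 0" using x by simp
      obtain d where d: "(D has_real_derivative d) (at x)" "d \<ge> t * x powr (t - 1) * N x / Im (q x)"
        using D[OF x0] by blast
      have "((\<lambda>_. 0) has_real_derivative d) (at x)"
        by (rule has_field_derivative_transform_within_open[OF d(1), of "{0<..<1}"]) (use x D_zero in auto)
      hence "d = 0" using DERIV_unique DERIV_const by blast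
      hence "t * x powr (t - 1) * N x / Im (q x) \<le> 0" using d by simp
      hence "t * x powr (t - 1) * N x \<le> 0"
        using Im_q[OF x0] by (simp add: divide_le_0_iff)
      moreover have "t * x powr (t - 1) > 0" using \<open>t > 0\<close> x by simp
      ultimately have "N x \<le> 0" using zero_less_mult_pos by (meson leI mult_pos_pos not_le)
      thus ?thesis using N_nonneg[of x] by simp
    qed
    have Im_zero: "Im (g x) = 0" if "x \<in> {0<..<1}" for x
      using N_zero[OF that] by (metis N_def cmod_eq_Re abs_eq_iff' complex_eq_iff
          cmod_power2 eq_iff_diff_eq_0 add_cancel_right_right power_eq_0_iff)
    have "((\<lambda>_. 0) has_real_derivative Re (q (1/2)) * Im (g (1/2)) + Im (q (1/2)) * Re (g (1/2))) (at (1/2))"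
      by (rule has_field_derivative_transform_within_open[OF Im_g, of _ "{0<..<1}"]) (use Im_zero in auto)
    hence "Re (q (1/2)) * Im (g (1/2)) + Im (q (1/2)) * Re (g (1/2)) = 0"
      using DERIV_unique DERIV_const by blast
    moreover have "Re (g (1/2)) = norm (g (1/2))" using N_zero[of "1/2"] by (simp add: N_def)
    ultimately show False using Im_zero[of "1/2"] Im_q[of "1/2"] gnz[of "1/2"] by simp
  qed
qed


section \<open>Taylor coefficients and the series of the model case\<close>

definition taylor :: "(complex \<Rightarrow> complex) \<Rightarrow> nat \<Rightarrow> real" where
  "taylor G k = Re ((deriv ^^ k) G 0) / fact k"

lemma LPplus_taylor_nonneg: "G \<in> LPplus \<Longrightarrow> taylor G k \<ge> 0"
  using LPplus_higher_deriv_0[of G k] by (auto elim!: nonneg_Reals_cases simp: taylor_def)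

lemma LPplus_sums:
  assumes "G \<in> LPplus"
  shows "(\<lambda>k. of_real (taylor G k) * z ^ k) sums G z"
proof -
  have "G holomorphic_on ball 0 (norm z + 1)" using assms by (auto simp: LPplus_def intro: holomorphic_on_subset)
  from holomorphic_power_series[OF this, of z]
  have "(\<lambda>k. (deriv ^^ k) G 0 / fact k * z ^ k) sums G z" by simp
  moreover have "(deriv ^^ k) G 0 / fact k = of_real (taylor G k)" for k
    using LPplus_higher_deriv_0[OF assms, of k] by (auto elim!: nonneg_Reals_cases simp: taylor_def)
  ultimately show ?thesis by simp
qed

lemma LPplus_summable_norm:
  assumes "G \<in> LPplus" "r \<ge> 0"
  shows "summable (\<lambda>k. taylor G k * r ^ k)"
proof -
  have "summable (\<lambda>k. complex_of_real (taylor G k * r ^ k))"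
    using LPplus_sums[OF assms(1), of "of_real r"] by (simp add: sums_iff)
  thus ?thesis by (simp only: summable_complex_of_real)
qed

text \<open>Linear growth is absorbed by k + 1 <= 2^k, that is by the convergence of the series at
  twice the radius. The multipliers considered later grow at most linearly along the
  integers.\<close>

lemma LPplus_summable_mult:
  assumes G: "G \<in> LPplus" and c: "\<And>k. norm (c k :: complex) \<le> K * (real k + 1)"
  shows "summable (\<lambda>k. norm (c k * of_real (taylor G k) * z ^ k))"
proof (rule summable_comparison_test')
  show "summable (\<lambda>k. K * (taylor G k * (2 * norm z) ^ k))"
    by (intro summable_mult LPplus_summable_norm[OF G]) auto
  fix k :: nat assume "k \<ge> 0"
  have "K * (real 0 + 1) \<ge> 0" using c[of 0] norm_ge_zero order_trans by blast
  hence K: "K \<ge> 0" by simp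
  have "k + 1 \<le> 2 ^ k" by (induction k) auto
  hence "real (k + 1) \<le> real (2 ^ k)" by (simp only: of_nat_le_iff)
  hence "K * (real k + 1) \<le> K * 2 ^ k" using K by (intro mult_left_mono) auto
  hence "norm (c k) \<le> K * 2 ^ k" using c[of k] by simp
  hence "norm (c k) * (taylor G k * norm z ^ k) \<le> K * 2 ^ k * (taylor G k * norm z ^ k)"
    using LPplus_taylor_nonneg[OF G, of k] by (intro mult_right_mono) auto
  thus "norm (norm (c k * of_real (taylor G k) * z ^ k)) \<le> K * (taylor G k * (2 * norm z) ^ k)"
    using LPplus_taylor_nonneg[OF G, of k] by (simp add: norm_mult norm_power power_mult_distrib mult_ac)
qed

lemma LPplus_scaled_has_vector_derivative:
  assumes G: "G \<in> LPplus"
  shows "((\<lambda>x. G (of_real x * z)) has_vector_derivative z * deriv G (of_real x * z)) (at x within A)"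
proof -
  have "(G has_field_derivative deriv G (of_real x * z)) (at (of_real x * z))"
    using G by (auto simp: LPplus_def intro!: holomorphic_derivI[of _ UNIV])
  moreover have "((\<lambda>x. of_real x * z) has_vector_derivative z) (at x within A)"
    by (auto intro!: derivative_eq_intros)
  ultimately show ?thesis
    using field_vector_diff_chain_within[of "\<lambda>x. of_real x * z" z x A G] by (auto simp: o_def intro: has_field_derivative_at_within)
qed

lemma kernel_ineq:
  fixes t :: real
  assumes G: "G \<in> LPplus" and G1: "deriv G 0 \<noteq> 0" and z: "Re z \<ge> 0" "Im z > 0" and t: "t \<ge> 0"
  shows "Im ((\<Sum>k. of_real (taylor G k / (real k + 1 + t)) * z ^ k) / G z) \<le> 0"
    and "t > 0 \<Longrightarrow> Im ((\<Sum>k. of_real (taylor G k / (real k + 1 + t)) * z ^ k) / G z) < 0"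
proof -
  define c where "c k = complex_of_real (taylor G k / (real k + 1 + t))" for k
  define \<Phi> where "\<Phi> u = (\<Sum>k. c k * u ^ k)" for u
  have Gnz: "G u \<noteq> 0" if "Re u \<ge> 0" for u using LPplus_nonzero[OF G that] .
  have summ: "summable (\<lambda>k. c k * u ^ k)" for u
  proof -
    have "norm (complex_of_real (1 / (real k + 1 + t))) \<le> 1 * (real k + 1)" for k
      unfolding norm_of_real using t by (simp add: field_simps)
    from LPplus_summable_mult[OF G this, of u] show ?thesis
      by (intro summable_norm_cancel[where f = "\<lambda>k. c k * u ^ k"]) (simp add: c_def)
  qed
  define \<Phi>' where "\<Phi>' u = (\<Sum>k. diffs c k * u ^ k)" for u
  have \<Phi>': "(\<Phi> has_field_derivative \<Phi>' u) (at u)" for u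
    unfolding \<Phi>_def \<Phi>'_def by (rule termdiffs_strong_converges_everywhere) (rule summ)
  \<comment> \<open>The operator multiplies the coefficient of index k by k + 1 + t and so undoes
    the division. The equation says that x^(t+1) \<Phi>(x z) has derivative x^t G(x z); the
    primitive is thus known explicitly and no integral over the unit interval has to be
    formed.\<close>
  have ode: "of_real (t + 1) * \<Phi> u + u * \<Phi>' u = G u" for u
  proof -
    have "summable (\<lambda>k. diffs c k * u ^ k)"
      by (rule termdiff_converges_all) (rule summ)
    hence "(\<lambda>k. diffs c k * u ^ k) sums \<Phi>' u" unfolding \<Phi>'_def by (rule summable_sums)
    hence "(\<lambda>k. u * (diffs c k * u ^ k)) sums (u * \<Phi>' u)" by (rule sums_mult)
    hence "(\<lambda>k. of_nat (Suc k) * c (Suc k) * u ^ Suc k) sums (u * \<Phi>' u)"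
      by (simp add: diffs_def mult_ac)
    hence "(\<lambda>k. of_nat k * c k * u ^ k) sums (u * \<Phi>' u)"
      by (subst (asm) sums_Suc_iff) simp
    moreover have "(\<lambda>k. of_real (t + 1) * (c k * u ^ k)) sums (of_real (t + 1) * \<Phi> u)"
      unfolding \<Phi>_def by (intro sums_mult summable_sums summ)
    ultimately have "(\<lambda>k. of_real (t + 1) * (c k * u ^ k) + of_nat k * c k * u ^ k) sums
        (of_real (t + 1) * \<Phi> u + u * \<Phi>' u)"
      by (intro sums_add)
    moreover have "of_real (t + 1) * (c k * u ^ k) + of_nat k * c k * u ^ k = of_real (taylor G k) * u ^ k" for k
    proof -
      have "real k + 1 + t \<noteq> 0" using t by simp
      have "of_real (t + 1) * (c k * u ^ k) + of_nat k * c k * u ^ k = of_real (real k + 1 + t) * c k * u ^ k"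
        by (simp add: algebra_simps)
      also have "of_real (real k + 1 + t) * c k = of_real (taylor G k)"
        unfolding c_def of_real_mult[symmetric] using \<open>real k + 1 + t \<noteq> 0\<close> by simp
      finally show ?thesis .
    qed
    ultimately show ?thesis using LPplus_sums[OF G, of u] sums_unique2 by simp
  qed
  define g where "g x = G (of_real x * z) / G z" for x :: real
  define q where "q x = z * deriv G (of_real x * z) / G (of_real x * z)" for x :: real
  define H where "H x = x powr (t + 1) * Im (\<Phi> (of_real x * z) / G z)" for x :: real
  have g: "(g has_vector_derivative q x * g x) (at x)" if "x > 0" for x
  proof -
    have "((\<lambda>x. G (of_real x * z) * (1 / G z)) has_vector_derivative (z * deriv G (of_real x * z)) * (1 / G z)) (at x)"
      by (intro has_vector_derivative_mult_left LPplus_scaled_has_vector_derivative G)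
    moreover have "q x * g x = (z * deriv G (of_real x * z)) * (1 / G z)"
      unfolding q_def g_def using Gnz[of "of_real x * z"] that z by simp
    moreover have "g = (\<lambda>x. G (of_real x * z) * (1 / G z))" by (simp add: g_def fun_eq_iff)
    ultimately show ?thesis by metis
  qed
  have q_diff: "\<exists>d. ((\<lambda>x. Im (q x)) has_real_derivative d) (at x)" if "x > 0" for x
  proof -
    have "(\<lambda>u. z * deriv G u / G u) field_differentiable at (of_real x * z)"
      using G Gnz[of "of_real x * z"] that z
      by (intro derivative_intros field_differentiable_divide field_differentiable_mult)
         (auto simp: LPplus_def intro!: holomorphic_on_imp_differentiable_at[of _ UNIV] holomorphic_deriv)
    then obtain d where "((\<lambda>u. z * deriv G u / G u) has_field_derivative d) (at (of_real x * z))"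
      by (auto simp: field_differentiable_def)
    moreover have "((\<lambda>x. of_real x * z) has_vector_derivative z) (at x)"
      by (auto intro!: derivative_eq_intros)
    ultimately have "(q has_vector_derivative z * d) (at x)"
      using field_vector_diff_chain_at[of "\<lambda>x. of_real x * z" z x "\<lambda>u. z * deriv G u / G u" d]
      unfolding q_def by (simp add: o_def)
    thus ?thesis unfolding has_vector_derivative_complex_iff by blast
  qed
  have H: "(H has_real_derivative x powr t * Im (g x)) (at x)" if x: "x > 0" for x
  proof -
    have "((\<lambda>x. of_real x * z) has_vector_derivative z) (at x)"
      by (auto intro!: derivative_eq_intros)
    hence "((\<lambda>x. \<Phi> (of_real x * z)) has_vector_derivative z * \<Phi>' (of_real x * z)) (at x)"
      using field_vector_diff_chain_at[of "\<lambda>x. of_real x * z" z x \<Phi>] \<Phi>' by (simp add: o_def)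
    from has_vector_derivative_mult_left[OF this, of "1 / G z"]
    have "((\<lambda>x. Im (\<Phi> (of_real x * z) / G z)) has_real_derivative Im (z * \<Phi>' (of_real x * z) / G z)) (at x)"
      unfolding has_vector_derivative_complex_iff by simp
    hence "(H has_real_derivative (t + 1) * x powr t * Im (\<Phi> (of_real x * z) / G z) +
        x powr (t + 1) * Im (z * \<Phi>' (of_real x * z) / G z)) (at x)"
      unfolding H_def
      by (rule DERIV_cong[OF DERIV_mult[OF has_real_derivative_powr[OF x]]]) (simp add: mult_ac)
    also have "(t + 1) * x powr t * Im (\<Phi> (of_real x * z) / G z) + x powr (t + 1) * Im (z * \<Phi>' (of_real x * z) / G z)
      = x powr t * Im ((of_real (t + 1) * \<Phi> (of_real x * z) + of_real x * z * \<Phi>' (of_real x * z)) / G z)"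
    proof -
      have Im1: "Im (of_real a * u / v) = a * Im (u / v)" for a u v
      proof -
        have "of_real a * u / v = of_real a * (u / v)" by simp
        thus ?thesis by (metis Im_complex_of_real Re_complex_of_real add.right_neutral mult_zero_left times_complex.simps(2))
      qed
      have "x powr (t + 1) = x powr t * x" using x by (simp add: powr_add)
      moreover have "of_real x * z * \<Phi>' (of_real x * z) = of_real x * (z * \<Phi>' (of_real x * z))" by simp
      ultimately show ?thesis
        unfolding add_divide_distrib by (simp only: plus_complex.simps Im1) (simp add: algebra_simps)
    qed
    also have "\<dots> = x powr t * Im (g x)" unfolding ode g_def ..
    finally show ?thesis .
  qed
  have H0: "(H \<longlongrightarrow> 0) (at_right 0)"
  proof -
    have "isCont \<Phi> 0" using \<Phi>' DERIV_isCont by blast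
    hence "((\<lambda>x. \<Phi> (of_real x * z)) \<longlongrightarrow> \<Phi> 0) (at_right 0)"
      by (rule isCont_tendsto_compose) (auto intro!: tendsto_eq_intros)
    hence "((\<lambda>x. x powr (t + 1) * Im (\<Phi> (of_real x * z) / G z)) \<longlongrightarrow> 0 powr (t + 1) * Im (\<Phi> 0 / G z)) (at_right 0)"
      using t Gnz[of z] z by (intro tendsto_intros) (auto simp: eventually_at_filter)
    thus ?thesis using t by (simp add: H_def[abs_def])
  qed
  have gnz: "g x \<noteq> 0" if "x > 0" for x
    unfolding g_def using Gnz[of "of_real x * z"] Gnz[of z] that z by simp
  have g1: "g 1 = 1" unfolding g_def using Gnz[of z] z by simp
  have Req: "Re (q x) \<ge> 0" and Imq: "Im (q x) > 0" if "x > 0" for x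
    using LPplus_log_deriv(1)[OF G z, of x] LPplus_log_deriv(3)[OF G z, of x] G1 that unfolding q_def by auto
  have Imq_mono: "Im (q y) \<le> Im (q x)" if "0 < x" "x \<le> y" for x y
    using LPplus_log_deriv(2)[OF G z, of x y] that unfolding q_def by auto
  have H1: "H 1 = Im ((\<Sum>k. of_real (taylor G k / (real k + 1 + t)) * z ^ k) / G z)"
    by (simp add: H_def \<Phi>_def c_def)
  show "Im ((\<Sum>k. of_real (taylor G k / (real k + 1 + t)) * z ^ k) / G z) \<le> 0"
    unfolding H1[symmetric] by (rule curve_below_tangent(1)[OF t g gnz Req Imq Imq_mono q_diff H H0 g1])
  show "Im ((\<Sum>k. of_real (taylor G k / (real k + 1 + t)) * z ^ k) / G z) < 0" if "t > 0"
    unfolding H1[symmetric] by (rule curve_below_tangent(2)[OF t g gnz Req Imq Imq_mono q_diff H H0 g1 that])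
qed

section \<open>The Herglotz representation\<close>

text \<open>Period \<open>1\<close>, in agreement with \<open>circlepath\<close>, so that integrals
  over \<open>{0..1}\<close> are already normalised means over the circle.\<close>

definition ecirc :: "real \<Rightarrow> complex" where
  "ecirc t = exp (2 * of_real pi * \<i> * of_real t)"

lemma ecirc_cis: "ecirc t = cis (2 * pi * t)"
  by (simp add: ecirc_def cis_conv_exp mult_ac)

lemma norm_ecirc [simp]: "norm (ecirc t) = 1"
  by (simp add: ecirc_cis)

lemma cnj_ecirc: "cnj (ecirc t) = inverse (ecirc t)"
  by (simp add: ecirc_cis cis_cnj cis_inverse)

lemma ecirc_nonzero [simp]: "ecirc t \<noteq> 0"
  using norm_ecirc[of t] by force

lemma continuous_on_ecirc [continuous_intros]: "continuous_on A ecirc"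
  unfolding ecirc_def[abs_def] by (intro continuous_intros)

lemma cauchy_circle:
  assumes "h holomorphic_on cball 0 1" "norm w < 1"
  shows "((\<lambda>t. h (ecirc t) * (ecirc t / (ecirc t - w))) has_integral h w) {0..1}"
proof -
  have "((\<lambda>u. h u / (u - w)) has_contour_integral (2 * of_real pi * \<i> * h w)) (circlepath 0 1)"
    by (rule Cauchy_integral_circlepath_simple) (use assms in auto)
  hence "((\<lambda>t. h (circlepath 0 1 t) / (circlepath 0 1 t - w) * vector_derivative (circlepath 0 1) (at t within {0..1}))
      has_integral (2 * of_real pi * \<i> * h w)) {0..1}"
    by (simp add: has_contour_integral_def)
  hence "((\<lambda>t. 1 / (2 * of_real pi * \<i>) * (h (circlepath 0 1 t) / (circlepath 0 1 t - w) * vector_derivative (circlepath 0 1) (at t within {0..1})))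
      has_integral 1 / (2 * of_real pi * \<i>) * (2 * of_real pi * \<i> * h w)) {0..1}"
    by (rule has_integral_mult_right)
  moreover have "1 / (2 * of_real pi * \<i>) * (2 * of_real pi * \<i> * h w) = h w" by simp
  ultimately have *: "((\<lambda>t. 1 / (2 * of_real pi * \<i>) * (h (circlepath 0 1 t) / (circlepath 0 1 t - w) * vector_derivative (circlepath 0 1) (at t within {0..1})))
      has_integral h w) {0..1}" by simp
  have c: "circlepath 0 1 t = ecirc t" for t by (simp add: circlepath ecirc_def)
  have vd: "vector_derivative (circlepath 0 1) (at t within {0..1}) = 2 * of_real pi * \<i> * ecirc t"
    if "t \<in> {0..1}" for t
    using that vector_derivative_circlepath01[of t 0 1] by (simp add: ecirc_def)
  show ?thesis
  proof (rule has_integral_eq[OF _ *])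
    fix t :: real assume t: "t \<in> {0..1}"
    have "1 / K * (a / b * (K * e)) = a * (e / b)" if "K \<noteq> 0" for K a b e :: complex
      using that by simp
    from this[of "2 * of_real pi * \<i>"]
    show "1 / (2 * of_real pi * \<i>) * (h (circlepath 0 1 t) / (circlepath 0 1 t - w) *
        vector_derivative (circlepath 0 1) (at t within {0..1})) = h (ecirc t) * (ecirc t / (ecirc t - w))"
      unfolding c vd[OF t] by simp
  qed
qed

text \<open>Schwarz' integral formula. Cauchy's formula at \<open>w\<close> yields
  \<open>f w\<close>. For the conjugate of f one applies Cauchy's formula at \<open>0\<close> to
  f(u) / (1 - cnj w * u): on the circle, conjugation turns the denominator into (u - w) / u, so this
  part contributes only \<open>cnj (f 0)\<close>. Finally 2 u / (u - w) - 1 = (u + w) / (u -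
  w).\<close>

lemma schwarz_circle:
  assumes f: "f holomorphic_on cball 0 1" and w: "norm w < 1"
  shows "((\<lambda>t. of_real (Re (f (ecirc t))) * ((ecirc t + w) / (ecirc t - w))) has_integral (f w - \<i> * of_real (Im (f 0)))) {0..1}"
    and "((\<lambda>t. Re (f (ecirc t))) has_integral Re (f 0)) {0..1}"
proof -
  have ne: "ecirc t - w \<noteq> 0" for t using w norm_ecirc[of t] by auto
  have 1: "((\<lambda>t. f (ecirc t) * (ecirc t / (ecirc t - w))) has_integral f w) {0..1}"
    by (rule cauchy_circle) fact+
  have nz: "1 - cnj w * u \<noteq> 0" if "norm u \<le> 1" for u
  proof
    assume "1 - cnj w * u = 0"
    hence "norm (cnj w * u) = 1" by (metis eq_iff_diff_eq_0 norm_one)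
    moreover have "norm w * norm u \<le> norm w * 1" using that by (intro mult_left_mono) auto
    ultimately show False using w by (simp add: norm_mult)
  qed
  have "((\<lambda>t. f (ecirc t) / (1 - cnj w * ecirc t) * (ecirc t / (ecirc t - 0))) has_integral f 0 / (1 - cnj w * 0)) {0..1}"
    by (rule cauchy_circle) (use nz in \<open>auto intro!: holomorphic_intros f\<close>)
  hence "((\<lambda>t. f (ecirc t) / (1 - cnj w * ecirc t)) has_integral f 0) {0..1}" by simp
  hence "((cnj \<circ> (\<lambda>t. f (ecirc t) / (1 - cnj w * ecirc t))) has_integral cnj (f 0)) {0..1}"
    by (rule has_integral_cnj[THEN iffD2])
  hence "((\<lambda>t. cnj (f (ecirc t) / (1 - cnj w * ecirc t))) has_integral cnj (f 0)) {0..1}"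
    by (simp only: o_def)
  moreover have "cnj (f (ecirc t) / (1 - cnj w * ecirc t)) = cnj (f (ecirc t)) * (ecirc t / (ecirc t - w))" for t
  proof -
    have "1 - w * inverse (ecirc t) = (ecirc t - w) / ecirc t" by (simp add: field_simps)
    thus ?thesis by (simp add: cnj_ecirc)
  qed
  ultimately have 2: "((\<lambda>t. cnj (f (ecirc t)) * (ecirc t / (ecirc t - w))) has_integral cnj (f 0)) {0..1}"
    by simp
  have "((\<lambda>t. f (ecirc t) * (ecirc t / (ecirc t - 0))) has_integral f 0) {0..1}"
    by (rule cauchy_circle) (use f in auto)
  hence "((\<lambda>t. f (ecirc t)) has_integral f 0) {0..1}" by simp
  from has_integral_Re[OF this] show 3: "((\<lambda>t. Re (f (ecirc t))) has_integral Re (f 0)) {0..1}" .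
  have "((\<lambda>t. f (ecirc t) * (ecirc t / (ecirc t - w)) + cnj (f (ecirc t)) * (ecirc t / (ecirc t - w)) - complex_of_real (Re (f (ecirc t))))
    has_integral (f w + cnj (f 0) - of_real (Re (f 0)))) {0..1}"
    by (intro has_integral_diff has_integral_add 1 2 has_integral_linear[OF 3 bounded_linear_of_real, unfolded o_def])
  moreover have "f w + cnj (f 0) - of_real (Re (f 0)) = f w - \<i> * of_real (Im (f 0))"
    by (simp add: complex_eq_iff)
  moreover have "f (ecirc t) * (ecirc t / (ecirc t - w)) + cnj (f (ecirc t)) * (ecirc t / (ecirc t - w)) - complex_of_real (Re (f (ecirc t)))
      = of_real (Re (f (ecirc t))) * ((ecirc t + w) / (ecirc t - w))" for t
  proof -
    have "f (ecirc t) * (ecirc t / (ecirc t - w)) + cnj (f (ecirc t)) * (ecirc t / (ecirc t - w))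
       = (f (ecirc t) + cnj (f (ecirc t))) * (ecirc t / (ecirc t - w))"
      by (rule distrib_right[symmetric])
    also have "f (ecirc t) + cnj (f (ecirc t)) = 2 * of_real (Re (f (ecirc t)))"
      by (simp add: complex_add_cnj)
    finally show ?thesis using ne[of t] by (simp add: field_simps)
  qed
  ultimately show "((\<lambda>t. of_real (Re (f (ecirc t))) * ((ecirc t + w) / (ecirc t - w))) has_integral (f w - \<i> * of_real (Im (f 0)))) {0..1}"
    by simp
qed

section \<open>Boundary measures and their weak limits\<close>

text \<open>The circle is cut open and placed on the real line, so that Helly's selection theorem
  for distributions on the line is applicable. The price is that \<open>0\<close> and
  \<open>1\<close> denote the same point of the circle.\<close>

definition circle_measure :: "(real \<Rightarrow> real) \<Rightarrow> real measure" where
  "circle_measure d = density lborel (\<lambda>t. ennreal (indicator {0..1} t * d t))"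

lemma circle_measure_integral:
  fixes \<phi> :: "real \<Rightarrow> 'a :: euclidean_space"
  assumes d: "continuous_on UNIV d" "\<And>t. d t \<ge> 0" and \<phi>: "continuous_on UNIV \<phi>"
  shows "integral\<^sup>L (circle_measure d) \<phi> = integral {0..1} (\<lambda>t. d t *\<^sub>R \<phi> t)"
proof -
  have [measurable]: "d \<in> borel_measurable borel" "\<phi> \<in> borel_measurable borel"
    using d(1) \<phi> by (auto intro: borel_measurable_continuous_onI)
  have "integral\<^sup>L (circle_measure d) \<phi> = (LINT t|lborel. (indicator {0..1} t * d t) *\<^sub>R \<phi> t)"
    unfolding circle_measure_def by (rule integral_density) (auto simp: d(2))
  also have "\<dots> = (LINT t:{0..1}|lborel. d t *\<^sub>R \<phi> t)"
    by (simp add: set_lebesgue_integral_def)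
  also have "\<dots> = integral {0..1} (\<lambda>t. d t *\<^sub>R \<phi> t)"
  proof (rule set_borel_integral_eq_integral(2))
    show "set_integrable lborel {0..1} (\<lambda>t. d t *\<^sub>R \<phi> t)"
      unfolding set_integrable_def
      by (intro borel_integrable_compact) (auto intro!: continuous_intros continuous_on_subset[OF d(1)] continuous_on_subset[OF \<phi>])
  qed
  finally show ?thesis .
qed

lemma circle_measure_distribution:
  assumes d: "continuous_on UNIV d" "\<And>t. d t \<ge> 0" "(d has_integral 1) {0..1}"
  shows "real_distribution (circle_measure d)" and "AE t in circle_measure d. t \<in> {0..1}"
proof -
  have [measurable]: "d \<in> borel_measurable borel"
    using d(1) by (auto intro: borel_measurable_continuous_onI)
  have "emeasure (circle_measure d) UNIV = (\<integral>\<^sup>+t. ennreal (indicator {0..1} t * d t) \<partial>lborel)"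
    unfolding circle_measure_def by (subst emeasure_density) auto
  also have "\<dots> = ennreal 1"
  proof (rule nn_integral_has_integral_lborel)
    show "((\<lambda>t. indicator {0..1} t * d t) has_integral 1) UNIV"
    proof -
      have "(\<lambda>t. indicator {0..1} t * d t) = (\<lambda>t. if t \<in> {0..1} then d t else 0)"
        by (auto simp: fun_eq_iff)
      thus ?thesis using d(3) has_integral_restrict_UNIV[of "{0..1}" d 1] by simp
    qed
  qed (auto simp: d(2))
  finally have "emeasure (circle_measure d) (space (circle_measure d)) = 1"
    by (simp add: circle_measure_def)
  hence "prob_space (circle_measure d)" by (rule prob_spaceI)
  thus "real_distribution (circle_measure d)"
    by (auto simp: real_distribution_def real_distribution_axioms_def circle_measure_def)
  show "AE t in circle_measure d. t \<in> {0..1}"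
    unfolding circle_measure_def by (subst AE_density) (auto simp: indicator_def)
qed

text \<open>Weak convergence only sees bounded continuous functions. A statement about the support
  of the limit is therefore phrased through a non-negative test function whose integrals tend to
  \<open>0\<close>.\<close>

lemma weak_limit_AE_zero:
  fixes \<phi> :: "real \<Rightarrow> real"
  assumes "\<And>n. real_distribution (\<mu> n)" "real_distribution M" "weak_conv_m \<mu> M"
    and \<phi>: "continuous_on UNIV \<phi>" "\<And>t. 0 \<le> \<phi> t" "\<And>t. \<phi> t \<le> B"
    and lim: "(\<lambda>n. integral\<^sup>L (\<mu> n) \<phi>) \<longlonglongrightarrow> 0"
  shows "AE t in M. \<phi> t = 0"
proof -
  interpret M: real_distribution M by fact
  have cont: "isCont \<phi> t" for t using \<phi>(1) by (simp add: continuous_on_eq_continuous_at)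
  have bd: "norm (\<phi> t) \<le> B" for t using \<phi>(2,3)[of t] by simp
  have "(\<lambda>n. integral\<^sup>L (\<mu> n) \<phi>) \<longlonglongrightarrow> integral\<^sup>L M \<phi>"
    by (rule weak_conv_imp_integral_bdd_continuous_conv[OF assms(1-3) cont bd])
  hence "integral\<^sup>L M \<phi> = 0" using lim LIMSEQ_unique by blast
  moreover have [measurable]: "\<phi> \<in> borel_measurable borel"
    using \<phi>(1) by (rule borel_measurable_continuous_onI)
  have "integrable M \<phi>"
    by (rule M.integrable_const_bound[of _ B]) (use bd in auto)
  ultimately show ?thesis
    using integral_nonneg_eq_0_iff_AE[of M \<phi>] \<phi>(2) by auto
qed

text \<open>On circles of radius less than \<open>1\<close> the normalised real part of
  \<open>f\<close> is a probability density. All these measures live on \<open>{0..1}\<close>, so a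
  subsequence converges weakly, and the Schwarz formula passes to the limit because its kernel is
  bounded and continuous in \<open>t\<close>. The last conclusion, that arcs on which the real part
  tends uniformly to \<open>0\<close> carry no mass, will locate the support.\<close>

lemma herglotz_representation:
  assumes f: "f holomorphic_on ball 0 1" and Re_f: "\<And>w. norm w < 1 \<Longrightarrow> Re (f w) \<ge> 0" and m: "Re (f 0) > 0"
  obtains M where "real_distribution M" "AE t in M. t \<in> {0..1}"
    "\<forall>w. norm w < 1 \<longrightarrow> f w = \<i> * of_real (Im (f 0)) +
        of_real (Re (f 0)) * integral\<^sup>L M (\<lambda>t. (ecirc t + w) / (ecirc t - w))"
    "\<forall>a b. (\<forall>\<epsilon>>0. \<exists>\<rho><1. \<forall>r\<in>{\<rho><..<1}. \<forall>t\<in>{a..b}. Re (f (of_real r * ecirc t)) < \<epsilon>) \<longrightarrow>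
        (AE t in M. t \<notin> {a<..<b})"
proof -
  define m where "m = Re (f 0)"
  have "m > 0" using assms by (simp add: m_def)
  \<comment> \<open>The summand \<open>2\<close> makes already the first radius positive.\<close>
  define r where "r n = 1 - 1 / (real n + 2)" for n
  have r: "0 < r n" "r n < 1" for n by (auto simp: r_def field_simps)
  have r_lim: "r \<longlonglongrightarrow> 1"
    unfolding r_def by real_asymp
  define d where "d n t = Re (f (of_real (r n) * ecirc t)) / m" for n t
  have in_ball: "norm (of_real (r n) * u) < 1" if "norm u \<le> 1" for n and u :: complex
  proof -
    have "norm (of_real (r n) * u) \<le> r n * 1"
      using r[of n] that unfolding norm_mult by (intro mult_mono) auto
    thus ?thesis using r[of n] by simp
  qed
  have fr: "(\<lambda>u. f (of_real (r n) * u)) holomorphic_on cball 0 1" for n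
    by (rule holomorphic_on_compose_gen[of "\<lambda>u. of_real (r n) * u" _ f "ball 0 1", unfolded o_def])
       (use in_ball in \<open>auto intro!: holomorphic_intros f\<close>)
  have d_cont: "continuous_on A (d n)" for A n
  proof -
    have "continuous_on A (\<lambda>t. f (of_real (r n) * ecirc t))"
      by (rule continuous_on_compose2[OF holomorphic_on_imp_continuous_on[OF f]])
         (use in_ball in \<open>auto intro!: continuous_intros\<close>)
    thus ?thesis unfolding d_def using \<open>m > 0\<close> by (intro continuous_intros) auto
  qed
  have d_nonneg: "d n t \<ge> 0" for n t
    unfolding d_def using \<open>m > 0\<close> by (intro divide_nonneg_pos Re_f in_ball) auto
  have d_int: "(d n has_integral 1) {0..1}" for n
  proof -
    have "((\<lambda>t. Re (f (of_real (r n) * ecirc t))) has_integral m) {0..1}"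
      using schwarz_circle(2)[OF fr[of n], of 0] by (simp add: m_def)
    from has_integral_divide[OF this, of m] show ?thesis using \<open>m > 0\<close> by (simp add: d_def[abs_def])
  qed
  define \<mu> where "\<mu> n = circle_measure (d n)" for n
  have \<mu>: "real_distribution (\<mu> n)" for n
    unfolding \<mu>_def by (rule circle_measure_distribution(1)[OF d_cont d_nonneg d_int])
  have \<mu>_AE: "AE t in \<mu> n. t \<in> {0..1}" for n
    unfolding \<mu>_def by (rule circle_measure_distribution(2)[OF d_cont d_nonneg d_int])
  have "tight \<mu>"
    unfolding tight_def
  proof (intro conjI allI impI \<mu>)
    fix \<epsilon> :: real assume "\<epsilon> > 0"
    have "measure (\<mu> n) {-1<..1} = 1" for n
    proof -
      interpret real_distribution "\<mu> n" by (rule \<mu>)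
      have "AE t in \<mu> n. t \<in> {-1<..1}" using \<mu>_AE[of n] by eventually_elim auto
      thus ?thesis by (subst prob_eq_1) auto
    qed
    thus "\<exists>a b. a < b \<and> (\<forall>n. 1 - \<epsilon> < measure (\<mu> n) {a<..b})"
      using \<open>\<epsilon> > 0\<close> by (intro exI[of _ "-1"] exI[of _ 1]) auto
  qed
  from tight_imp_convergent_subsubsequence[OF this, of id]
  obtain s M where s: "strict_mono s" and M: "real_distribution M" and conv: "weak_conv_m (\<mu> \<circ> s) M"
    by (auto simp: strict_mono_id)
  have \<mu>s: "real_distribution ((\<mu> \<circ> s) n)" for n using \<mu> by simp
  have rs_lim: "(\<lambda>n. r (s n)) \<longlonglongrightarrow> 1"
    using LIMSEQ_subseq_LIMSEQ[OF r_lim s] by (simp add: o_def)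
  interpret M: real_distribution M by fact
  show ?thesis
  proof (rule that; (intro allI impI)?)
    show "real_distribution M" by fact
    \<comment> \<open>The distance from the unit interval, cut off at \<open>1\<close> to be
      bounded; it vanishes exactly on that interval.\<close>
    define \<phi> where "\<phi> t = min 1 (max 0 (max (- t) (t - 1)))" for t :: real
    have "AE t in M. \<phi> t = 0"
    proof (rule weak_limit_AE_zero[OF \<mu>s M conv])
      show "continuous_on UNIV \<phi>" unfolding \<phi>_def by (intro continuous_intros)
      have "integral\<^sup>L ((\<mu> \<circ> s) n) \<phi> = 0" for n
      proof -
        have "AE t in \<mu> (s n). \<phi> t = 0" using \<mu>_AE[of "s n"] by eventually_elim (auto simp: \<phi>_def)
        from integral_cong_AE[OF _ _ this] integral_eq_zero_AE[OF this] show ?thesis by simp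
      qed
      thus "(\<lambda>n. integral\<^sup>L ((\<mu> \<circ> s) n) \<phi>) \<longlonglongrightarrow> 0" by simp
      show "0 \<le> \<phi> t" "\<phi> t \<le> 1" for t by (auto simp: \<phi>_def)
    qed
    thus "AE t in M. t \<in> {0..1}"
      by eventually_elim (auto simp: \<phi>_def min_def max_def split: if_splits)
  next
    fix w :: complex assume w: "norm w < 1"
    define \<phi> where "\<phi> t = (ecirc t + w) / (ecirc t - w)" for t
    have ne: "ecirc t - w \<noteq> 0" for t using w norm_ecirc[of t] by auto
    have \<phi>_cont: "continuous_on UNIV \<phi>" unfolding \<phi>_def using ne by (intro continuous_intros) auto
    have \<phi>_bd: "norm (\<phi> t) \<le> 2 / (1 - norm w)" for t
    proof -
      have "norm (ecirc t + w) \<le> 2" using norm_triangle_ineq[of "ecirc t" w] w by simp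
      moreover have "norm (ecirc t - w) \<ge> 1 - norm w" using norm_triangle_ineq2[of "ecirc t" w] by simp
      ultimately show ?thesis unfolding \<phi>_def norm_divide using w by (intro frac_le) auto
    qed
    have "(\<lambda>n. integral\<^sup>L ((\<mu> \<circ> s) n) \<phi>) \<longlonglongrightarrow> integral\<^sup>L M \<phi>"
      by (rule weak_conv_imp_integral_bdd_continuous_conv[OF \<mu>s M conv _ \<phi>_bd])
         (use \<phi>_cont in \<open>simp add: continuous_on_eq_continuous_at\<close>)
    moreover have "integral\<^sup>L ((\<mu> \<circ> s) n) \<phi> = (f (of_real (r (s n)) * w) - \<i> * of_real (Im (f 0))) / of_real m" for n
    proof -
      have "integral\<^sup>L ((\<mu> \<circ> s) n) \<phi> = integral {0..1} (\<lambda>t. d (s n) t *\<^sub>R \<phi> t)"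
        unfolding o_def \<mu>_def by (rule circle_measure_integral[OF d_cont d_nonneg \<phi>_cont])
      also have "\<dots> = (f (of_real (r (s n)) * w) - \<i> * of_real (Im (f 0))) / of_real m"
      proof (rule integral_unique)
        have "((\<lambda>t. of_real (Re (f (of_real (r (s n)) * ecirc t))) * \<phi> t) has_integral
           (f (of_real (r (s n)) * w) - \<i> * of_real (Im (f 0)))) {0..1}"
          using schwarz_circle(1)[OF fr[of "s n"] w] by (simp add: \<phi>_def)
        from has_integral_divide[OF this, of "of_real m"]
        show "((\<lambda>t. d (s n) t *\<^sub>R \<phi> t) has_integral
           (f (of_real (r (s n)) * w) - \<i> * of_real (Im (f 0))) / of_real m) {0..1}"
          by (simp add: d_def scaleR_conv_of_real)
      qed
      finally show ?thesis .
    qed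
    moreover have "(\<lambda>n. (f (of_real (r (s n)) * w) - \<i> * of_real (Im (f 0))) / of_real m) \<longlonglongrightarrow>
        (f w - \<i> * of_real (Im (f 0))) / of_real m"
    proof -
      have "(\<lambda>n. of_real (r (s n)) * w) \<longlonglongrightarrow> of_real 1 * w"
        by (intro tendsto_intros rs_lim)
      moreover have "isCont f w"
        using f w by (auto simp: continuous_on_eq_continuous_at dest!: holomorphic_on_imp_continuous_on)
      ultimately have "(\<lambda>n. f (of_real (r (s n)) * w)) \<longlonglongrightarrow> f w"
        by (intro isCont_tendsto_compose[of w f]) auto
      thus ?thesis using \<open>m > 0\<close> by (intro tendsto_intros) auto
    qed
    ultimately have "integral\<^sup>L M \<phi> = (f w - \<i> * of_real (Im (f 0))) / of_real m"
      using LIMSEQ_unique by simp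
    thus "f w = \<i> * of_real (Im (f 0)) + of_real (Re (f 0)) * integral\<^sup>L M (\<lambda>t. (ecirc t + w) / (ecirc t - w))"
      using \<open>m > 0\<close> unfolding m_def[symmetric] \<phi>_def[symmetric, abs_def] by (simp add: field_simps)
  next
    fix a b :: real
    assume unif: "\<forall>\<epsilon>>0. \<exists>\<rho><1. \<forall>r\<in>{\<rho><..<1}. \<forall>t\<in>{a..b}. Re (f (of_real r * ecirc t)) < \<epsilon>"
    \<comment> \<open>A tent that is positive exactly between \<open>a\<close> and
      \<open>b\<close>.\<close>
    define \<phi> where "\<phi> t = min 1 (max 0 (min (t - a) (b - t)))" for t
    have \<phi>_cont: "continuous_on UNIV \<phi>" unfolding \<phi>_def by (intro continuous_intros)
    have \<phi>_bd: "0 \<le> \<phi> t" "\<phi> t \<le> 1" for t by (auto simp: \<phi>_def)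
    have "AE t in M. \<phi> t = 0"
    proof (rule weak_limit_AE_zero[OF \<mu>s M conv \<phi>_cont \<phi>_bd])
      show "(\<lambda>n. integral\<^sup>L ((\<mu> \<circ> s) n) \<phi>) \<longlonglongrightarrow> 0"
      proof (rule tendstoI)
        fix \<epsilon> :: real assume \<epsilon>: "\<epsilon> > 0"
        \<comment> \<open>The factor \<open>m\<close> compensates for the normalisation of the
          density, and the factor 1/2 leaves room for a strict inequality after integration.\<close>
        obtain \<rho> where \<rho>: "\<rho> < 1" "\<And>r t. r \<in> {\<rho><..<1} \<Longrightarrow> t \<in> {a..b} \<Longrightarrow> Re (f (of_real r * ecirc t)) < \<epsilon> * m / 2"
          using unif[rule_format, of "\<epsilon> * m / 2"] \<epsilon> \<open>m > 0\<close> by auto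
        have "eventually (\<lambda>n. r (s n) > \<rho>) sequentially"
          using rs_lim \<rho>(1) by (rule order_tendstoD)
        thus "eventually (\<lambda>n. dist (integral\<^sup>L ((\<mu> \<circ> s) n) \<phi>) 0 < \<epsilon>) sequentially"
        proof eventually_elim
          case (elim n)
          have eq: "integral\<^sup>L ((\<mu> \<circ> s) n) \<phi> = integral {0..1} (\<lambda>t. d (s n) t *\<^sub>R \<phi> t)"
            unfolding o_def \<mu>_def by (rule circle_measure_integral[OF d_cont d_nonneg \<phi>_cont])
          have int: "(\<lambda>t. d (s n) t *\<^sub>R \<phi> t) integrable_on {0..1}"
            by (intro integrable_continuous_real continuous_intros d_cont continuous_on_subset[OF \<phi>_cont]) auto
          have "integral {0..1} (\<lambda>t. d (s n) t *\<^sub>R \<phi> t) \<le> integral {0..1} (\<lambda>t::real. \<epsilon> / 2)"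
          proof (rule integral_le[OF int])
            fix t :: real
            show "d (s n) t *\<^sub>R \<phi> t \<le> \<epsilon> / 2"
            proof (cases "t \<in> {a..b}")
              case True
              have "Re (f (of_real (r (s n)) * ecirc t)) < \<epsilon> * m / 2"
                using \<rho>(2)[of "r (s n)" t] elim r True by auto
              hence "d (s n) t \<le> \<epsilon> / 2" unfolding d_def using \<open>m > 0\<close> by (simp add: field_simps)
              hence "d (s n) t * \<phi> t \<le> \<epsilon> / 2 * 1" using \<phi>_bd[of t] d_nonneg[of "s n" t] \<epsilon> by (intro mult_mono) auto
              thus ?thesis by simp
            next
              case False
              hence "\<phi> t = 0" by (auto simp: \<phi>_def)
              thus ?thesis using \<epsilon> by simp
            qed
          qed auto
          moreover have "integral {0..1} (\<lambda>t. d (s n) t *\<^sub>R \<phi> t) \<ge> 0"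
            by (rule integral_nonneg[OF int]) (use \<phi>_bd d_nonneg in auto)
          ultimately show ?case unfolding eq using \<epsilon> by simp
        qed
      qed
    qed
    thus "AE t in M. t \<notin> {a<..<b}"
      by eventually_elim (auto simp: \<phi>_def min_def max_def split: if_splits)
  qed
qed

text \<open>With \<open>t = cot \<eta>\<close> this is the Nevanlinna kernel \<open>(t z - 1) / (z + t)\<close>; the angle makes the
  endpoint \<open>t = \<infinity>\<close>, where the kernel is \<open>z\<close>, the ordinary point \<open>\<eta> = 0\<close>.\<close>

definition pick_kernel :: "real \<Rightarrow> complex \<Rightarrow> complex" where
  "pick_kernel \<eta> z = (z * of_real (cos \<eta>) - of_real (sin \<eta>)) / (z * of_real (sin \<eta>) + of_real (cos \<eta>))"

text \<open>On this quarter period sin + cos >= 1, because squaring only decreases numbers between 0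
  and 1. The bound does not depend on \<eta> and so provides the domination needed under the
  integral.\<close>

lemma pick_kernel_denom:
  assumes "0 \<le> \<eta>" "\<eta> \<le> pi / 2" "Re z > 0"
  shows "norm (z * of_real (sin \<eta>) + of_real (cos \<eta>)) \<ge> min (Re z) 1"
proof -
  have s: "sin \<eta> \<ge> 0" "cos \<eta> \<ge> 0" using assms by (auto intro: sin_ge_zero cos_ge_zero)
  have "(sin \<eta>)\<^sup>2 \<le> sin \<eta>" "(cos \<eta>)\<^sup>2 \<le> cos \<eta>"
    using s by (auto simp: power2_eq_square intro!: mult_left_le)
  hence "1 \<le> sin \<eta> + cos \<eta>" using sin_cos_squared_add[of \<eta>] by linarith
  hence "min (Re z) 1 * 1 \<le> min (Re z) 1 * (sin \<eta> + cos \<eta>)"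
    using assms by (intro mult_left_mono) auto
  also have "\<dots> = min (Re z) 1 * sin \<eta> + min (Re z) 1 * cos \<eta>" by (simp add: distrib_left)
  also have "\<dots> \<le> Re z * sin \<eta> + 1 * cos \<eta>" using s by (intro add_mono mult_right_mono) auto
  also have "\<dots> = Re (z * of_real (sin \<eta>) + of_real (cos \<eta>))" by simp
  also have "\<dots> \<le> norm (z * of_real (sin \<eta>) + of_real (cos \<eta>))" by (rule complex_Re_le_cmod)
  finally show ?thesis by simp
qed

lemma pick_kernel_bound:
  assumes "0 \<le> \<eta>" "\<eta> \<le> pi / 2" "Re z > 0"
  shows "norm (pick_kernel \<eta> z) \<le> (norm z + 1) / min (Re z) 1"
proof -
  have "norm (z * of_real (cos \<eta>) - of_real (sin \<eta>)) \<le> norm (z * of_real (cos \<eta>)) + norm (complex_of_real (sin \<eta>))"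
    by (rule norm_triangle_ineq4)
  also have "\<dots> \<le> norm z * 1 + 1"
    unfolding norm_mult norm_of_real by (intro add_mono mult_left_mono) auto
  finally show ?thesis unfolding pick_kernel_def norm_divide
    using assms by (intro frac_le pick_kernel_denom) auto
qed

lemma pick_kernel_measurable [measurable]: "(\<lambda>\<eta>. pick_kernel \<eta> z) \<in> borel_measurable borel"
  unfolding pick_kernel_def
  by (intro borel_measurable_divide borel_measurable_continuous_onI continuous_intros)

section \<open>From the disc to the upper half-plane\<close>

definition cayley :: "complex \<Rightarrow> complex" where
  "cayley w = \<i> * (1 + w) / (1 - w)"

lemma cayley_Im: "w \<noteq> 1 \<Longrightarrow> Im (cayley w) = (1 - (norm w)\<^sup>2) / (norm (1 - w))\<^sup>2"
  and cayley_Re: "w \<noteq> 1 \<Longrightarrow> Re (cayley w) = - 2 * Im w / (norm (1 - w))\<^sup>2"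
proof -
  assume w: "w \<noteq> 1"
  have "cayley w = \<i> * (1 + w) * cnj (1 - w) / of_real ((norm (1 - w))\<^sup>2)"
    unfolding cayley_def complex_norm_square using w by simp
  moreover have "Im (\<i> * (1 + w) * cnj (1 - w)) = 1 - (norm w)\<^sup>2"
    unfolding cmod_power2 by (simp add: algebra_simps power2_eq_square)
  moreover have "Re (\<i> * (1 + w) * cnj (1 - w)) = - 2 * Im w"
    by (simp add: algebra_simps)
  ultimately show "Im (cayley w) = (1 - (norm w)\<^sup>2) / (norm (1 - w))\<^sup>2"
    "Re (cayley w) = - 2 * Im w / (norm (1 - w))\<^sup>2"
    by (simp_all only: Re_divide_of_real Im_divide_of_real)
qed

text \<open>The boundary point \<open>ecirc t\<close> is sent to -cot(pi t). Hence t in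
  \<open>{0..1/2}\<close> is the closed negative half-axis including infinity, and t strictly
  between 1/2 and 1 is the positive half-axis. The end t = 1 is once more the point at infinity; it
  is listed separately because the limit measure may charge both ends.\<close>

lemma cayley_kernel:
  assumes z: "Im z > 0"
  defines "w \<equiv> (z - \<i>) / (z + \<i>)"
  shows "norm w < 1" and "cayley w = z"
    and "t \<in> {0..1/2} \<Longrightarrow> (ecirc t + w) / (ecirc t - w) = - \<i> * pick_kernel (pi * t) z"
    and "(ecirc 1 + w) / (ecirc 1 - w) = - \<i> * pick_kernel 0 z"
proof -
  have nz: "z + \<i> \<noteq> 0" using z by (auto simp: complex_eq_iff)
  have "(norm (z - \<i>))\<^sup>2 < (norm (z + \<i>))\<^sup>2"
    unfolding cmod_power2 using z by (simp add: algebra_simps power2_eq_square)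
  hence "norm (z - \<i>) < norm (z + \<i>)" by (rule power_less_imp_less_base) auto
  thus "norm w < 1" unfolding w_def norm_divide using nz by simp
  have 1: "1 + w = 2 * z / (z + \<i>)" "1 - w = 2 * \<i> / (z + \<i>)"
    unfolding w_def using nz by (simp_all add: field_simps)
  show cz: "cayley w = z" unfolding cayley_def 1 using nz by simp
  show "(ecirc 1 + w) / (ecirc 1 - w) = - \<i> * pick_kernel 0 z"
  proof -
    have "ecirc 1 = 1" by (simp add: ecirc_cis)
    hence "(ecirc 1 + w) / (ecirc 1 - w) = - \<i> * cayley w" by (simp add: cayley_def)
    thus ?thesis unfolding cz by (simp add: pick_kernel_def)
  qed
  show "(ecirc t + w) / (ecirc t - w) = - \<i> * pick_kernel (pi * t) z" if t: "t \<in> {0..1/2}"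
  proof -
    define c s where "c = complex_of_real (cos (pi * t))" and "s = complex_of_real (sin (pi * t))"
    \<comment> \<open>\<open>e\<close> is the square root of \<open>ecirc t\<close> and
      \<open>e'\<close> its inverse. Extracting \<open>e\<close> from numerator and denominator
      passes to half the angle and leaves real cosines and sines.\<close>
    define e where "e = c + \<i> * s"
    define e' where "e' = c - \<i> * s"
    have cs: "c\<^sup>2 + s\<^sup>2 = 1" unfolding c_def s_def by (simp flip: of_real_power of_real_add)
    have ee: "e * e' = 1" using cs by (simp add: e_def e'_def algebra_simps power2_eq_square)
    have et: "ecirc t = e * e"
    proof -
      have "e = cis (pi * t)" by (simp add: e_def c_def s_def complex_eq_iff)
      thus ?thesis by (simp add: ecirc_cis cis_mult mult.assoc)
    qed
    have e0: "e \<noteq> 0" using ee by auto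
    have "(ecirc t + w) / (ecirc t - w) = (ecirc t * (z + \<i>) + (z - \<i>)) / (ecirc t * (z + \<i>) - (z - \<i>))"
    proof -
      have "ecirc t + w = (ecirc t * (z + \<i>) + (z - \<i>)) / (z + \<i>)"
        "ecirc t - w = (ecirc t * (z + \<i>) - (z - \<i>)) / (z + \<i>)"
        unfolding w_def using nz by (simp_all add: add_divide_distrib diff_divide_distrib)
      thus ?thesis using nz by simp
    qed
    also have "ecirc t * (z + \<i>) + (z - \<i>) = e * (e * (z + \<i>) + e' * (z - \<i>))"
      unfolding et using ee by (simp add: algebra_simps)
    also have "ecirc t * (z + \<i>) - (z - \<i>) = e * (e * (z + \<i>) - e' * (z - \<i>))"
      unfolding et using ee by (simp add: algebra_simps)
    also have "e * (z + \<i>) + e' * (z - \<i>) = 2 * (z * c - s)"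
      by (simp add: e_def e'_def algebra_simps)
    also have "e * (z + \<i>) - e' * (z - \<i>) = 2 * (\<i> * (z * s + c))"
      by (simp add: e_def e'_def algebra_simps)
    also have "e * (2 * (z * c - s)) / (e * (2 * (\<i> * (z * s + c)))) = - \<i> * ((z * c - s) / (z * s + c))"
    proof -
      have "e * (2 * A) / (e * (2 * (\<i> * B))) = - \<i> * (A / B)" for A B
        using e0 by (cases "B = 0") (simp_all add: field_simps)
      thus ?thesis .
    qed
    finally show ?thesis by (simp add: pick_kernel_def c_def s_def)
  qed
qed

lemma Im_pos_slit: "Im z > 0 \<Longrightarrow> z \<in> - \<real>\<^sub>\<le>\<^sub>0"
  by (auto simp: complex_nonpos_Reals_iff)

text \<open>The arc is mapped into the positive axis, where \<psi> is real, so the imaginary part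
  vanishes for radius \<open>1\<close>. Uniform continuity on a compact sector up to the boundary
  does the rest. Radii are kept above 1/2 so that the sector avoids the origin and its image lies in
  the right half-plane.\<close>

lemma pick_boundary_uniform:
  assumes hol: "\<psi> holomorphic_on (- \<real>\<^sub>\<le>\<^sub>0)" and real: "\<And>x. x > 0 \<Longrightarrow> \<psi> (of_real x) \<in> \<real>"
    and ab: "1 / 2 < a" "b < 1" and \<epsilon>: "\<epsilon> > 0"
  shows "\<exists>\<rho><1. \<forall>r\<in>{\<rho><..<1}. \<forall>t\<in>{a..b}. Im (\<psi> (cayley (of_real r * ecirc t))) < \<epsilon>"
proof -
  define K where "K = {1/2..1::real} \<times> {a..b}"
  define F where "F p = Im (\<psi> (cayley (of_real (fst p) * ecirc (snd p))))" for p
  have sin_neg: "sin (2 * pi * t) < 0" if "t \<in> {a..b}" for t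
  proof -
    have "pi < 2 * pi * t" "2 * pi * t < 2 * pi" using that ab by auto
    thus ?thesis by (rule sin_lt_zero)
  qed
  have Im_neg: "Im (of_real (fst p) * ecirc (snd p)) < 0" if "p \<in> K" for p
    using that sin_neg[of "snd p"] by (auto simp: K_def ecirc_cis mult_pos_neg)
  have ne1: "of_real (fst p) * ecirc (snd p) \<noteq> 1" if "p \<in> K" for p
    using Im_neg[OF that] by (metis less_irrefl one_complex.simps(2))
  have Re_pos: "Re (cayley (of_real (fst p) * ecirc (snd p))) > 0" if "p \<in> K" for p
    using Im_neg[OF that] ne1[OF that] by (subst cayley_Re) (auto intro!: divide_neg_pos)
  have contF: "continuous_on K F"
  proof -
    have "continuous_on K (\<lambda>p. ecirc (snd p))"
      by (rule continuous_on_compose2[OF continuous_on_ecirc[of UNIV]]) (auto intro!: continuous_intros)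
    hence "continuous_on K (\<lambda>p. cayley (of_real (fst p) * ecirc (snd p)))"
      unfolding cayley_def using ne1 by (intro continuous_intros) auto
    moreover have "cayley (of_real (fst p) * ecirc (snd p)) \<in> - \<real>\<^sub>\<le>\<^sub>0" if "p \<in> K" for p
      using Re_pos[OF that] by (auto simp: complex_nonpos_Reals_iff)
    ultimately have "continuous_on K (\<lambda>p. \<psi> (cayley (of_real (fst p) * ecirc (snd p))))"
      by (intro continuous_on_compose2[OF holomorphic_on_imp_continuous_on[OF hol]]) auto
    thus ?thesis unfolding F_def by (intro continuous_intros)
  qed
  have "compact K" unfolding K_def by (intro compact_Times) auto
  from compact_uniformly_continuous[OF contF this] \<epsilon>
  obtain \<delta> where \<delta>: "\<delta> > 0" "\<And>p p'. p \<in> K \<Longrightarrow> p' \<in> K \<Longrightarrow> dist p' p < \<delta> \<Longrightarrow> dist (F p') (F p) < \<epsilon>"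
    unfolding uniformly_continuous_on_def by metis
  have F1: "F (1, t) = 0" if "t \<in> {a..b}" for t
  proof -
    have p: "(1, t) \<in> K" using that by (simp add: K_def)
    have "Im (cayley (ecirc t)) = 0" using ne1[OF p] by (subst cayley_Im) auto
    hence "cayley (ecirc t) = of_real (Re (cayley (ecirc t)))" by (simp add: complex_eq_iff)
    moreover have "Re (cayley (ecirc t)) > 0" using Re_pos[OF p] by simp
    ultimately have "\<psi> (cayley (ecirc t)) \<in> \<real>" using real by metis
    thus ?thesis by (simp add: F_def complex_is_Real_iff)
  qed
  show ?thesis
  proof (intro exI[of _ "max (1/2) (1 - \<delta>)"] conjI ballI)
    show "max (1/2) (1 - \<delta>) < 1" using \<open>\<delta> > 0\<close> by simp
    fix r t assume r: "r \<in> {max (1/2) (1 - \<delta>)<..<1}" and t: "t \<in> {a..b}"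
    have "dist (F (r, t)) (F (1, t)) < \<epsilon>"
      by (rule \<delta>(2)) (use r t in \<open>auto simp: K_def dist_Pair_Pair dist_real_def\<close>)
    thus "Im (\<psi> (cayley (of_real r * ecirc t))) < \<epsilon>"
      using F1[OF t] by (simp add: F_def dist_real_def)
  qed
qed

text \<open>Normalised to total mass \<open>1\<close>; the mass of the representing measure is kept
  as a separate factor, so that constants correspond to the factor \<open>0\<close>.\<close>

definition pick_measure :: "real measure \<Rightarrow> bool" where
  "pick_measure M \<longleftrightarrow> real_distribution M \<and> (AE \<eta> in M. \<eta> \<in> {0..pi/2})"

lemma pick_representation_upper:
  assumes hol: "\<psi> holomorphic_on (- \<real>\<^sub>\<le>\<^sub>0)" and real: "\<And>x. x > 0 \<Longrightarrow> \<psi> (of_real x) \<in> \<real>"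
    and Im_psi: "\<And>z. Im z > 0 \<Longrightarrow> Im (\<psi> z) \<ge> 0" and pos: "Im (\<psi> \<i>) > 0"
  obtains M where "pick_measure M"
    "\<forall>z. Im z > 0 \<longrightarrow> \<psi> z = of_real (Re (\<psi> \<i>)) + of_real (Im (\<psi> \<i>)) * integral\<^sup>L M (\<lambda>\<eta>. pick_kernel \<eta> z)"
proof -
  define f where "f w = - \<i> * \<psi> (cayley w)" for w
  have Im_cayley: "Im (cayley w) > 0" if "norm w < 1" for w
  proof -
    have "(norm w)\<^sup>2 < 1" using that by (simp add: power_less_one_iff)
    thus ?thesis using that by (subst cayley_Im) (auto intro!: divide_pos_pos)
  qed
  have f0: "f 0 = - \<i> * \<psi> \<i>" by (simp add: f_def cayley_def)
  have f_hol: "f holomorphic_on ball 0 1"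
  proof -
    have "cayley holomorphic_on ball 0 1"
      unfolding cayley_def[abs_def] by (intro holomorphic_intros) auto
    moreover have "cayley ` ball 0 1 \<subseteq> - \<real>\<^sub>\<le>\<^sub>0" using Im_cayley Im_pos_slit by auto
    ultimately have "(\<psi> \<circ> cayley) holomorphic_on ball 0 1"
      by (intro holomorphic_on_compose_gen[OF _ hol])
    thus ?thesis unfolding f_def[abs_def] by (intro holomorphic_intros) (simp add: o_def)
  qed
  have Re_f: "Re (f w) \<ge> 0" if "norm w < 1" for w
    using Im_psi[OF Im_cayley[OF that]] by (simp add: f_def)
  have Re_f0: "Re (f 0) > 0" using pos by (simp add: f0)
  obtain M where M: "real_distribution M" "AE t in M. t \<in> {0..1}"
    and "\<forall>w. norm w < 1 \<longrightarrow> f w = \<i> * of_real (Im (f 0)) +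
        of_real (Re (f 0)) * integral\<^sup>L M (\<lambda>t. (ecirc t + w) / (ecirc t - w))"
    and "\<forall>a b. (\<forall>\<epsilon>>0. \<exists>\<rho><1. \<forall>r\<in>{\<rho><..<1}. \<forall>t\<in>{a..b}. Re (f (of_real r * ecirc t)) < \<epsilon>) \<longrightarrow>
        (AE t in M. t \<notin> {a<..<b})"
    by (rule herglotz_representation[OF f_hol Re_f Re_f0])
  note rep = this(3)[rule_format] and gap = this(4)[rule_format]
  interpret M: real_distribution M by fact
  \<comment> \<open>The open arc over the positive axis is exhausted by countably many closed arcs,
    since the boundary values are uniformly small only away from its ends. For small
    \<open>n\<close> the interval is empty.\<close>
  have "AE t in M. t \<notin> {1/2 + 1 / real (n + 1)<..<1 - 1 / real (n + 1)}" for n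
  proof (rule gap)
    fix \<epsilon> :: real assume "\<epsilon> > 0"
    have "\<exists>\<rho><1. \<forall>r\<in>{\<rho><..<1}. \<forall>t\<in>{1/2 + 1 / real (n + 1)..1 - 1 / real (n + 1)}. Im (\<psi> (cayley (of_real r * ecirc t))) < \<epsilon>"
      by (rule pick_boundary_uniform[OF hol real _ _ \<open>\<epsilon> > 0\<close>]) auto
    thus "\<exists>\<rho><1. \<forall>r\<in>{\<rho><..<1}. \<forall>t\<in>{1/2 + 1 / real (n + 1)..1 - 1 / real (n + 1)}. Re (f (of_real r * ecirc t)) < \<epsilon>"
      by (simp add: f_def)
  qed
  hence "AE t in M. \<forall>n. t \<notin> {1/2 + 1 / real (n + 1)<..<1 - 1 / real (n + 1)}"
    by (simp add: AE_all_countable)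
  with M(2) have supp: "AE t in M. t \<in> {0..1/2} \<union> {1}"
  proof eventually_elim
    case (elim t)
    show ?case
    proof (rule ccontr)
      assume "t \<notin> {0..1/2} \<union> {1}"
      hence t: "1/2 < t" "t < 1" using elim by auto
      hence "0 < min (t - 1/2) (1 - t)" by simp
      then obtain n where "inverse (real (Suc n)) < min (t - 1/2) (1 - t)"
        using reals_Archimedean by blast
      hence "t \<in> {1/2 + 1 / real (n + 1)<..<1 - 1 / real (n + 1)}" by (auto simp: inverse_eq_divide)
      thus False using elim by blast
    qed
  qed
  \<comment> \<open>Outside a null set the second branch concerns only t = 1, the other copy of the
    point at infinity, which is thereby merged with t = 0.\<close>
  define \<eta> where "\<eta> t = (if t \<le> 1/2 then pi * t else 0)" for t :: real
  have [measurable]: "\<eta> \<in> borel_measurable borel" unfolding \<eta>_def by measurable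
  define M' where "M' = distr M borel \<eta>"
  have "real_distribution M'" unfolding M'_def by (rule M.real_distribution_distr) measurable
  moreover have "AE x in M'. x \<in> {0..pi/2}"
    unfolding M'_def
  proof (subst AE_distr_iff)
    show "AE x in M. \<eta> x \<in> {0..pi/2}" using supp by eventually_elim (auto simp: \<eta>_def)
  qed auto
  moreover have "\<psi> z = of_real (Re (\<psi> \<i>)) + of_real (Im (\<psi> \<i>)) * integral\<^sup>L M' (\<lambda>\<eta>. pick_kernel \<eta> z)" if z: "Im z > 0" for z
  proof -
    define w where "w = (z - \<i>) / (z + \<i>)"
    note ck = cayley_kernel[OF z, folded w_def]
    have "integral\<^sup>L M' (\<lambda>\<eta>. pick_kernel \<eta> z) = integral\<^sup>L M (\<lambda>t. pick_kernel (\<eta> t) z)"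
      unfolding M'_def by (rule integral_distr) measurable
    moreover have "integral\<^sup>L M (\<lambda>t. (ecirc t + w) / (ecirc t - w)) = integral\<^sup>L M (\<lambda>t. - \<i> * pick_kernel (\<eta> t) z)"
    proof (rule integral_cong_AE)
      have "(\<lambda>t. (ecirc t + w) / (ecirc t - w)) \<in> borel_measurable borel"
        by (intro borel_measurable_divide borel_measurable_continuous_onI continuous_intros)
      thus "(\<lambda>t. (ecirc t + w) / (ecirc t - w)) \<in> borel_measurable M" by simp
      show "(\<lambda>t. - \<i> * pick_kernel (\<eta> t) z) \<in> borel_measurable M" by measurable
      show "AE t in M. (ecirc t + w) / (ecirc t - w) = - \<i> * pick_kernel (\<eta> t) z"
        using supp by eventually_elim (use ck(3,4) in \<open>auto simp: \<eta>_def\<close>)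
    qed
    ultimately have int: "integral\<^sup>L M (\<lambda>t. (ecirc t + w) / (ecirc t - w)) = - \<i> * integral\<^sup>L M' (\<lambda>\<eta>. pick_kernel \<eta> z)"
      by simp
    have "\<psi> z = \<i> * f w" by (simp add: f_def ck(2))
    also have "f w = - \<i> * of_real (Re (\<psi> \<i>)) + of_real (Im (\<psi> \<i>)) * (- \<i> * integral\<^sup>L M' (\<lambda>\<eta>. pick_kernel \<eta> z))"
      unfolding rep[OF ck(1)] int by (simp add: f0)
    finally show ?thesis by (simp add: algebra_simps)
  qed
  ultimately show ?thesis using that unfolding pick_measure_def by blast
qed

lemma pick_kernel_denom_nonzero:
  fixes z :: complex
  assumes "0 \<le> \<eta>" "\<eta> \<le> pi / 2" "z \<in> - \<real>\<^sub>\<le>\<^sub>0"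
  shows "z * of_real (sin \<eta>) + of_real (cos \<eta>) \<noteq> 0"
proof
  assume eq: "z * of_real (sin \<eta>) + of_real (cos \<eta>) = 0"
  have sc: "sin \<eta> \<ge> 0" "cos \<eta> \<ge> 0" using assms by (auto intro: sin_ge_zero cos_ge_zero)
  have "sin \<eta> \<noteq> 0" using eq sin_zero_abs_cos_one by fastforce
  moreover have "z * of_real (sin \<eta>) = - of_real (cos \<eta>)" using eq by (simp add: eq_neg_iff_add_eq_0)
  ultimately have "z = - of_real (cos \<eta>) / of_real (sin \<eta>)"
    by (subst nonzero_eq_divide_eq) simp_all
  hence "z = of_real (- cos \<eta> / sin \<eta>)" by simp
  moreover have "- cos \<eta> / sin \<eta> \<le> 0" using sc by simp
  ultimately have "z \<in> \<real>\<^sub>\<le>\<^sub>0" by (simp only: nonpos_Reals_of_real_iff)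
  thus False using assms by simp
qed

lemma pick_measure_integrable:
  assumes "pick_measure M" "z \<in> - \<real>\<^sub>\<le>\<^sub>0"
  shows "integrable M (\<lambda>\<eta>. pick_kernel \<eta> z)"
proof -
  interpret real_distribution M using assms by (simp add: pick_measure_def)
  have "continuous_on {0..pi/2} (\<lambda>\<eta>. pick_kernel \<eta> z)"
    unfolding pick_kernel_def using pick_kernel_denom_nonzero[OF _ _ assms(2)]
    by (intro continuous_intros) auto
  hence "bounded ((\<lambda>\<eta>. pick_kernel \<eta> z) ` {0..pi/2})"
    by (intro compact_imp_bounded compact_continuous_image) auto
  then obtain B where B: "\<And>\<eta>. \<eta> \<in> {0..pi/2} \<Longrightarrow> norm (pick_kernel \<eta> z) \<le> B"
    unfolding bounded_iff by blast
  have "AE \<eta> in M. \<eta> \<in> {0..pi/2}" using assms by (simp add: pick_measure_def)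
  hence "AE \<eta> in M. norm (pick_kernel \<eta> z) \<le> B" by eventually_elim (rule B)
  thus ?thesis by (rule integrable_const_bound) measurable
qed

text \<open>Two gaps of the half-plane version are closed: the degenerate case in which the
  imaginary part vanishes at \<open>\<i>\<close>, and the positive real axis, where the multiplier
  is actually evaluated.\<close>

lemma pick_representation:
  assumes hol: "\<psi> holomorphic_on (- \<real>\<^sub>\<le>\<^sub>0)" and real: "\<And>x. x > 0 \<Longrightarrow> \<psi> (of_real x) \<in> \<real>"
    and Im_psi: "\<And>z. Im z > 0 \<Longrightarrow> Im (\<psi> z) \<ge> 0"
  obtains c m M where "m \<ge> 0" "pick_measure M"
    "\<forall>z. Im z > 0 \<or> Im z = 0 \<and> Re z > 0 \<longrightarrow>
       \<psi> z = of_real c + of_real m * integral\<^sup>L M (\<lambda>\<eta>. pick_kernel \<eta> z)"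
proof -
  have "\<exists>c m M. m \<ge> 0 \<and> pick_measure M \<and>
    (\<forall>z. Im z > 0 \<longrightarrow> \<psi> z = of_real c + of_real m * integral\<^sup>L M (\<lambda>\<eta>. pick_kernel \<eta> z))"
  proof (cases "Im (\<psi> \<i>) > 0")
    case True
    obtain M where M: "pick_measure M"
      "\<forall>z. Im z > 0 \<longrightarrow> \<psi> z = of_real (Re (\<psi> \<i>)) + of_real (Im (\<psi> \<i>)) * integral\<^sup>L M (\<lambda>\<eta>. pick_kernel \<eta> z)"
      by (rule pick_representation_upper[OF hol real Im_psi True])
    show ?thesis
      by (intro exI[of _ "Re (\<psi> \<i>)"] exI[of _ "Im (\<psi> \<i>)"] exI[of _ M] conjI M less_imp_le[OF True])
  next
    case False
    hence Im0: "Im (\<psi> \<i>) = 0" using Im_psi[of \<i>] by simp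
    \<comment> \<open>The imaginary part attains its minimum \<open>0\<close> at
      \<open>\<i>\<close>. A non-constant \<psi> would be open and take values below the real axis
      nearby.\<close>
    define U where "U = {z. Im z > 0}"
    have U: "open U" "connected U" "\<i> \<in> U"
      by (auto simp: U_def open_halfspace_Im_gt convex_halfspace_Im_gt convex_connected)
    have "\<psi> constant_on U"
    proof (rule ccontr)
      assume "\<not> \<psi> constant_on U"
      hence "open (\<psi> ` U)"
        by (intro open_mapping_thm[of \<psi> U U] holomorphic_on_subset[OF hol] U) (auto simp: U_def complex_nonpos_Reals_iff)
      moreover have "\<psi> \<i> \<in> \<psi> ` U" using U by blast
      ultimately obtain e where e: "e > 0" "ball (\<psi> \<i>) e \<subseteq> \<psi> ` U" by (meson open_contains_ball)
      have "\<psi> \<i> - of_real (e / 2) * \<i> \<in> ball (\<psi> \<i>) e" using e by (simp add: dist_norm norm_mult)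
      hence "\<psi> \<i> - of_real (e / 2) * \<i> \<in> \<psi> ` U" using e(2) by (rule rev_subsetD)
      then obtain z where "z \<in> U" "\<psi> \<i> - of_real (e / 2) * \<i> = \<psi> z" by (rule imageE)
      moreover have "Im (\<psi> \<i> - of_real (e / 2) * \<i>) < 0" using e Im0 by simp
      ultimately show False using Im_psi[of z] by (simp add: U_def)
    qed
    then obtain y where y: "\<And>z. z \<in> U \<Longrightarrow> \<psi> z = y" unfolding constant_on_def by blast
    have "y = of_real (Re y)" using y[OF U(3)] Im0 by (simp add: complex_eq_iff)
    hence "\<psi> z = of_real (Re y)" if "Im z > 0" for z
      using y[of z] that by (simp add: U_def)
    \<comment> \<open>The mass factor is \<open>0\<close>, so any admissible measure serves; the
      uniform distribution on \<open>{0..1}\<close> is one, as 1 <= pi / 2.\<close>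
    moreover have "pick_measure (circle_measure (\<lambda>_. 1))"
    proof -
      have "((\<lambda>_. 1::real) has_integral 1) {0..1::real}"
        using has_integral_const_real[of "1::real" 0 1] by simp
      note M = circle_measure_distribution[OF continuous_on_const _ this]
      have "AE \<eta> in circle_measure (\<lambda>_. 1). \<eta> \<in> {0..1}" by (rule M(2)) simp
      hence "AE \<eta> in circle_measure (\<lambda>_. 1). \<eta> \<in> {0..pi/2}"
        by eventually_elim (use pi_ge_two in auto)
      with M(1) show ?thesis by (simp add: pick_measure_def)
    qed
    ultimately show ?thesis
      by (intro exI[of _ "Re y"] exI[of _ 0] exI[of _ "circle_measure (\<lambda>_. 1)"] conjI) simp_all
  qed
  then obtain c m M where m: "m \<ge> 0" and M: "pick_measure M" and
    rep: "\<And>z. Im z > 0 \<Longrightarrow> \<psi> z = of_real c + of_real m * integral\<^sup>L M (\<lambda>\<eta>. pick_kernel \<eta> z)"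
    by auto
  interpret M: real_distribution M using M by (simp add: pick_measure_def)
  have "\<psi> z = of_real c + of_real m * integral\<^sup>L M (\<lambda>\<eta>. pick_kernel \<eta> z)" if z: "Im z = 0" "Re z > 0" for z
  proof -
    \<comment> \<open>The axis is approached vertically, so the real part stays fixed and a single
      kernel bound dominates the sequence.\<close>
    define u where "u n = z + of_real (1 / real (n + 1)) * \<i>" for n
    have u: "Im (u n) > 0" "Re (u n) = Re z" for n using z by (auto simp: u_def)
    have u_norm: "norm (u n) \<le> norm z + 1" for n
    proof -
      have "norm (u n) \<le> norm z + norm (of_real (1 / real (n + 1)) * \<i>)"
        unfolding u_def by (rule norm_triangle_ineq)
      also have "norm (of_real (1 / real (n + 1)) * \<i>) \<le> 1" unfolding norm_mult norm_of_real by simp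
      finally show ?thesis by simp
    qed
    have "(\<lambda>n. of_real (1 / real (n + 1)) * \<i>) \<longlonglongrightarrow> of_real 0 * \<i>"
      by (intro tendsto_intros) real_asymp
    hence u_lim: "u \<longlonglongrightarrow> z"
      unfolding u_def using tendsto_add[OF tendsto_const[of z]] by fastforce
    have "isCont \<psi> z"
      using hol z by (auto simp: continuous_on_eq_continuous_at complex_nonpos_Reals_iff closed_nonpos_Reals_complex open_Compl
          dest!: holomorphic_on_imp_continuous_on)
    hence lim1: "(\<lambda>n. \<psi> (u n)) \<longlonglongrightarrow> \<psi> z" using u_lim by (rule isCont_tendsto_compose)
    have supp: "AE \<eta> in M. \<eta> \<in> {0..pi/2}" using M by (simp add: pick_measure_def)
    have "(\<lambda>n. integral\<^sup>L M (\<lambda>\<eta>. pick_kernel \<eta> (u n))) \<longlonglongrightarrow> integral\<^sup>L M (\<lambda>\<eta>. pick_kernel \<eta> z)"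
    proof (rule integral_dominated_convergence[where w = "\<lambda>_. (norm z + 2) / min (Re z) 1"])
      show "AE \<eta> in M. (\<lambda>n. pick_kernel \<eta> (u n)) \<longlonglongrightarrow> pick_kernel \<eta> z"
        using supp
      proof eventually_elim
        case (elim \<eta>)
        have "norm (z * of_real (sin \<eta>) + of_real (cos \<eta>)) > 0"
          using pick_kernel_denom[of \<eta> z] elim z by (auto simp: min_def split: if_splits)
        thus ?case unfolding pick_kernel_def by (intro tendsto_intros u_lim) auto
      qed
      show "AE \<eta> in M. norm (pick_kernel \<eta> (u n)) \<le> (norm z + 2) / min (Re z) 1" for n
        using supp
      proof eventually_elim
        case (elim \<eta>)
        have "norm (pick_kernel \<eta> (u n)) \<le> (norm (u n) + 1) / min (Re (u n)) 1"
          using elim u z by (intro pick_kernel_bound) auto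
        also have "\<dots> \<le> (norm z + 2) / min (Re z) 1"
          unfolding u(2) using u_norm[of n] z by (intro divide_right_mono) auto
        finally show ?case .
      qed
    qed auto
    hence "(\<lambda>n. of_real c + of_real m * integral\<^sup>L M (\<lambda>\<eta>. pick_kernel \<eta> (u n))) \<longlonglongrightarrow>
        of_real c + of_real m * integral\<^sup>L M (\<lambda>\<eta>. pick_kernel \<eta> z)"
      by (intro tendsto_intros)
    hence "(\<lambda>n. \<psi> (u n)) \<longlonglongrightarrow> of_real c + of_real m * integral\<^sup>L M (\<lambda>\<eta>. pick_kernel \<eta> z)"
      using rep[OF u(1)] by simp
    with lim1 show ?thesis using LIMSEQ_unique by blast
  qed
  with rep m M that show ?thesis by blast
qed

section \<open>Superposition of kernels\<close>

lemma taylor_deriv: "taylor (deriv G) k = real (Suc k) * taylor G (Suc k)"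
proof -
  have "(deriv ^^ k) (deriv G) = (deriv ^^ Suc k) G" by (simp add: funpow_swap1)
  thus ?thesis unfolding taylor_def by (simp only:) (simp add: fact_Suc del: of_nat_Suc)
qed

lemma LPplus_sums_deriv:
  assumes "G \<in> LPplus" "deriv G 0 \<noteq> 0"
  shows "(\<lambda>k. of_real (real k * taylor G k) * z ^ k) sums (z * deriv G z)"
proof -
  have "(\<lambda>k. z * (of_real (real (Suc k) * taylor G (Suc k)) * z ^ k)) sums (z * deriv G z)"
    using LPplus_sums[OF LPplus_deriv[OF assms], of z] unfolding taylor_deriv by (rule sums_mult)
  hence "(\<lambda>k. of_real (real (Suc k) * taylor G (Suc k)) * z ^ Suc k) sums (z * deriv G z)"
    by (simp add: mult_ac)
  thus ?thesis by (subst (asm) sums_Suc_iff) simp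
qed

text \<open>For t = cot \<eta> the kernel is a constant minus a positive multiple of the model
  function 1 / (x + t), taken at x = k + 1. The inequality of the model case therefore applies with
  reversed sign.\<close>

lemma pick_kernel_cot:
  fixes k :: nat
  assumes "0 < \<eta>" "\<eta> \<le> pi / 2"
  defines "t \<equiv> cos \<eta> / sin \<eta>"
  shows "pick_kernel \<eta> (of_nat (k + 1)) = of_real (t - (t\<^sup>2 + 1) / (real k + 1 + t))" and "t \<ge> 0"
proof -
  have s: "sin \<eta> > 0" using assms by (intro sin_gt_zero) auto
  have c: "cos \<eta> \<ge> 0" using assms by (intro cos_ge_zero) auto
  show t: "t \<ge> 0" using s c by (simp add: t_def)
  define x where "x = real k + 1"
  have x: "x > 0" by (simp add: x_def)
  have "pick_kernel \<eta> (of_nat (k + 1)) = of_real ((x * cos \<eta> - sin \<eta>) / (x * sin \<eta> + cos \<eta>))"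
    by (simp add: pick_kernel_def x_def add.commute)
  also have "cos \<eta> = t * sin \<eta>" using s by (simp add: t_def)
  also have "(x * (t * sin \<eta>) - sin \<eta>) / (x * sin \<eta> + t * sin \<eta>) = (sin \<eta> * (x * t - 1)) / (sin \<eta> * (x + t))"
    by (simp add: algebra_simps)
  also have "\<dots> = (x * t - 1) / (x + t)" using s by simp
  also have "\<dots> = t - (t\<^sup>2 + 1) / (x + t)"
    using x t by (simp add: field_simps power2_eq_square)
  finally show "pick_kernel \<eta> (of_nat (k + 1)) = of_real (t - (t\<^sup>2 + 1) / (real k + 1 + t))"
    by (simp add: x_def)
qed

text \<open>At \<eta> = 0 the kernel is z itself and the series is G + z G', so the claim reduces to
  the positive imaginary part of z G' / G. Otherwise the model case with t = cot \<eta> decides, and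
  its strict form needs t > 0, that is \<eta> < pi / 2.\<close>

lemma pick_kernel_series:
  assumes G: "G \<in> LPplus" and G1: "deriv G 0 \<noteq> 0" and z: "Re z \<ge> 0" "Im z > 0" and \<eta>: "0 \<le> \<eta>" "\<eta> \<le> pi / 2"
  shows "Im ((\<Sum>k. pick_kernel \<eta> (of_nat (k + 1)) * of_real (taylor G k) * z ^ k) / G z) \<ge> 0"
    and "\<eta> < pi / 2 \<Longrightarrow> Im ((\<Sum>k. pick_kernel \<eta> (of_nat (k + 1)) * of_real (taylor G k) * z ^ k) / G z) > 0"
proof -
  have Gz: "G z \<noteq> 0" using LPplus_nonzero[OF G z(1)] .
  let ?T = "\<Sum>k. pick_kernel \<eta> (of_nat (k + 1)) * of_real (taylor G k) * z ^ k"
  have "Im (?T / G z) \<ge> 0 \<and> (\<eta> < pi / 2 \<longrightarrow> Im (?T / G z) > 0)"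
  proof (cases "\<eta> = 0")
    case True
    have "(\<lambda>k. of_real (taylor G k) * z ^ k + of_real (real k * taylor G k) * z ^ k) sums (G z + z * deriv G z)"
      by (intro sums_add LPplus_sums LPplus_sums_deriv G G1)
    hence "(\<lambda>k. pick_kernel \<eta> (of_nat (k + 1)) * of_real (taylor G k) * z ^ k) sums (G z + z * deriv G z)"
      by (simp add: True pick_kernel_def algebra_simps)
    hence "?T / G z = 1 + z * deriv G z / G z"
      using Gz by (simp add: sums_iff add_divide_distrib)
    hence "Im (?T / G z) = Im (z * deriv G z / G z)" by simp
    moreover have "Im (z * deriv G z / G z) > 0"
      using LPplus_log_deriv(3)[OF G z, of 1] G1 by simp
    ultimately show ?thesis by simp
  next
    case False
    define t where "t = cos \<eta> / sin \<eta>"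
    have \<eta>0: "\<eta> > 0" using False \<eta> by simp
    note pk = pick_kernel_cot[OF \<eta>0 \<eta>(2), folded t_def]
    define S where "S = (\<Sum>k. of_real (taylor G k / (real k + 1 + t)) * z ^ k)"
    have "norm (complex_of_real (1 / (real k + 1 + t))) \<le> 1 * (real k + 1)" for k
      unfolding norm_of_real using pk(2) by (simp add: field_simps)
    from LPplus_summable_mult[OF G this, of z]
    have "summable (\<lambda>k. of_real (taylor G k / (real k + 1 + t)) * z ^ k)"
      by (intro summable_norm_cancel[where f = "\<lambda>k. of_real (taylor G k / (real k + 1 + t)) * z ^ k"]) simp
    hence "(\<lambda>k. of_real (taylor G k / (real k + 1 + t)) * z ^ k) sums S" unfolding S_def by (rule summable_sums)
    hence "(\<lambda>k. of_real t * (of_real (taylor G k) * z ^ k) -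
        of_real (t\<^sup>2 + 1) * (of_real (taylor G k / (real k + 1 + t)) * z ^ k)) sums (of_real t * G z - of_real (t\<^sup>2 + 1) * S)"
      by (intro sums_diff sums_mult LPplus_sums G)
    moreover have "of_real t * (of_real (taylor G k) * z ^ k) -
        of_real (t\<^sup>2 + 1) * (of_real (taylor G k / (real k + 1 + t)) * z ^ k) =
        pick_kernel \<eta> (of_nat (k + 1)) * of_real (taylor G k) * z ^ k" for k
      unfolding pk(1) by (simp add: algebra_simps)
    ultimately have "?T = of_real t * G z - of_real (t\<^sup>2 + 1) * S" by (simp add: sums_iff)
    hence "?T / G z = of_real t - of_real (t\<^sup>2 + 1) * (S / G z)"
      using Gz by (simp add: diff_divide_distrib)
    moreover have "Im (of_real t - of_real (t\<^sup>2 + 1) * u) = - (t\<^sup>2 + 1) * Im u" for u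
    proof -
      have "Im (of_real a * u) = a * Im u" for a by simp
      hence "Im (of_real (t\<^sup>2 + 1) * u) = (t\<^sup>2 + 1) * Im u" by blast
      thus ?thesis by (simp only: minus_complex.simps Im_complex_of_real)
    qed
    ultimately have eq: "Im (?T / G z) = - (t\<^sup>2 + 1) * Im (S / G z)" by (simp only:)
    have tp: "t\<^sup>2 + 1 > 0" by (simp add: add_nonneg_pos)
    have "Im (S / G z) \<le> 0" unfolding S_def by (rule kernel_ineq(1)[OF G G1 z pk(2)])
    hence "Im (?T / G z) \<ge> 0" unfolding eq by (intro mult_nonpos_nonpos) (use tp in linarith)
    moreover have "Im (?T / G z) > 0" if "\<eta> < pi / 2"
    proof -
      have "t > 0" unfolding t_def using that \<eta>0 by (intro divide_pos_pos cos_gt_zero sin_gt_zero) auto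
      hence "Im (S / G z) < 0" unfolding S_def by (intro kernel_ineq(2)[OF G G1 z pk(2)])
      thus ?thesis unfolding eq by (intro mult_neg_neg) (use tp in linarith)
    qed
    ultimately show ?thesis by simp
  qed
  thus "Im (?T / G z) \<ge> 0" "\<eta> < pi / 2 \<Longrightarrow> Im (?T / G z) > 0" by auto
qed

text \<open>The kernel at k + 1 is bounded by k + 2 uniformly in the angle, so sum and integral may
  be exchanged. An integral of a non-negative function vanishes only if the function does almost
  everywhere, which by the strict inequality leaves no mass off pi / 2.\<close>

lemma pick_integral_series:
  assumes G: "G \<in> LPplus" and G1: "deriv G 0 \<noteq> 0" and z: "Re z \<ge> 0" "Im z > 0" and M: "pick_measure M"
  defines "I \<equiv> \<lambda>k::nat. integral\<^sup>L M (\<lambda>\<eta>. pick_kernel \<eta> (of_nat (k + 1)))"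
  shows "summable (\<lambda>k. I k * of_real (taylor G k) * z ^ k)"
    and "Im ((\<Sum>k. I k * of_real (taylor G k) * z ^ k) / G z) \<ge> 0"
    and "Im ((\<Sum>k. I k * of_real (taylor G k) * z ^ k) / G z) = 0 \<Longrightarrow> AE \<eta> in M. \<eta> = pi / 2"
proof -
  interpret M: real_distribution M using M by (simp add: pick_measure_def)
  have supp: "AE \<eta> in M. \<eta> \<in> {0..pi/2}" using M by (simp add: pick_measure_def)
  define f where "f k \<eta> = pick_kernel \<eta> (of_nat (k + 1)) * (of_real (taylor G k) * z ^ k)" for k \<eta>
  have int_f: "integrable M (f k)" for k
    unfolding f_def by (intro integrable_mult_left pick_measure_integrable M) (auto simp: complex_nonpos_Reals_iff)
  define b where "b k = norm (of_real (real k + 2) * of_real (taylor G k) * z ^ k)" for k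
  have b: "summable b"
    unfolding b_def by (rule LPplus_summable_mult[OF G, of _ 2]) (simp only: norm_of_real, simp)
  have f_le: "norm (f k \<eta>) \<le> b k" if "\<eta> \<in> {0..pi/2}" for k \<eta>
  proof -
    have "norm (pick_kernel \<eta> (of_nat (k + 1))) \<le> (norm (of_nat (k + 1) :: complex) + 1) / min (Re (of_nat (k + 1))) 1"
      by (rule pick_kernel_bound) (use that in auto)
    also have "\<dots> = real k + 2" by (simp only: norm_of_nat) simp
    finally have "norm (pick_kernel \<eta> (of_nat (k + 1))) * norm (of_real (taylor G k) * z ^ k) \<le>
        (real k + 2) * norm (of_real (taylor G k) * z ^ k)" by (rule mult_right_mono) simp
    moreover have "b k = (real k + 2) * norm (of_real (taylor G k) * z ^ k)"
      unfolding b_def norm_mult norm_of_real by simp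
    ultimately show ?thesis unfolding f_def norm_mult by simp
  qed
  have summ: "AE \<eta> in M. summable (\<lambda>k. norm (f k \<eta>))"
    using supp by eventually_elim (rule summable_comparison_test'[OF b], use f_le in simp)
  have "norm (integral\<^sup>L M (\<lambda>\<eta>. norm (f k \<eta>))) \<le> b k" for k
  proof -
    have "integral\<^sup>L M (\<lambda>\<eta>. norm (f k \<eta>)) \<le> integral\<^sup>L M (\<lambda>_. b k)"
      by (rule integral_mono_AE) (use int_f supp f_le in auto)
    moreover have "integral\<^sup>L M (\<lambda>\<eta>. norm (f k \<eta>)) \<ge> 0" by (rule integral_nonneg_AE) auto
    ultimately show ?thesis using M.prob_space by simp
  qed
  hence summ': "summable (\<lambda>k. integral\<^sup>L M (\<lambda>\<eta>. norm (f k \<eta>)))"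
    by (intro summable_comparison_test'[OF b]) auto
  have If: "integral\<^sup>L M (f k) = I k * of_real (taylor G k) * z ^ k" for k
    unfolding f_def I_def by simp
  have sums: "(\<lambda>k. I k * of_real (taylor G k) * z ^ k) sums integral\<^sup>L M (\<lambda>\<eta>. \<Sum>k. f k \<eta>)"
    using sums_integral[OF int_f summ summ'] by (simp only: If)
  thus "summable (\<lambda>k. I k * of_real (taylor G k) * z ^ k)" by (rule sums_summable)
  define T where "T \<eta> = (\<Sum>k. f k \<eta>) / G z" for \<eta>
  have int_T: "integrable M T"
    unfolding T_def by (intro integrable_divide_zero integrable_suminf int_f summ summ')
  have "(\<Sum>k. I k * of_real (taylor G k) * z ^ k) / G z = integral\<^sup>L M T"
    using sums unfolding T_def by (simp add: sums_iff)
  hence eq: "Im ((\<Sum>k. I k * of_real (taylor G k) * z ^ k) / G z) = integral\<^sup>L M (\<lambda>\<eta>. Im (T \<eta>))"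
    using int_T by simp
  have T_eq: "T \<eta> = (\<Sum>k. pick_kernel \<eta> (of_nat (k + 1)) * of_real (taylor G k) * z ^ k) / G z" for \<eta>
    unfolding T_def f_def by (simp only: mult.assoc)
  have pos: "AE \<eta> in M. Im (T \<eta>) \<ge> 0"
    using supp by eventually_elim (use pick_kernel_series(1)[OF G G1 z] in \<open>simp add: T_eq\<close>)
  show "Im ((\<Sum>k. I k * of_real (taylor G k) * z ^ k) / G z) \<ge> 0"
    unfolding eq by (rule integral_nonneg_AE[OF pos])
  assume "Im ((\<Sum>k. I k * of_real (taylor G k) * z ^ k) / G z) = 0"
  hence "AE \<eta> in M. Im (T \<eta>) = 0"
    unfolding eq using integral_nonneg_eq_0_iff_AE[OF integrable_Im[OF int_T] pos] by simp
  with supp show "AE \<eta> in M. \<eta> = pi / 2"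
  proof eventually_elim
    case (elim \<eta>)
    show ?case
    proof (rule ccontr)
      assume "\<eta> \<noteq> pi / 2"
      hence "\<eta> < pi / 2" using elim by auto
      hence "Im (T \<eta>) > 0" unfolding T_eq using elim by (intro pick_kernel_series(2)[OF G G1 z]) auto
      thus False using elim by simp
    qed
  qed
qed

section \<open>Series with a general Stieltjes multiplier\<close>

lemma slit_domain: "open (- \<real>\<^sub>\<le>\<^sub>0 :: complex set)" "connected (- \<real>\<^sub>\<le>\<^sub>0 :: complex set)"
proof -
  show "open (- \<real>\<^sub>\<le>\<^sub>0 :: complex set)" by (simp add: open_Compl)
  have "complex_of_real ` {..0} = \<real>\<^sub>\<le>\<^sub>0"
    by (auto simp: nonpos_Reals_def)
  thus "connected (- \<real>\<^sub>\<le>\<^sub>0 :: complex set)"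
    using starlike_imp_connected[OF starlike_slotted_complex_plane_left[of 0]] by simp
qed

lemma slit_continuation:
  assumes "f holomorphic_on (- \<real>\<^sub>\<le>\<^sub>0)" "g holomorphic_on (- \<real>\<^sub>\<le>\<^sub>0)"
    and "\<And>z. z \<in> U \<Longrightarrow> f z = g z" "U \<subseteq> - \<real>\<^sub>\<le>\<^sub>0" "\<xi> islimpt U" "\<xi> \<in> - \<real>\<^sub>\<le>\<^sub>0" "z \<in> - \<real>\<^sub>\<le>\<^sub>0"
  shows "f z = g z"
proof -
  have "f z - g z = 0"
    by (rule analytic_continuation[of "\<lambda>z. f z - g z" "- \<real>\<^sub>\<le>\<^sub>0" U \<xi>])
       (use assms slit_domain in \<open>auto intro!: holomorphic_intros\<close>)
  thus ?thesis by simp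
qed

text \<open>The representation is applied to \<open>- \<phi>\<close>. In the strict claim the
  excluded functions may have coefficients of any sign, so constants are excluded as well; this is
  exactly the family for which the measure has no mass off pi / 2.\<close>

lemma stieltjes_series:
  assumes hol: "\<phi> holomorphic_on (- \<real>\<^sub>\<le>\<^sub>0)" and real: "\<And>x. x > 0 \<Longrightarrow> \<phi> (of_real x) \<in> \<real>"
    and Im_chi: "\<And>z. Im z > 0 \<Longrightarrow> Im (\<phi> z) \<le> 0"
    and G: "G \<in> LPplus" and G1: "deriv G 0 \<noteq> 0" and z: "Re z \<ge> 0" "Im z > 0"
  shows "Im ((\<Sum>k. \<phi> (of_nat (k + 1)) * of_real (taylor G k) * z ^ k) / G z) \<le> 0"
    and "\<not> (\<exists>a b :: real. \<forall>z \<in> - \<real>\<^sub>\<le>\<^sub>0. \<phi> z = of_real a + of_real b / z) \<Longrightarrow>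
      Im ((\<Sum>k. \<phi> (of_nat (k + 1)) * of_real (taylor G k) * z ^ k) / G z) < 0"
proof -
  have Gz: "G z \<noteq> 0" using LPplus_nonzero[OF G z(1)] .
  have hol': "(\<lambda>z. - \<phi> z) holomorphic_on (- \<real>\<^sub>\<le>\<^sub>0)" using hol by (intro holomorphic_intros)
  have real': "- \<phi> (of_real x) \<in> \<real>" if "x > 0" for x using real[OF that] by simp
  have Im': "Im (- \<phi> z) \<ge> 0" if "Im z > 0" for z using Im_chi[OF that] by simp
  obtain c m M where m: "m \<ge> 0" and M: "pick_measure M"
    and "\<forall>z. Im z > 0 \<or> Im z = 0 \<and> Re z > 0 \<longrightarrow>
       - \<phi> z = of_real c + of_real m * integral\<^sup>L M (\<lambda>\<eta>. pick_kernel \<eta> z)"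
    by (rule pick_representation[OF hol' real' Im'])
  note rep = this(3)[rule_format]
  define I where "I k = integral\<^sup>L M (\<lambda>\<eta>. pick_kernel \<eta> (of_nat (k + 1)))" for k :: nat
  define T where "T = (\<Sum>k. I k * of_real (taylor G k) * z ^ k)"
  note ser = pick_integral_series[OF G G1 z M, folded I_def]
  have chi: "\<phi> (of_nat (k + 1)) = - (of_real c + of_real m * I k)" for k
  proof -
    have "- \<phi> (of_nat (k + 1)) = of_real c + of_real m * I k"
      unfolding I_def by (rule rep) simp
    thus ?thesis by (metis minus_minus)
  qed
  have "(\<lambda>k. - (of_real c * (of_real (taylor G k) * z ^ k) + of_real m * (I k * of_real (taylor G k) * z ^ k)))
      sums - (of_real c * G z + of_real m * T)"
    unfolding T_def by (intro sums_minus sums_add sums_mult LPplus_sums G summable_sums ser(1))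
  moreover have "- (of_real c * (of_real (taylor G k) * z ^ k) + of_real m * (I k * of_real (taylor G k) * z ^ k))
      = \<phi> (of_nat (k + 1)) * of_real (taylor G k) * z ^ k" for k
    unfolding chi by (simp add: algebra_simps)
  ultimately have "(\<Sum>k. \<phi> (of_nat (k + 1)) * of_real (taylor G k) * z ^ k) = - (of_real c * G z + of_real m * T)"
    by (simp only: sums_iff)
  hence "(\<Sum>k. \<phi> (of_nat (k + 1)) * of_real (taylor G k) * z ^ k) / G z = - (of_real c + of_real m * (T / G z))"
    using Gz by (simp add: field_simps)
  moreover have "Im (of_real m * u) = m * Im u" for u by simp
  ultimately have eq: "Im ((\<Sum>k. \<phi> (of_nat (k + 1)) * of_real (taylor G k) * z ^ k) / G z) = - (m * Im (T / G z))"
    by (simp only: uminus_complex.simps plus_complex.simps Im_complex_of_real add_0_left)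
  have nonneg: "m * Im (T / G z) \<ge> 0" using m ser(2) unfolding T_def by (intro mult_nonneg_nonneg)
  thus "Im ((\<Sum>k. \<phi> (of_nat (k + 1)) * of_real (taylor G k) * z ^ k) / G z) \<le> 0" unfolding eq by simp
  assume nonspecial: "\<not> (\<exists>a b :: real. \<forall>z \<in> - \<real>\<^sub>\<le>\<^sub>0. \<phi> z = of_real a + of_real b / z)"
  show "Im ((\<Sum>k. \<phi> (of_nat (k + 1)) * of_real (taylor G k) * z ^ k) / G z) < 0"
  proof (rule ccontr)
    assume "\<not> ?thesis"
    hence "m * Im (T / G z) = 0" unfolding eq using nonneg by simp
    \<comment> \<open>The first alternative makes \<phi> constant; in the second the kernel is -1 /
      z almost everywhere. One formula a + b / z covers both, first in the upper half-plane and then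
      by the identity theorem.\<close>
    hence disj: "m = 0 \<or> (AE \<eta> in M. \<eta> = pi / 2)" using ser(3) unfolding T_def by auto
    have chi_eq: "\<phi> u = of_real (- c) + of_real m / u" if u: "Im u > 0" for u
    proof -
      have rep_u: "- \<phi> u = of_real c + of_real m * integral\<^sup>L M (\<lambda>\<eta>. pick_kernel \<eta> u)"
        using u by (intro rep) simp
      have "of_real m * integral\<^sup>L M (\<lambda>\<eta>. pick_kernel \<eta> u) = - (of_real m / u)"
        using disj
      proof
        assume AE: "AE \<eta> in M. \<eta> = pi / 2"
        interpret M: real_distribution M using M by (simp add: pick_measure_def)
        have K: "pick_kernel (pi / 2) u = - 1 / u" by (simp add: pick_kernel_def)
        have "AE \<eta> in M. pick_kernel \<eta> u = - 1 / u"
          using AE by eventually_elim (simp only: K)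
        hence "integral\<^sup>L M (\<lambda>\<eta>. pick_kernel \<eta> u) = integral\<^sup>L M (\<lambda>_. - 1 / u)"
          by (intro integral_cong_AE) auto
        thus ?thesis using M.prob_space by simp
      qed simp
      with rep_u have "- \<phi> u = of_real c - of_real m / u" by simp
      thus ?thesis by (simp add: minus_equation_iff[of "\<phi> u"])
    qed
    have lp: "\<i> islimpt {u. Im u > 0}"
      by (rule interior_limit_point) (auto intro!: interiorI[OF open_halfspace_Im_gt[of 0]])
    have sub: "{u. Im u > 0} \<subseteq> - \<real>\<^sub>\<le>\<^sub>0" using Im_pos_slit by auto
    have "\<phi> u = of_real (- c) + of_real m / u" if "u \<in> - \<real>\<^sub>\<le>\<^sub>0" for u
      by (rule slit_continuation[OF hol _ _ sub lp])
         (use that chi_eq in \<open>auto intro!: holomorphic_intros simp: complex_nonpos_Reals_iff\<close>)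
    thus False using nonspecial by blast
  qed
qed

section \<open>Hurwitz stability\<close>

lemma LPplus_taylor_0:
  assumes "G \<in> LPplus"
  shows "taylor G 0 > 0" and "G 0 = of_real (taylor G 0)"
proof -
  obtain c where "c > 0" "G 0 = of_real c" by (rule LPplus_0[OF assms])
  thus "taylor G 0 > 0" "G 0 = of_real (taylor G 0)" by (simp_all add: taylor_def)
qed

text \<open>If \<open>deriv G 0\<close> vanishes, the exponential bound has type \<open>0\<close>
  and gives |G(1)| <= G(0). But G(1) is the sum of the non-negative coefficients and G(0) is the
  first of them.\<close>

lemma LPplus_taylor_const:
  assumes G: "G \<in> LPplus" and "deriv G 0 = 0" "k > 0"
  shows "taylor G k = 0"
proof -
  have "(\<lambda>k. complex_of_real (taylor G k)) sums G 1" using LPplus_sums[OF G, of 1] by simp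
  hence sums: "taylor G sums Re (G 1)" using sums_Re by fastforce
  have "sum (taylor G) {0, k} \<le> suminf (taylor G)"
    by (rule sum_le_suminf) (use sums LPplus_taylor_nonneg[OF G] in \<open>auto simp: sums_iff\<close>)
  hence "taylor G 0 + taylor G k \<le> Re (G 1)" using \<open>k > 0\<close> sums by (simp add: sums_iff)
  also have "\<dots> \<le> norm (G 1)" by (rule complex_Re_le_cmod)
  also have "\<dots> \<le> norm (G 0)" using LPplus_norm_le[OF G, of 1] assms(2) by simp
  also have "\<dots> = taylor G 0" using LPplus_taylor_0[OF G] by simp
  finally show ?thesis using LPplus_taylor_nonneg[OF G, of k] by simp
qed

lemma power_series_coeff_unique:
  fixes a b :: "nat \<Rightarrow> complex"
  assumes "\<And>z. (\<lambda>k. a k * z ^ k) sums F z" "\<And>z. (\<lambda>k. b k * z ^ k) sums F z"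
  shows "a k = b k"
proof (rule ccontr)
  assume ne: "a k \<noteq> b k"
  have sums: "(\<lambda>k. (a k - b k) * z ^ k) sums 0" for z
    using sums_diff[OF assms(1)[of z] assms(2)[of z]] by (simp add: algebra_simps)
  have "a 0 - b 0 = 0"
    by (rule sums_unique2[OF powser_sums_zero[of "\<lambda>k. a k - b k"] sums])
  hence "k > 0" using ne by (cases k) auto
  show False
  proof (rule powser_0_nonzero[of 1 0 "\<lambda>k. a k - b k" "\<lambda>_. 0" k])
    fix s :: real
    assume s: "0 < s" "\<And>z. z \<in> cball 0 s - {0::complex} \<Longrightarrow> (0::complex) \<noteq> 0"
    have "complex_of_real s \<in> cball 0 s - {0}" using s(1) by simp
    thus False using s(2) by blast
  qed (use sums ne \<open>k > 0\<close> in simp_all)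
qed

text \<open>Roots have to be excluded by hypothesis only in the open upper part of the right
  half-plane: real coefficients make the roots symmetric, and non-negative coefficients with a
  positive first one leave none at real z >= 0. Non-negativity also bounds the modulus at z by the
  value at |z|, which compares the two directions of the indicator.\<close>

lemma hurwitz_stable_multiplier:
  fixes C :: real and c :: "nat \<Rightarrow> real"
  assumes G: "G \<in> LPplus" and C: "C \<noteq> 0" and c: "\<And>k. c k \<ge> 0" "c 0 > 0" "\<And>k. c k \<le> K * (real k + 1)"
    and nz: "\<And>z. Re z \<ge> 0 \<Longrightarrow> Im z > 0 \<Longrightarrow> (\<Sum>k. of_real (c k * taylor G k) * z ^ k) \<noteq> 0"
  shows "hurwitz_stable (\<lambda>z. of_real C * (\<Sum>k. of_real (c k * taylor G k) * z ^ k))"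
proof -
  define a where "a k = c k * taylor G k" for k
  define S where "S z = (\<Sum>k. of_real (a k) * z ^ k)" for z :: complex
  define R where "R r = (\<Sum>k. a k * r ^ k)" for r :: real
  have a: "a k \<ge> 0" for k using c(1) LPplus_taylor_nonneg[OF G] by (simp add: a_def)
  have a0: "a 0 > 0" using c(2) LPplus_taylor_0(1)[OF G] by (simp add: a_def)
  have "norm (complex_of_real (c k)) \<le> K * (real k + 1)" for k using c(1,3) by simp
  from LPplus_summable_mult[OF G this]
  have summ: "summable (\<lambda>k. norm (of_real (a k) * z ^ k))" for z :: complex by (simp add: a_def)
  have sumS: "(\<lambda>k. of_real (a k) * z ^ k) sums S z" for z
    unfolding S_def by (rule summable_sums[OF summable_norm_cancel[OF summ]])
  have sumR: "(\<lambda>k. a k * r ^ k) sums R r" if "r \<ge> 0" for r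
    unfolding R_def using summ[of "of_real r"] a that by (intro summable_sums) (simp add: norm_mult norm_power)
  have S_real: "S (of_real r) = of_real (R r)" if "r \<ge> 0" for r
  proof -
    have "(\<lambda>k. complex_of_real (a k * r ^ k)) sums of_real (R r)" by (rule sums_of_real[OF sumR[OF that]])
    thus ?thesis using sumS[of "of_real r"] by (simp add: sums_unique2)
  qed
  have S_norm: "norm (S z) \<le> R (norm z)" for z
  proof -
    have "norm (S z) \<le> (\<Sum>k. norm (of_real (a k) * z ^ k))" unfolding S_def by (rule summable_norm[OF summ])
    also have "\<dots> = R (norm z)" unfolding R_def using a by (simp add: norm_mult norm_power)
    finally show ?thesis .
  qed
  have R_pos: "R r > 0" if "r \<ge> 0" for r
  proof -
    have "sum (\<lambda>k. a k * r ^ k) {0} \<le> R r"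
      unfolding R_def by (rule sum_le_suminf) (use sumR[OF that] a that in \<open>auto simp: sums_iff\<close>)
    thus ?thesis using a0 by simp
  qed
  have K: "K > 0" using c(2) c(3)[of 0] by simp
  define B where "B = Re (deriv G 0 / G 0)"
  \<comment> \<open>The linear factor is again absorbed by doubling the radius. This doubles the
    exponential type, of which only finiteness is required.\<close>
  have R_le: "R r \<le> K * norm (G 0) * exp (2 * B * r)" if r: "r \<ge> 0" for r
  proof -
    have sG: "(\<lambda>k. taylor G k * (2 * r) ^ k) sums Re (G (of_real (2 * r)))"
    proof -
      have "Re (of_real (taylor G k) * of_real (2 * r) ^ k) = taylor G k * (2 * r) ^ k" for k
        by (metis Re_complex_of_real of_real_mult of_real_power)
      thus ?thesis using sums_Re[OF LPplus_sums[OF G, of "of_real (2 * r)"]] by (simp only:)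
    qed
    have "R r \<le> K * Re (G (of_real (2 * r)))"
    proof (rule sums_le[OF _ sumR[OF r] sums_mult[OF sG]])
      fix k :: nat
      have "k + 1 \<le> 2 ^ k" by (induction k) auto
      hence "real (k + 1) \<le> real (2 ^ k)" by (simp only: of_nat_le_iff)
      hence "K * (real k + 1) \<le> K * 2 ^ k" using K by (intro mult_left_mono) auto
      hence "c k \<le> K * 2 ^ k" using c(3)[of k] by simp
      hence "c k * (taylor G k * r ^ k) \<le> K * 2 ^ k * (taylor G k * r ^ k)"
        using LPplus_taylor_nonneg[OF G, of k] r by (intro mult_right_mono) auto
      thus "a k * r ^ k \<le> K * (taylor G k * (2 * r) ^ k)"
        by (simp add: a_def power_mult_distrib mult_ac)
    qed
    also have "\<dots> \<le> K * (norm (G 0) * exp (B * (2 * r)))"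
      using complex_Re_le_cmod[of "G (of_real (2 * r))"] LPplus_norm_le[OF G, of "of_real (2 * r)"] K r
      by (intro mult_left_mono) (auto simp: B_def)
    finally show ?thesis by (simp add: mult_ac)
  qed
  have S_cnj: "S (cnj z) = cnj (S z)" for z
  proof -
    have "(\<lambda>k. cnj (of_real (a k) * z ^ k)) sums cnj (S z)" by (simp only: sums_cnj sumS)
    thus ?thesis using sumS[of "cnj z"] by (simp add: sums_unique2)
  qed
  have S_hol: "S holomorphic_on UNIV"
  proof -
    have "(S has_field_derivative (\<Sum>k. diffs (\<lambda>k. of_real (a k)) k * z ^ k)) (at z)" for z
      unfolding S_def by (rule termdiffs_strong_converges_everywhere) (rule sums_summable[OF sumS])
    thus ?thesis by (auto simp: holomorphic_on_def field_differentiable_def intro: has_field_derivative_at_within)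
  qed
  have S_nz: "Re z < 0" if "S z = 0" for z
  proof (rule ccontr)
    assume "\<not> Re z < 0"
    hence Re: "Re z \<ge> 0" by simp
    consider "Im z > 0" | "Im z < 0" | "Im z = 0" by linarith
    thus False
    proof cases
      case 1
      thus False using nz[OF Re 1] that by (simp add: S_def a_def)
    next
      case 2
      thus False using nz[of "cnj z"] Re S_cnj[of z] that by (simp add: S_def a_def)
    next
      case 3
      hence "z = of_real (Re z)" by (simp add: complex_eq_iff)
      thus False using S_real[OF Re] R_pos[OF Re] that by (metis less_irrefl of_real_eq_0_iff)
    qed
  qed
  define \<Phi> where "\<Phi> z = of_real C * S z" for z
  define P where "P = \<bar>C\<bar> * K * norm (G 0)"
  have "G 0 \<noteq> 0" using G by (auto simp: LPplus_def)
  hence P: "P > 0" using K C by (simp add: P_def)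
  have \<Phi>_norm: "norm (\<Phi> z) \<le> P * exp (2 * B * norm z)" for z
  proof -
    have "norm (\<Phi> z) \<le> \<bar>C\<bar> * (K * norm (G 0) * exp (2 * B * norm z))"
      unfolding \<Phi>_def norm_mult norm_of_real using S_norm[of z] R_le[of "norm z"]
      by (intro mult_left_mono) auto
    thus ?thesis by (simp add: P_def mult_ac)
  qed
  have "at_most_exponential_growth \<Phi>"
  proof -
    have "Limsup at_infinity (\<lambda>z. ln_modulus (\<Phi> z) / ereal (norm z)) \<le> ereal (\<bar>ln P\<bar> + 2 * B)"
    proof (rule Limsup_bounded)
      have "eventually (\<lambda>z::complex. norm z \<ge> 1) at_infinity"
        unfolding eventually_at_infinity by blast
      thus "eventually (\<lambda>z. ln_modulus (\<Phi> z) / ereal (norm z) \<le> ereal (\<bar>ln P\<bar> + 2 * B)) at_infinity"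
      proof eventually_elim
        case (elim z)
        have "z \<noteq> 0" using elim by auto
        show ?case
        proof (cases "\<Phi> z = 0")
          case True
          thus ?thesis using elim by (simp add: ln_modulus_def)
        next
          case False
          have "ln (norm (\<Phi> z)) \<le> ln (P * exp (2 * B * norm z))"
            using False P \<Phi>_norm[of z] by (subst ln_le_cancel_iff) auto
          also have "\<dots> = ln P + 2 * B * norm z" using P by (simp add: ln_mult)
          finally have "ln (norm (\<Phi> z)) / norm z \<le> (ln P + 2 * B * norm z) / norm z"
            by (rule divide_right_mono) simp
          also have "\<dots> = ln P / norm z + 2 * B"
            using \<open>z \<noteq> 0\<close> by (simp add: add_divide_distrib)
          also have "ln P / norm z \<le> \<bar>ln P\<bar> / 1"
            using elim by (intro frac_le) auto
          finally show ?thesis using False \<open>z \<noteq> 0\<close> by (simp add: ln_modulus_def)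
        qed
      qed
    qed
    also have "\<dots> < \<infinity>" by simp
    finally show ?thesis by (simp add: at_most_exponential_growth_def)
  qed
  moreover have "indicator_fn \<Phi> 0 \<ge> indicator_fn \<Phi> pi"
    unfolding indicator_fn_def
  proof (rule Limsup_mono)
    show "eventually (\<lambda>r. ln_modulus (\<Phi> (of_real r * cis pi)) / ereal r \<le> ln_modulus (\<Phi> (of_real r * cis 0)) / ereal r) at_top"
      using eventually_gt_at_top[of 0]
    proof eventually_elim
      case (elim r)
      have 1: "norm (\<Phi> (of_real r)) = \<bar>C\<bar> * R r"
        using elim S_real[of r] R_pos[of r] by (simp add: \<Phi>_def norm_mult)
      have 2: "norm (\<Phi> (- of_real r)) \<le> \<bar>C\<bar> * R r"
        using elim S_norm[of "- of_real r"] by (simp add: \<Phi>_def norm_mult mult_left_mono)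
      have nz: "\<Phi> (of_real r) \<noteq> 0" using 1 C R_pos[of r] elim by auto
      show ?case
      proof (cases "\<Phi> (- of_real r) = 0")
        case True
        thus ?thesis using elim by (simp add: ln_modulus_def)
      next
        case False
        hence "ln (norm (\<Phi> (- of_real r))) \<le> ln (norm (\<Phi> (of_real r)))"
          unfolding 1 using 2 by (intro ln_mono) auto
        hence "ln (norm (\<Phi> (- of_real r))) / r \<le> ln (norm (\<Phi> (of_real r))) / r"
          using elim by (intro divide_right_mono) auto
        thus ?thesis using False nz by (simp add: ln_modulus_def)
      qed
    qed
  qed
  moreover have "\<Phi> holomorphic_on UNIV" unfolding \<Phi>_def[abs_def] using S_hol by (intro holomorphic_intros)
  moreover have "Re z < 0" if "\<Phi> z = 0" for z using that C S_nz by (simp add: \<Phi>_def)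
  ultimately have "hurwitz_stable \<Phi>" by (auto simp: hurwitz_stable_def)
  thus ?thesis by (simp add: \<Phi>_def[abs_def] S_def a_def)
qed

section \<open>Growth and difference quotients of Pick functions\<close>

lemma pick_growth:
  assumes hol: "\<psi> holomorphic_on (- \<real>\<^sub>\<le>\<^sub>0)" and real: "\<And>x. x > 0 \<Longrightarrow> \<psi> (of_real x) \<in> \<real>"
    and Im_psi: "\<And>z. Im z > 0 \<Longrightarrow> Im (\<psi> z) \<ge> 0"
  obtains K where "\<forall>k::nat. norm (\<psi> (of_nat (k + 1))) \<le> K * (real k + 1)"
proof -
  obtain c m M where m: "m \<ge> 0" and M: "pick_measure M"
    and "\<forall>z. Im z > 0 \<or> Im z = 0 \<and> Re z > 0 \<longrightarrow>
       \<psi> z = of_real c + of_real m * integral\<^sup>L M (\<lambda>\<eta>. pick_kernel \<eta> z)"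
    by (rule pick_representation[OF hol real Im_psi])
  note rep = this(3)[rule_format]
  interpret M: real_distribution M using M by (simp add: pick_measure_def)
  have supp: "AE \<eta> in M. \<eta> \<in> {0..pi/2}" using M by (simp add: pick_measure_def)
  have "norm (\<psi> (of_nat (k + 1))) \<le> (\<bar>c\<bar> + 2 * m) * (real k + 1)" for k
  proof -
    have "norm (integral\<^sup>L M (\<lambda>\<eta>. pick_kernel \<eta> (of_nat (k + 1)))) \<le> real k + 2"
    proof -
      have int: "integrable M (\<lambda>\<eta>. pick_kernel \<eta> (of_nat (k + 1)))"
        by (rule pick_measure_integrable[OF M]) (auto simp: complex_nonpos_Reals_iff)
      have "norm (integral\<^sup>L M (\<lambda>\<eta>. pick_kernel \<eta> (of_nat (k + 1)))) \<le>
          integral\<^sup>L M (\<lambda>\<eta>. norm (pick_kernel \<eta> (of_nat (k + 1))))"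
        by (rule integral_norm_bound)
      also have "\<dots> \<le> integral\<^sup>L M (\<lambda>_. real k + 2)"
      proof (rule integral_mono_AE)
        show "AE \<eta> in M. norm (pick_kernel \<eta> (of_nat (k + 1))) \<le> real k + 2"
          using supp
        proof eventually_elim
          case (elim \<eta>)
          have "norm (pick_kernel \<eta> (of_nat (k + 1))) \<le> (norm (of_nat (k + 1) :: complex) + 1) / min (Re (of_nat (k + 1))) 1"
            by (rule pick_kernel_bound) (use elim in auto)
          also have "\<dots> = real k + 2" by (simp only: norm_of_nat) simp
          finally show ?case .
        qed
      qed (use int in auto)
      also have "\<dots> = real k + 2" using M.prob_space by simp
      finally show ?thesis .
    qed
    hence 1: "norm (of_real m * integral\<^sup>L M (\<lambda>\<eta>. pick_kernel \<eta> (of_nat (k + 1)))) \<le> m * (real k + 2)"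
      using m unfolding norm_mult norm_of_real by (simp add: mult_left_mono)
    have "\<psi> (of_nat (k + 1)) = of_real c + of_real m * integral\<^sup>L M (\<lambda>\<eta>. pick_kernel \<eta> (of_nat (k + 1)))"
      by (rule rep) simp
    hence "norm (\<psi> (of_nat (k + 1))) \<le> \<bar>c\<bar> + m * (real k + 2)"
      using norm_triangle_ineq[of "of_real c :: complex"] 1 by (metis add_left_mono norm_of_real order_trans)
    also have "\<dots> \<le> (\<bar>c\<bar> + 2 * m) * (real k + 1)"
    proof -
      have "0 \<le> \<bar>c\<bar> * real k" "0 \<le> m * real k" using m by simp_all
      thus ?thesis by (simp add: algebra_simps)
    qed
    finally show ?thesis .
  qed
  thus ?thesis by (intro that) blast
qed

text \<open>As a function of z the kernel is a Moebius map of determinant cos^2 + sin^2 = 1. Its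
  difference quotient is therefore 1 / (w v), where w and v > 0 are the denominators at
  \<open>z\<close> and \<open>s\<close>, and the conjugate of w shows both signs. Real z give
  monotonicity; \<open>s\<close> tending to \<open>0\<close> gives the quotient by z.\<close>

lemma pick_difference_quotient:
  assumes hol: "\<psi> holomorphic_on (- \<real>\<^sub>\<le>\<^sub>0)" and real: "\<And>x. x > 0 \<Longrightarrow> \<psi> (of_real x) \<in> \<real>"
    and Im_psi: "\<And>z. Im z > 0 \<Longrightarrow> Im (\<psi> z) \<ge> 0"
    and s: "s > 0" and z: "Im z > 0 \<or> Im z = 0 \<and> Re z > 0" "z \<noteq> of_real s"
  shows "Im ((\<psi> z - \<psi> (of_real s)) / (z - of_real s)) \<le> 0"
    and "Im z = 0 \<Longrightarrow> Re ((\<psi> z - \<psi> (of_real s)) / (z - of_real s)) \<ge> 0"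
proof -
  obtain c m M where m: "m \<ge> 0" and M: "pick_measure M"
    and "\<forall>z. Im z > 0 \<or> Im z = 0 \<and> Re z > 0 \<longrightarrow>
       \<psi> z = of_real c + of_real m * integral\<^sup>L M (\<lambda>\<eta>. pick_kernel \<eta> z)"
    by (rule pick_representation[OF hol real Im_psi])
  note rep = this(3)[rule_format]
  interpret M: real_distribution M using M by (simp add: pick_measure_def)
  have supp: "AE \<eta> in M. \<eta> \<in> {0..pi/2}" using M by (simp add: pick_measure_def)
  have zs: "z \<in> - \<real>\<^sub>\<le>\<^sub>0" "of_real s \<in> - (\<real>\<^sub>\<le>\<^sub>0 :: complex set)"
    using z s by (auto simp: complex_nonpos_Reals_iff)
  note int = pick_measure_integrable[OF M zs(1)] pick_measure_integrable[OF M zs(2)]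
  define D where "D \<eta> = (pick_kernel \<eta> z - pick_kernel \<eta> (of_real s)) / (z - of_real s)" for \<eta>
  have int_D: "integrable M D" unfolding D_def using int by (intro integrable_divide_zero integrable_diff) auto
  have "\<psi> z - \<psi> (of_real s) = of_real m * (integral\<^sup>L M (\<lambda>\<eta>. pick_kernel \<eta> z) - integral\<^sup>L M (\<lambda>\<eta>. pick_kernel \<eta> (of_real s)))"
    using rep[OF z(1)] rep[of "of_real s"] s by (simp add: right_diff_distrib)
  also have "integral\<^sup>L M (\<lambda>\<eta>. pick_kernel \<eta> z) - integral\<^sup>L M (\<lambda>\<eta>. pick_kernel \<eta> (of_real s)) =
      integral\<^sup>L M (\<lambda>\<eta>. pick_kernel \<eta> z - pick_kernel \<eta> (of_real s))"
    using int by (rule Bochner_Integration.integral_diff[symmetric])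
  finally have "(\<psi> z - \<psi> (of_real s)) / (z - of_real s) = of_real m * integral\<^sup>L M D"
    unfolding D_def by simp
  moreover have "Im (of_real m * u) = m * Im u" "Re (of_real m * u) = m * Re u" for u by simp_all
  ultimately have eq: "Im ((\<psi> z - \<psi> (of_real s)) / (z - of_real s)) = m * integral\<^sup>L M (\<lambda>\<eta>. Im (D \<eta>))"
    "Re ((\<psi> z - \<psi> (of_real s)) / (z - of_real s)) = m * integral\<^sup>L M (\<lambda>\<eta>. Re (D \<eta>))"
    using int_D by simp_all
  define w v where "w \<eta> = z * of_real (sin \<eta>) + of_real (cos \<eta>)" and "v \<eta> = s * sin \<eta> + cos \<eta>" for \<eta>
  have D_eq: "D \<eta> = cnj (w \<eta>) * of_real (1 / (v \<eta> * (norm (w \<eta>))\<^sup>2))" and v_pos: "v \<eta> > 0"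
    if \<eta>: "\<eta> \<in> {0..pi/2}" for \<eta>
  proof -
    have nz: "w \<eta> \<noteq> 0" unfolding w_def using \<eta> zs by (intro pick_kernel_denom_nonzero) auto
    have sc: "sin \<eta> \<ge> 0" "cos \<eta> \<ge> 0" using \<eta> by (auto intro: sin_ge_zero cos_ge_zero)
    have v0: "complex_of_real (v \<eta>) \<noteq> 0"
      using pick_kernel_denom_nonzero[of \<eta> "of_real s"] \<eta> zs by (simp add: v_def)
    hence "v \<eta> \<noteq> 0" by simp
    moreover have "v \<eta> \<ge> 0" unfolding v_def using s sc by simp
    ultimately show "v \<eta> > 0" by simp
    have cs: "complex_of_real (cos \<eta>) * of_real (cos \<eta>) + of_real (sin \<eta>) * of_real (sin \<eta>) = 1"
      unfolding of_real_mult[symmetric] of_real_add[symmetric] by (simp add: power2_eq_square[symmetric])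
    have "pick_kernel \<eta> z - pick_kernel \<eta> (of_real s) =
        (z * of_real (cos \<eta>) - of_real (sin \<eta>)) / w \<eta> - (of_real s * of_real (cos \<eta>) - of_real (sin \<eta>)) / of_real (v \<eta>)"
      by (simp add: pick_kernel_def w_def v_def)
    also have "\<dots> = ((z * of_real (cos \<eta>) - of_real (sin \<eta>)) * of_real (v \<eta>) -
        (of_real s * of_real (cos \<eta>) - of_real (sin \<eta>)) * w \<eta>) / (w \<eta> * of_real (v \<eta>))"
      using nz v0 by (simp add: diff_frac_eq)
    also have "(z * of_real (cos \<eta>) - of_real (sin \<eta>)) * of_real (v \<eta>) -
        (of_real s * of_real (cos \<eta>) - of_real (sin \<eta>)) * w \<eta> =
        (z - of_real s) * (complex_of_real (cos \<eta>) * of_real (cos \<eta>) + of_real (sin \<eta>) * of_real (sin \<eta>))"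
      by (simp add: w_def v_def algebra_simps)
    finally have "D \<eta> = 1 / (w \<eta> * of_real (v \<eta>))"
      unfolding D_def cs using z(2) by simp
    also have "1 / w \<eta> = cnj (w \<eta>) / of_real ((norm (w \<eta>))\<^sup>2)"
      unfolding complex_norm_square using nz by simp
    hence "1 / (w \<eta> * of_real (v \<eta>)) = cnj (w \<eta>) / of_real ((norm (w \<eta>))\<^sup>2) / of_real (v \<eta>)"
      by (metis divide_divide_eq_left)
    finally show "D \<eta> = cnj (w \<eta>) * of_real (1 / (v \<eta> * (norm (w \<eta>))\<^sup>2))" by simp
  qed
  have "AE \<eta> in M. Im (D \<eta>) \<le> 0"
    using supp
  proof eventually_elim
    case (elim \<eta>)
    have "sin \<eta> \<ge> 0" using elim by (auto intro: sin_ge_zero)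
    moreover have "1 / (v \<eta> * (norm (w \<eta>))\<^sup>2) \<ge> 0" using v_pos[OF elim] by simp
    moreover have "Im (D \<eta>) = - (Im z * sin \<eta>) * (1 / (v \<eta> * (norm (w \<eta>))\<^sup>2))"
      unfolding D_eq[OF elim] by (simp add: w_def)
    ultimately show ?case using z by (auto intro!: mult_nonpos_nonneg)
  qed
  hence "integral\<^sup>L M (\<lambda>\<eta>. - Im (D \<eta>)) \<ge> 0" by (intro integral_nonneg_AE) auto
  thus "Im ((\<psi> z - \<psi> (of_real s)) / (z - of_real s)) \<le> 0"
    unfolding eq using m by (simp add: mult_nonneg_nonpos)
  assume Im0: "Im z = 0"
  have "AE \<eta> in M. Re (D \<eta>) \<ge> 0"
    using supp
  proof eventually_elim
    case (elim \<eta>)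
    have "sin \<eta> \<ge> 0" "cos \<eta> \<ge> 0" using elim by (auto intro: sin_ge_zero cos_ge_zero)
    moreover have "1 / (v \<eta> * (norm (w \<eta>))\<^sup>2) \<ge> 0" using v_pos[OF elim] by simp
    moreover have "Re (D \<eta>) = (Re z * sin \<eta> + cos \<eta>) * (1 / (v \<eta> * (norm (w \<eta>))\<^sup>2))"
      unfolding D_eq[OF elim] by (simp add: w_def)
    ultimately show ?case using z Im0 by (auto intro!: mult_nonneg_nonneg)
  qed
  hence "integral\<^sup>L M (\<lambda>\<eta>. Re (D \<eta>)) \<ge> 0" by (rule integral_nonneg_AE)
  thus "Re ((\<psi> z - \<psi> (of_real s)) / (z - of_real s)) \<ge> 0"
    unfolding eq using m by simp
qed

section \<open>Stability for the class S\<close>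

lemma LPplus_const_series:
  fixes c :: "nat \<Rightarrow> complex"
  assumes G: "G \<in> LPplus" "deriv G 0 = 0"
  shows "(\<Sum>k. c k * of_real (taylor G k) * z ^ k) = c 0 * of_real (taylor G 0)"
proof -
  have "(\<Sum>k. c k * of_real (taylor G k) * z ^ k) = (\<Sum>k\<in>{0}. c k * of_real (taylor G k) * z ^ k)"
    by (rule suminf_finite) (use LPplus_taylor_const[OF G] in auto)
  thus ?thesis by simp
qed

lemma stieltjes_series_le:
  assumes hol: "\<phi> holomorphic_on (- \<real>\<^sub>\<le>\<^sub>0)" and real: "\<And>x. x > 0 \<Longrightarrow> \<phi> (of_real x) \<in> \<real>"
    and Im_phi: "\<And>z. Im z > 0 \<Longrightarrow> Im (\<phi> z) \<le> 0"
    and G: "G \<in> LPplus" and z: "Re z \<ge> 0" "Im z > 0"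
  shows "Im ((\<Sum>k. \<phi> (of_nat (k + 1)) * of_real (taylor G k) * z ^ k) / G z) \<le> 0"
proof (cases "deriv G 0 = 0")
  case True
  have "G z = of_real (taylor G 0)"
    using sums_unique[OF LPplus_sums[OF G, of z]] LPplus_const_series[OF G True, of "\<lambda>_. 1" z] by simp
  hence "(\<Sum>k. \<phi> (of_nat (k + 1)) * of_real (taylor G k) * z ^ k) / G z = \<phi> 1"
    using LPplus_const_series[OF G True, of "\<lambda>k. \<phi> (of_nat (k + 1))" z] LPplus_taylor_0(1)[OF G] by simp
  thus ?thesis using real[of 1] by (simp add: complex_is_Real_iff)
qed (use stieltjes_series(1)[OF hol real Im_phi G _ z] in blast)

lemma stieltjes_series_nonzero:
  assumes hol: "\<phi> holomorphic_on (- \<real>\<^sub>\<le>\<^sub>0)" and real: "\<And>x. x > 0 \<Longrightarrow> \<phi> (of_real x) \<in> \<real>"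
    and Im_phi: "\<And>z. Im z > 0 \<Longrightarrow> Im (\<phi> z) \<le> 0" and "\<phi> 1 \<noteq> 0"
    and nonspecial: "\<not> (\<exists>a b :: real. \<forall>z \<in> - \<real>\<^sub>\<le>\<^sub>0. \<phi> z = of_real a + of_real b / z)"
    and G: "G \<in> LPplus" and z: "Re z \<ge> 0" "Im z > 0"
  shows "(\<Sum>k. \<phi> (of_nat (k + 1)) * of_real (taylor G k) * z ^ k) \<noteq> 0"
proof (cases "deriv G 0 = 0")
  case True
  thus ?thesis
    using LPplus_const_series[OF G True, of "\<lambda>k. \<phi> (of_nat (k + 1))" z] LPplus_taylor_0(1)[OF G] \<open>\<phi> 1 \<noteq> 0\<close> by simp
next
  case False
  thus ?thesis using stieltjes_series(2)[OF hol real Im_phi G False z nonspecial] by auto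
qed

lemma multiplier_series_factor:
  fixes c :: "nat \<Rightarrow> real"
  assumes G: "G \<in> LPplus" and f: "\<And>k. f k = of_real C * of_real (taylor G k)"
    and b: "\<And>k. b k = complex_of_real (c k)" "\<And>k. \<bar>c k\<bar> \<le> K * (real k + 1)"
  shows "(\<Sum>k. b k * f k * z ^ k) = of_real C * (\<Sum>k. of_real (c k * taylor G k) * z ^ k)"
proof -
  have "norm (complex_of_real (c k)) \<le> K * (real k + 1)" for k using b(2) by simp
  from summable_norm_cancel[OF LPplus_summable_mult[OF G this, of z]]
  have "summable (\<lambda>k. of_real (c k * taylor G k) * z ^ k)" by simp
  from suminf_mult[OF this, of "of_real C"] show ?thesis by (simp add: f b(1) mult_ac)
qed

lemma of_nat_pos_Reals:
  assumes "\<And>x. x > 0 \<Longrightarrow> \<phi> (complex_of_real x) \<in> \<real>"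
  shows "\<phi> (of_nat (k + 1)) = of_real (Re (\<phi> (of_nat (k + 1))))"
proof -
  have "\<phi> (complex_of_real (real (k + 1))) \<in> \<real>" by (rule assms) simp
  hence "\<phi> (of_nat (k + 1)) \<in> \<real>" by (simp only: of_real_of_nat_eq)
  thus ?thesis by (simp only: of_real_Re)
qed

text \<open>Positivity is asked only at \<open>1\<close>, where the constant coefficient is formed,
  and non-negativity elsewhere. In this form the lemma applies directly to the quotient built from a
  function of the inverse class.\<close>

lemma hurwitz_stable_multiplier_stieltjes:
  assumes G: "G \<in> LPplus" and C: "C \<noteq> 0" and f: "\<And>k. f k = of_real C * of_real (taylor G k)"
    and hol: "\<phi> holomorphic_on (- \<real>\<^sub>\<le>\<^sub>0)" and real: "\<And>x. x > 0 \<Longrightarrow> \<phi> (of_real x) \<in> \<real>"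
    and nonneg: "\<And>x. x > 0 \<Longrightarrow> Re (\<phi> (of_real x)) \<ge> 0" and pos: "Re (\<phi> 1) > 0"
    and Im_phi: "\<And>z. Im z > 0 \<Longrightarrow> Im (\<phi> z) \<le> 0"
    and nonspecial: "\<not> (\<exists>a b :: real. \<forall>z \<in> - \<real>\<^sub>\<le>\<^sub>0. \<phi> z = of_real a + of_real b / z)"
  shows "hurwitz_stable (multiplier \<phi> f)"
proof -
  define c where "c k = Re (\<phi> (of_nat (k + 1)))" for k :: nat
  have c: "\<phi> (of_nat (k + 1)) = of_real (c k)" for k unfolding c_def by (rule of_nat_pos_Reals[of \<phi>, OF real])
  have hol': "(\<lambda>z. - \<phi> z) holomorphic_on (- \<real>\<^sub>\<le>\<^sub>0)" using hol by (intro holomorphic_intros)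
  have real': "- \<phi> (of_real x) \<in> \<real>" if "x > 0" for x using real[OF that] by simp
  have Im': "Im (- \<phi> z) \<ge> 0" if "Im z > 0" for z using Im_phi[OF that] by simp
  obtain K where K: "\<forall>k::nat. norm (- \<phi> (of_nat (k + 1))) \<le> K * (real k + 1)"
    by (rule pick_growth[OF hol' real' Im'])
  have c_le: "\<bar>c k\<bar> \<le> K * (real k + 1)" for k
    using K[rule_format, of k] unfolding c norm_minus_cancel norm_of_real .
  have c_nonneg: "c k \<ge> 0" for k
    using nonneg[of "real (k + 1)"] unfolding c_def by (simp only: of_real_of_nat_eq)
  have eq: "multiplier \<phi> f = (\<lambda>z. of_real C * (\<Sum>k. of_real (c k * taylor G k) * z ^ k))"
    unfolding multiplier_def by (rule ext, rule multiplier_series_factor[OF G f c c_le])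
  show ?thesis
    unfolding eq
  proof (rule hurwitz_stable_multiplier[OF G C c_nonneg])
    show "c 0 > 0" using pos by (simp add: c_def)
    show "c k \<le> K * (real k + 1)" for k using c_le[of k] by simp
    fix z assume z: "Re z \<ge> 0" "Im z > 0"
    have "\<phi> 1 \<noteq> 0" using pos by auto
    from stieltjes_series_nonzero[OF hol real Im_phi this nonspecial G z]
    show "(\<Sum>k. of_real (c k * taylor G k) * z ^ k) \<noteq> 0" unfolding c by simp
  qed
qed

text \<open>Excluding special functions also excludes a + b / z with arbitrary real coefficients:
  positivity on the positive axis forces a >= 0 at infinity and b >= 0 at the origin, and b = 0
  would be a constant.\<close>

lemma stieltjes_nonspecial:
  assumes "\<psi> \<in> stieltjes" "\<not> special_stieltjes \<psi>"
  shows "\<not> (\<exists>a b :: real. \<forall>z \<in> - \<real>\<^sub>\<le>\<^sub>0. \<psi> z = of_real a + of_real b / z)"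
proof
  assume "\<exists>a b :: real. \<forall>z \<in> - \<real>\<^sub>\<le>\<^sub>0. \<psi> z = of_real a + of_real b / z"
  then obtain a b :: real where ab: "\<And>z. z \<in> - \<real>\<^sub>\<le>\<^sub>0 \<Longrightarrow> \<psi> z = of_real a + of_real b / z" by blast
  have pos: "a + b / x > 0" if "x > 0" for x
  proof -
    have "\<psi> (of_real x) = of_real (a + b / x)" using ab[of "of_real x"] that by (simp add: complex_nonpos_Reals_iff)
    moreover have "Re (\<psi> (of_real x)) > 0" using assms(1) that unfolding stieltjes_def by blast
    ultimately show ?thesis by (simp only: Re_complex_of_real)
  qed
  have "a \<ge> 0"
  proof (rule tendsto_lowerbound[of "\<lambda>x::real. a + b / x" a at_top])
    show "((\<lambda>x. a + b / x) \<longlongrightarrow> a) at_top" by real_asymp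
    show "eventually (\<lambda>x. 0 \<le> a + b / x) at_top"
      using eventually_gt_at_top[of 0] by eventually_elim (use pos in \<open>force intro: less_imp_le\<close>)
  qed simp
  have "b \<ge> 0"
  proof (rule tendsto_lowerbound[of "\<lambda>x::real. a * x + b" b "at_right 0"])
    have "((\<lambda>x. a * x + b) \<longlongrightarrow> a * 0 + b) (at_right 0)" by (intro tendsto_intros)
    thus "((\<lambda>x. a * x + b) \<longlongrightarrow> b) (at_right 0)" by simp
    show "eventually (\<lambda>x. 0 \<le> a * x + b) (at_right 0)"
      using eventually_at_right_less[of 0]
    proof eventually_elim
      case (elim x)
      have "0 < (a + b / x) * x" using pos[OF elim] elim by simp
      also have "\<dots> = a * x + b" using elim by (simp add: field_simps)
      finally show ?case by simp
    qed
  qed simp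
  show False
  proof (cases "b = 0")
    case True
    hence "\<psi> constant_on (- \<real>\<^sub>\<le>\<^sub>0)" unfolding constant_on_def using ab by (intro exI[of _ "of_real a"]) simp
    thus False using assms(1) by (simp add: stieltjes_def)
  next
    case False
    hence "special_stieltjes \<psi>"
      unfolding special_stieltjes_def using ab \<open>a \<ge> 0\<close> \<open>b \<ge> 0\<close>
      by (intro exI[of _ a] exI[of _ b]) simp
    thus False using assms(2) by blast
  qed
qed

section \<open>Stability for the inverse class\<close>

lemma islimpt_unit_interval: "complex_of_real (1 / 2) islimpt of_real ` {0<..<1}"
  unfolding islimpt_sequential
proof (intro exI conjI allI)
  fix n :: nat
  have "1 / 2 + 1 / (real n + 3) \<in> {0<..<1}" by (simp add: field_simps)
  moreover have "1 / 2 + 1 / (real n + 3) \<noteq> 1 / 2" by simp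
  ultimately show "complex_of_real (1 / 2 + 1 / (real n + 3)) \<in> of_real ` {0<..<1} - {of_real (1 / 2)}"
    by (auto simp del: of_real_add of_real_divide)
next
  show "(\<lambda>n. complex_of_real (1 / 2 + 1 / (real n + 3))) \<longlonglongrightarrow> of_real (1 / 2)"
    by (intro tendsto_of_real) real_asymp
qed

lemma pick_mono:
  assumes hol: "\<psi> holomorphic_on (- \<real>\<^sub>\<le>\<^sub>0)" and real: "\<And>x. x > 0 \<Longrightarrow> \<psi> (of_real x) \<in> \<real>"
    and Im_psi: "\<And>z. Im z > 0 \<Longrightarrow> Im (\<psi> z) \<ge> 0" and xy: "0 < x" "x \<le> y"
  shows "Re (\<psi> (of_real x)) \<le> Re (\<psi> (of_real y))"
proof (cases "x = y")
  case False
  hence "y - x > 0" using xy by simp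
  have "Re ((\<psi> (of_real y) - \<psi> (of_real x)) / (of_real y - of_real x)) \<ge> 0"
    by (rule pick_difference_quotient(2)[OF hol real Im_psi]) (use xy False in auto)
  also have "(\<psi> (of_real y) - \<psi> (of_real x)) / (of_real y - of_real x) =
      (\<psi> (of_real y) - \<psi> (of_real x)) / of_real (y - x)" by simp
  also have "Re \<dots> = (Re (\<psi> (of_real y)) - Re (\<psi> (of_real x))) / (y - x)"
    by (simp only: Re_divide_of_real minus_complex.simps)
  finally show ?thesis using \<open>y - x > 0\<close> by (simp add: zero_le_divide_iff)
qed simp

text \<open>The origin is not in the domain of \<psi>, so difference quotients are formed at points
  s > 0, and their sign in the upper half-plane is kept as \<open>s\<close> tends to
  \<open>0\<close>.\<close>

lemma stieltjes_inv_quotient: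
  assumes psi: "\<psi> \<in> stieltjes_inv"
  obtains L where "L \<ge> 0" "value_at_0 \<psi> = of_real L"
    "((\<lambda>t. \<psi> (of_real t)) \<longlongrightarrow> of_real L) (at_right 0)"
    "(\<lambda>z. (\<psi> z - of_real L) / z) holomorphic_on (- \<real>\<^sub>\<le>\<^sub>0)"
    "\<forall>x>0. (\<psi> (of_real x) - of_real L) / of_real x \<in> \<real>"
    "\<forall>x>0. Re ((\<psi> (of_real x) - of_real L) / of_real x) \<ge> 0"
    "Re (\<psi> 1 - of_real L) > 0"
    "\<forall>z. Im z > 0 \<longrightarrow> Im ((\<psi> z - of_real L) / z) \<le> 0"
proof -
  have hol: "\<psi> holomorphic_on (- \<real>\<^sub>\<le>\<^sub>0)" and nonconst: "\<not> \<psi> constant_on (- \<real>\<^sub>\<le>\<^sub>0)"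
    and real: "\<And>x. x > 0 \<Longrightarrow> \<psi> (of_real x) \<in> \<real>"
    and pos: "\<And>x. x > 0 \<Longrightarrow> Re (\<psi> (of_real x)) > 0"
    using psi by (auto simp: stieltjes_inv_def)
  have Im_psi: "Im (\<psi> z) \<ge> 0" if "Im z > 0" for z
    using psi that by (auto simp: stieltjes_inv_def complex_nonpos_Reals_iff)
  define f where "f t = Re (\<psi> (of_real t))" for t
  have psi_f: "\<psi> (of_real t) = of_real (f t)" if "t > 0" for t
    using real[OF that] by (simp add: f_def)
  have f_mono: "f x \<le> f y" if "0 < x" "x \<le> y" for x y
    unfolding f_def by (rule pick_mono[OF hol real Im_psi that])
  \<comment> \<open>Monotonicity on the positive axis makes the infimum the limit at the
    origin.\<close>
  define L where "L = Inf (f ` {0<..})"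
  have bdd: "bdd_below (f ` {0<..})"
    by (rule bdd_belowI[of _ 0]) (use pos in \<open>force simp: f_def intro: less_imp_le\<close>)
  have L_le: "L \<le> f t" if "t > 0" for t
    unfolding L_def by (rule cInf_lower[OF _ bdd]) (use that in auto)
  have L: "L \<ge> 0"
    unfolding L_def by (rule cInf_greatest) (use pos in \<open>force simp: f_def intro: less_imp_le\<close>)+
  have f_lim: "(f \<longlongrightarrow> L) (at_right 0)"
  proof (rule order_tendstoI)
    fix a assume "a < L"
    show "eventually (\<lambda>t. a < f t) (at_right 0)"
      using eventually_at_right_less[of 0]
      by eventually_elim (use L_le \<open>a < L\<close> in force)
  next
    fix a assume "L < a"
    then obtain t where t: "t > 0" "f t < a"
      unfolding L_def using cInf_lessD[of "f ` {0<..}" a] by auto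
    have "eventually (\<lambda>s. s \<in> {0<..<t}) (at_right 0)" using t by (intro eventually_at_right_real)
    thus "eventually (\<lambda>s. f s < a) (at_right 0)"
      by eventually_elim (use f_mono[of _ t] t in force)
  qed
  have lim: "((\<lambda>t. \<psi> (of_real t)) \<longlongrightarrow> of_real L) (at_right 0)"
  proof (rule Lim_transform_eventually)
    show "((\<lambda>t. complex_of_real (f t)) \<longlongrightarrow> of_real L) (at_right 0)"
      by (intro tendsto_of_real f_lim)
    show "eventually (\<lambda>t. of_real (f t) = \<psi> (of_real t)) (at_right 0)"
      using eventually_at_right_less[of 0] by eventually_elim (simp add: psi_f)
  qed
  have chi_f: "(\<psi> (of_real x) - of_real L) / of_real x = of_real ((f x - L) / x)" if "x > 0" for x
    using psi_f[OF that] by simp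
  show ?thesis
  proof (rule that[OF L _ lim])
    show "value_at_0 \<psi> = of_real L"
      unfolding value_at_0_def by (rule tendsto_Lim[OF _ lim]) simp
    show "(\<lambda>z. (\<psi> z - of_real L) / z) holomorphic_on (- \<real>\<^sub>\<le>\<^sub>0)"
      by (intro holomorphic_intros hol) auto
    show "\<forall>x>0. (\<psi> (of_real x) - of_real L) / of_real x \<in> \<real>"
      using chi_f by (metis Reals_of_real)
    show "\<forall>x>0. Re ((\<psi> (of_real x) - of_real L) / of_real x) \<ge> 0"
    proof (intro allI impI)
      fix x :: real assume "x > 0"
      thus "Re ((\<psi> (of_real x) - of_real L) / of_real x) \<ge> 0"
        unfolding chi_f[OF \<open>x > 0\<close>] Re_complex_of_real using L_le[of x] by simp
    qed
    \<comment> \<open>A monotone function that has reached its infimum at \<open>1\<close> is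
      constant to the left of \<open>1\<close>, and the identity theorem spreads this over the slit
      plane.\<close>
    show "Re (\<psi> 1 - of_real L) > 0"
    proof (rule ccontr)
      assume "\<not> Re (\<psi> 1 - of_real L) > 0"
      hence "f 1 \<le> L" by (simp add: f_def)
      hence const: "\<psi> z = of_real L" if "z \<in> complex_of_real ` {0<..<1}" for z
        using that f_mono[of _ 1] L_le psi_f by force
      have "\<psi> z = of_real L" if "z \<in> - \<real>\<^sub>\<le>\<^sub>0" for z
        by (rule slit_continuation[OF hol _ const _ islimpt_unit_interval])
           (use that in \<open>auto simp: complex_nonpos_Reals_iff\<close>)
      thus False using nonconst by (auto simp: constant_on_def)
    qed
    show "\<forall>z. Im z > 0 \<longrightarrow> Im ((\<psi> z - of_real L) / z) \<le> 0"
    proof (intro allI impI)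
      fix z assume z: "Im z > 0"
      show "Im ((\<psi> z - of_real L) / z) \<le> 0"
      proof (rule tendsto_upperbound)
        have "((\<lambda>s. (\<psi> z - \<psi> (of_real s)) / (z - of_real s)) \<longlongrightarrow> (\<psi> z - of_real L) / (z - of_real 0)) (at_right 0)"
          using z by (intro tendsto_intros lim) auto
        from tendsto_Im[OF this]
        show "((\<lambda>s. Im ((\<psi> z - \<psi> (of_real s)) / (z - of_real s))) \<longlongrightarrow> Im ((\<psi> z - of_real L) / z)) (at_right 0)"
          by simp
        show "eventually (\<lambda>s. Im ((\<psi> z - \<psi> (of_real s)) / (z - of_real s)) \<le> 0) (at_right 0)"
          using eventually_at_right_less[of 0]
        proof eventually_elim
          case (elim s)
          show ?case
            by (rule pick_difference_quotient(1)[OF hol real Im_psi elim]) (use z in auto)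
        qed
      qed simp
    qed
  qed
qed

text \<open>An equation \<psi>(z) / z = a + b / z means \<psi>(z) = a z + b. The limit at the origin
  gives b = 0, so \<psi> would be special.\<close>

lemma stieltjes_inv_nonspecial:
  assumes psi: "\<psi> \<in> stieltjes_inv" "\<not> special_stieltjes_inv \<psi>"
    and lim: "((\<lambda>t. \<psi> (of_real t)) \<longlongrightarrow> 0) (at_right 0)"
  shows "\<not> (\<exists>a b :: real. \<forall>z \<in> - \<real>\<^sub>\<le>\<^sub>0. \<psi> z / z = of_real a + of_real b / z)"
proof
  assume "\<exists>a b :: real. \<forall>z \<in> - \<real>\<^sub>\<le>\<^sub>0. \<psi> z / z = of_real a + of_real b / z"
  then obtain a b :: real where ab: "\<And>z. z \<in> - \<real>\<^sub>\<le>\<^sub>0 \<Longrightarrow> \<psi> z / z = of_real a + of_real b / z" by blast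
  have psi_eq: "\<psi> z = of_real a * z + of_real b" if "z \<in> - \<real>\<^sub>\<le>\<^sub>0" for z
  proof -
    have "z \<noteq> 0" using that by auto
    have "\<psi> z = \<psi> z / z * z" using \<open>z \<noteq> 0\<close> by simp
    also have "\<dots> = of_real a * z + of_real b" unfolding ab[OF that] using \<open>z \<noteq> 0\<close> by (simp add: field_simps)
    finally show ?thesis .
  qed
  have "((\<lambda>t. \<psi> (of_real t)) \<longlongrightarrow> of_real b) (at_right 0)"
  proof (rule Lim_transform_eventually)
    have "((\<lambda>t. of_real a * of_real t + of_real b) \<longlongrightarrow> of_real a * of_real 0 + complex_of_real b) (at_right 0)"
      by (intro tendsto_intros)
    thus "((\<lambda>t. of_real a * of_real t + of_real b) \<longlongrightarrow> complex_of_real b) (at_right 0)" by simp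
    show "eventually (\<lambda>t. of_real a * of_real t + of_real b = \<psi> (of_real t)) (at_right 0)"
      using eventually_at_right_less[of 0]
      by eventually_elim (simp add: psi_eq complex_nonpos_Reals_iff)
  qed
  from tendsto_unique[OF _ this lim] have "b = 0" by simp
  have "\<forall>x>0. Re (\<psi> (of_real x)) > 0" using psi(1) unfolding stieltjes_inv_def by blast
  from this[rule_format, of 1] have "a > 0" using psi_eq[of 1] \<open>b = 0\<close> by (simp add: complex_nonpos_Reals_iff)
  hence "special_stieltjes_inv \<psi>"
    unfolding special_stieltjes_inv_def using psi_eq \<open>b = 0\<close> by (intro exI[of _ 0] exI[of _ a]) simp
  thus False using psi(2) by blast
qed

text \<open>With \<phi>(z) = (\<psi>(z) - L) / z one has \<psi>(k) = L + k \<phi>(k) for k >= 1, and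
  the factor k belongs to the derivative. Taking out z shifts the index, which is why \<phi> is
  evaluated at k + 1.\<close>

lemma multiplier_inv_decompose:
  assumes G: "G \<in> LPplus" and G1: "deriv G 0 \<noteq> 0" and f: "\<And>k. f k = of_real C * of_real (taylor G k)"
    and L: "value_at_0 \<psi> = of_real L"
    and summ: "summable (\<lambda>k. (\<psi> (of_nat (k + 1)) - of_real L) / of_nat (k + 1) * of_real (taylor (deriv G) k) * z ^ k)"
  shows "multiplier_inv \<psi> f z = of_real C * (of_real L * G z +
    z * (\<Sum>k. (\<psi> (of_nat (k + 1)) - of_real L) / of_nat (k + 1) * of_real (taylor (deriv G) k) * z ^ k))"
proof -
  define S where "S = (\<Sum>k. (\<psi> (of_nat (k + 1)) - of_real L) / of_nat (k + 1) * of_real (taylor (deriv G) k) * z ^ k)"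
  define g where "g k = (if k = 0 then 0 else \<psi> (of_nat k) - of_real L) * of_real (taylor G k) * z ^ k" for k :: nat
  have "(\<lambda>k. z * ((\<psi> (of_nat (k + 1)) - of_real L) / of_nat (k + 1) * of_real (taylor (deriv G) k) * z ^ k)) sums (z * S)"
    unfolding S_def by (intro sums_mult summable_sums summ)
  moreover have "z * ((\<psi> (of_nat (k + 1)) - of_real L) / of_nat (k + 1) * of_real (taylor (deriv G) k) * z ^ k) = g (Suc k)" for k
  proof -
    have "complex_of_real (taylor (deriv G) k) = of_nat (k + 1) * of_real (taylor G (Suc k))"
      unfolding taylor_deriv by (simp del: of_nat_Suc)
    hence "z * ((\<psi> (of_nat (k + 1)) - of_real L) / of_nat (k + 1) * of_real (taylor (deriv G) k) * z ^ k) =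
        z * ((\<psi> (of_nat (k + 1)) - of_real L) * of_real (taylor G (Suc k)) * z ^ k)"
      by (simp del: of_nat_Suc of_nat_add)
    thus ?thesis by (simp add: g_def mult_ac)
  qed
  ultimately have "(\<lambda>k. g (Suc k)) sums (z * S)" by simp
  hence g: "g sums (z * S)" by (subst (asm) sums_Suc_iff) (simp add: g_def)
  have "(\<lambda>k. of_real C * (of_real L * (of_real (taylor G k) * z ^ k) + g k)) sums (of_real C * (of_real L * G z + z * S))"
    by (intro sums_mult sums_add g LPplus_sums G)
  moreover have "of_real C * (of_real L * (of_real (taylor G k) * z ^ k) + g k) =
      (if k = 0 then value_at_0 \<psi> else \<psi> (of_nat k)) * f k * z ^ k" for k
    by (simp add: g_def f L algebra_simps)
  ultimately show ?thesis unfolding multiplier_inv_def S_def by (simp add: sums_iff)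
qed


lemma stieltjes_series_summable:
  assumes hol: "\<phi> holomorphic_on (- \<real>\<^sub>\<le>\<^sub>0)" and real: "\<And>x. x > 0 \<Longrightarrow> \<phi> (of_real x) \<in> \<real>"
    and Im_phi: "\<And>z. Im z > 0 \<Longrightarrow> Im (\<phi> z) \<le> 0" and G: "G \<in> LPplus"
  shows "summable (\<lambda>k. \<phi> (of_nat (k + 1)) * of_real (taylor G k) * z ^ k)"
proof -
  have hol': "(\<lambda>z. - \<phi> z) holomorphic_on (- \<real>\<^sub>\<le>\<^sub>0)" using hol by (intro holomorphic_intros)
  have real': "- \<phi> (of_real x) \<in> \<real>" if "x > 0" for x using real[OF that] by simp
  have Im': "Im (- \<phi> z) \<ge> 0" if "Im z > 0" for z using Im_phi[OF that] by simp
  obtain K where K: "\<forall>k::nat. norm (- \<phi> (of_nat (k + 1))) \<le> K * (real k + 1)"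
    by (rule pick_growth[OF hol' real' Im'])
  show ?thesis
    by (rule summable_norm_cancel[OF LPplus_summable_mult[OF G K[rule_format, unfolded norm_minus_cancel]]])
qed

lemma hurwitz_stable_multiplier_inv:
  assumes G: "G \<in> LPplus" and C: "C \<noteq> 0" and f: "\<And>k. f k = of_real C * of_real (taylor G k)"
    and psi: "\<psi> \<in> stieltjes_inv" and nz: "value_at_0 \<psi> \<noteq> 0"
  shows "hurwitz_stable (multiplier_inv \<psi> f)"
proof -
  obtain L where L: "L \<ge> 0" "value_at_0 \<psi> = of_real L"
    and "((\<lambda>t. \<psi> (of_real t)) \<longlongrightarrow> of_real L) (at_right 0)"
    and hol_q: "(\<lambda>z. (\<psi> z - of_real L) / z) holomorphic_on (- \<real>\<^sub>\<le>\<^sub>0)"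
    and real_q: "\<forall>x>0. (\<psi> (of_real x) - of_real L) / of_real x \<in> \<real>"
    and "\<forall>x>0. Re ((\<psi> (of_real x) - of_real L) / of_real x) \<ge> 0"
    and "Re (\<psi> 1 - of_real L) > 0"
    and Im_q: "\<forall>z. Im z > 0 \<longrightarrow> Im ((\<psi> z - of_real L) / z) \<le> 0"
    by (rule stieltjes_inv_quotient[OF psi])
  have "L > 0" using L nz by (cases "L = 0") auto
  have hol: "\<psi> holomorphic_on (- \<real>\<^sub>\<le>\<^sub>0)" and real: "\<forall>x>0. \<psi> (of_real x) \<in> \<real>"
    and pos: "\<forall>x>0. Re (\<psi> (of_real x)) > 0" and Im: "\<forall>z \<in> - \<real>\<^sub>\<le>\<^sub>0. Im z \<ge> 0 \<longrightarrow> Im (\<psi> z) \<ge> 0"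
    using psi(1) unfolding stieltjes_inv_def by blast+
  have Im': "Im (\<psi> z) \<ge> 0" if "Im z > 0" for z
    using Im[rule_format, OF Im_pos_slit[OF that]] that by simp
  obtain K where K: "\<forall>k::nat. norm (\<psi> (of_nat (k + 1))) \<le> K * (real k + 1)"
    by (rule pick_growth[OF hol real[rule_format] Im'])
  have "K \<ge> 0" using order_trans[OF norm_ge_zero K[rule_format, of 0]] by simp
  define c where "c k = (if k = 0 then L else Re (\<psi> (of_nat k)))" for k :: nat
  have c_psi: "\<psi> (of_nat (Suc k)) = of_real (c (Suc k))" for k
    using of_nat_pos_Reals[of \<psi> k, OF real[rule_format]] by (simp add: c_def)
  have c: "(if k = 0 then value_at_0 \<psi> else \<psi> (of_nat k)) = of_real (c k)" for k
    using c_psi[of "k - 1"] L(2) by (cases k) (auto simp: c_def simp del: of_nat_Suc)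
  have c_nonneg: "c k \<ge> 0" for k
  proof (cases k)
    case (Suc n)
    have "Re (\<psi> (of_real (real k))) > 0" using pos Suc by (metis of_nat_0_less_iff zero_less_Suc)
    thus ?thesis using Suc by (simp add: c_def)
  qed (use L(1) in \<open>simp add: c_def\<close>)
  have c_le: "\<bar>c k\<bar> \<le> (L + K) * (real k + 1)" for k
  proof (cases k)
    case 0
    thus ?thesis using L(1) \<open>K \<ge> 0\<close> by (simp add: c_def)
  next
    case (Suc n)
    have "\<bar>c k\<bar> = norm (\<psi> (of_nat (n + 1)))" using c_psi[of n] Suc by (simp del: of_nat_Suc)
    also have "\<dots> \<le> K * (real n + 1)" by (rule K[rule_format])
    also have "\<dots> \<le> (L + K) * (real k + 1)"
      using L(1) \<open>K \<ge> 0\<close> Suc by (intro mult_mono) auto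
    finally show ?thesis .
  qed
  have eq: "multiplier_inv \<psi> f = (\<lambda>z. of_real C * (\<Sum>k. of_real (c k * taylor G k) * z ^ k))"
    unfolding multiplier_inv_def by (rule ext, rule multiplier_series_factor[OF G f c c_le])
  show ?thesis
    unfolding eq
  proof (rule hurwitz_stable_multiplier[OF G C c_nonneg])
    show "c 0 > 0" using \<open>L > 0\<close> by (simp add: c_def)
    show "c k \<le> (L + K) * (real k + 1)" for k using c_le[of k] by simp
    fix z assume z: "Re z \<ge> 0" "Im z > 0"
    show "(\<Sum>k. of_real (c k * taylor G k) * z ^ k) \<noteq> 0"
    proof (cases "deriv G 0 = 0")
      case True
      have "(\<Sum>k. of_real (c k * taylor G k) * z ^ k) = of_real (c 0) * of_real (taylor G 0)"
        using LPplus_const_series[OF G True, of "\<lambda>k. of_real (c k)" z] by simp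
      thus ?thesis using LPplus_taylor_0(1)[OF G] \<open>L > 0\<close> by (simp add: c_def)
    next
      case False
      define q where "q z = (\<psi> z - of_real L) / z" for z
      define S where "S = (\<Sum>k. q (of_nat (k + 1)) * of_real (taylor (deriv G) k) * z ^ k)"
      have G': "deriv G \<in> LPplus" by (rule LPplus_deriv[OF G False])
      note q = hol_q[folded q_def] real_q[folded q_def, rule_format] Im_q[folded q_def, rule_format]
      have summ: "summable (\<lambda>k. q (of_nat (k + 1)) * of_real (taylor (deriv G) k) * z ^ k)"
        by (rule stieltjes_series_summable[OF q G'])
      have dec: "multiplier_inv \<psi> f z = of_real C * (of_real L * G z + z * S)"
        unfolding S_def q_def
        by (rule multiplier_inv_decompose[OF G False f L(2) summ[unfolded q_def]])
      hence "(\<Sum>k. of_real (c k * taylor G k) * z ^ k) = of_real L * G z + z * S"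
        unfolding eq using C by simp
      moreover have "of_real L * G z + z * S \<noteq> 0"
      proof
        assume zero: "of_real L * G z + z * S = 0"
        \<comment> \<open>The strict sign comes from the term with \<open>L\<close>: divided by z G'
          it is L / p, and Im p > 0 makes the imaginary part of 1 / p negative.\<close>
        define p where "p = z * deriv G z / G z"
        have nzs: "z \<noteq> 0" "deriv G z \<noteq> 0" "G z \<noteq> 0"
          using z LPplus_nonzero[OF G' z(1)] LPplus_nonzero[OF G z(1)] by auto
        have "Im p > 0" unfolding p_def using LPplus_log_deriv(3)[OF G z, of 1] False by simp
        hence "Im (1 / p) < 0" by (simp add: Im_divide divide_neg_pos sum_power2_gt_zero_iff)
        have "(of_real L * G z + z * S) / (z * deriv G z) = of_real L * (1 / p) + S / deriv G z"
          using nzs by (simp add: p_def field_simps)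
        hence "of_real L * (1 / p) + S / deriv G z = 0" using zero by simp
        hence "Im (of_real L * (1 / p) + S / deriv G z) = 0" by simp
        moreover have "Im (of_real L * u) = L * Im u" for u by simp
        ultimately have "L * Im (1 / p) + Im (S / deriv G z) = 0" by (simp only: plus_complex.simps)
        moreover have "L * Im (1 / p) < 0" using \<open>L > 0\<close> \<open>Im (1 / p) < 0\<close> by (rule mult_pos_neg)
        moreover have "Im (S / deriv G z) \<le> 0"
          unfolding S_def by (rule stieltjes_series_le[OF q G' z])
        ultimately show False by linarith
      qed
      ultimately show ?thesis by simp
    qed
  qed
qed

lemma multiplier_inv_vanishing:
  assumes G: "G \<in> LPplus" and G1: "deriv G 0 \<noteq> 0" and C: "C \<noteq> 0" and f: "\<And>k. f k = of_real C * of_real (taylor G k)"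
    and psi: "\<psi> \<in> stieltjes_inv" "\<not> special_stieltjes_inv \<psi>" and v0: "value_at_0 \<psi> = 0"
  shows "simple_root (multiplier_inv \<psi> f) 0"
    and "hurwitz_stable (remove_sings (\<lambda>z. multiplier_inv \<psi> f z / z))"
proof -
  obtain L where L: "L \<ge> 0" "value_at_0 \<psi> = of_real L"
    and lim: "((\<lambda>t. \<psi> (of_real t)) \<longlongrightarrow> of_real L) (at_right 0)"
    and hol_q: "(\<lambda>z. (\<psi> z - of_real L) / z) holomorphic_on (- \<real>\<^sub>\<le>\<^sub>0)"
    and real_q: "\<forall>x>0. (\<psi> (of_real x) - of_real L) / of_real x \<in> \<real>"
    and nonneg_q: "\<forall>x>0. Re ((\<psi> (of_real x) - of_real L) / of_real x) \<ge> 0"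
    and pos_q: "Re (\<psi> 1 - of_real L) > 0"
    and Im_q: "\<forall>z. Im z > 0 \<longrightarrow> Im ((\<psi> z - of_real L) / z) \<le> 0"
    by (rule stieltjes_inv_quotient[OF psi(1)])
  have "L = 0" using L v0 by simp
  define q where "q z = (\<psi> z - of_real L) / z" for z
  have G': "deriv G \<in> LPplus" by (rule LPplus_deriv[OF G G1])
  note q = hol_q[folded q_def] real_q[folded q_def, rule_format] Im_q[folded q_def, rule_format]
  define f' where "f' k = of_real C * complex_of_real (taylor (deriv G) k)" for k
  have nonspecial: "\<not> (\<exists>a b :: real. \<forall>z \<in> - \<real>\<^sub>\<le>\<^sub>0. q z = of_real a + of_real b / z)"
    using stieltjes_inv_nonspecial[OF psi] lim unfolding q_def \<open>L = 0\<close> by simp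
  have stable: "hurwitz_stable (multiplier q f')"
    by (rule hurwitz_stable_multiplier_stieltjes[OF G' C f'_def q(1,2) nonneg_q[folded q_def, rule_format] _ q(3) nonspecial])
       (use pos_q in \<open>simp_all add: q_def\<close>)
  have dec: "multiplier_inv \<psi> f z = z * multiplier q f' z" for z
  proof -
    have summ: "summable (\<lambda>k. q (of_nat (k + 1)) * of_real (taylor (deriv G) k) * z ^ k)"
      by (rule stieltjes_series_summable[OF q G'])
    have "multiplier q f' z = (\<Sum>k. of_real C * (q (of_nat (k + 1)) * of_real (taylor (deriv G) k) * z ^ k))"
      unfolding multiplier_def f'_def by (simp only: mult_ac)
    also have "\<dots> = of_real C * (\<Sum>k. q (of_nat (k + 1)) * of_real (taylor (deriv G) k) * z ^ k)"
      by (rule suminf_mult[OF summ])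
    finally show ?thesis
      using multiplier_inv_decompose[OF G G1 f L(2) summ[unfolded q_def]] \<open>L = 0\<close>
      by (simp add: q_def)
  qed
  \<comment> \<open>A Hurwitz stable function does not vanish at \<open>0\<close>, so the root of
    the product with z is simple.\<close>
  have hol: "multiplier q f' holomorphic_on UNIV" and nz: "multiplier q f' 0 \<noteq> 0"
    using stable by (auto simp: hurwitz_stable_def)
  have cont: "isCont (multiplier q f') z" for z
    using holomorphic_on_imp_continuous_on[OF hol] by (simp add: continuous_on_eq_continuous_at)
  \<comment> \<open>Division by zero gives the quotient the value \<open>0\<close> at the origin;
    \<open>remove_sings\<close> replaces it by the limit.\<close>
  have "remove_sings (\<lambda>z. multiplier_inv \<psi> f z / z) z = multiplier q f' z" for z
  proof (rule remove_sings_eqI)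
    have "(multiplier q f' \<longlongrightarrow> multiplier q f' z) (at z)" using cont by (simp add: isContD)
    moreover have "eventually (\<lambda>w. multiplier q f' w = multiplier_inv \<psi> f w / w) (at z)"
    proof -
      have "eventually (\<lambda>w. w \<noteq> 0) (at z)" by (cases "z = 0") (auto simp: eventually_neq_at_within)
      thus ?thesis by eventually_elim (simp add: dec)
    qed
    ultimately show "((\<lambda>z. multiplier_inv \<psi> f z / z) \<longlongrightarrow> multiplier q f' z) (at z)"
      by (rule Lim_transform_eventually)
  qed
  hence "remove_sings (\<lambda>z. multiplier_inv \<psi> f z / z) = multiplier q f'" by auto
  thus "hurwitz_stable (remove_sings (\<lambda>z. multiplier_inv \<psi> f z / z))" using stable by simp
  show "simple_root (multiplier_inv \<psi> f) 0"
    unfolding simple_root_def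
  proof (intro conjI)
    show "multiplier_inv \<psi> f 0 = 0" by (simp add: dec)
    show "zorder (multiplier_inv \<psi> f) 0 = 1"
      by (rule zorder_eqI[of UNIV _ "multiplier q f'"]) (use hol nz in \<open>simp_all add: dec\<close>)
    show "isolated_zero (multiplier_inv \<psi> f) 0"
      unfolding isolated_zero_def
    proof
      have "((\<lambda>z. z * multiplier q f' z) \<longlongrightarrow> 0 * multiplier q f' 0) (at 0)"
        using cont[of 0] by (intro tendsto_intros) (simp add: isContD)
      thus "(multiplier_inv \<psi> f \<longlongrightarrow> 0) (at 0)" by (simp add: dec[abs_def])
      have "eventually (\<lambda>z. multiplier q f' z \<noteq> 0) (at 0)"
        using isContD[OF cont] nz by (rule tendsto_imp_eventually_ne)
      moreover have "eventually (\<lambda>z::complex. z \<noteq> 0) (at 0)" by (rule eventually_neq_at_within)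
      ultimately show "eventually (\<lambda>z. multiplier_inv \<psi> f z \<noteq> 0) (at 0)"
        by eventually_elim (simp add: dec)
    qed
  qed
qed

text \<open>In the case of value \<open>0\<close> at the origin a constant F is set apart: all
  coefficients of positive index vanish, the first is multiplied by \<open>0\<close>, and the
  resulting zero function has no simple root.\<close>

theorem theorem2:
  fixes F :: "complex \<Rightarrow> complex" and f :: "nat \<Rightarrow> complex"
  assumes LP: "F \<in> laguerre_polya_I"
    and F0: "F 0 \<noteq> 0"
    and taylor: "\<And>z. (\<lambda>k. f k * z ^ k) sums F z"
  shows "(\<forall>\<psi> \<in> stieltjes. \<not> special_stieltjes \<psi> \<longrightarrow> hurwitz_stable (multiplier \<psi> f)) \<and>
         (\<forall>\<psi> \<in> stieltjes_inv. \<not> special_stieltjes_inv \<psi> \<longrightarrow>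
           (value_at_0 \<psi> \<noteq> 0 \<longrightarrow> hurwitz_stable (multiplier_inv \<psi> f)) \<and>
           (value_at_0 \<psi> = 0 \<longrightarrow> \<not> F constant_on UNIV \<longrightarrow>
              simple_root (multiplier_inv \<psi> f) 0 \<and>
              hurwitz_stable (remove_sings (\<lambda>z. multiplier_inv \<psi> f z / z))))"
proof -
  obtain C G where C: "C \<noteq> 0" and G: "G \<in> LPplus" and FG: "\<And>z. F z = of_real C * G z"
    using laguerre_polya_I_imp_LPplus[OF LP F0] by blast
  have f: "f k = of_real C * of_real (taylor G k)" for k
  proof (rule power_series_coeff_unique[of f F])
    show "(\<lambda>k. f k * z ^ k) sums F z" for z by (rule taylor)
    show "(\<lambda>k. of_real C * of_real (taylor G k) * z ^ k) sums F z" for z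
      using sums_mult[OF LPplus_sums[OF G, of z], of "of_real C"] by (simp add: FG mult.assoc)
  qed
  show ?thesis
  proof (intro conjI ballI impI)
    fix \<psi> assume psi: "\<psi> \<in> stieltjes" "\<not> special_stieltjes \<psi>"
    have hol: "\<psi> holomorphic_on (- \<real>\<^sub>\<le>\<^sub>0)" and real: "\<forall>x>0. \<psi> (of_real x) \<in> \<real>"
      and pos: "\<forall>x>0. Re (\<psi> (of_real x)) > 0" and Im: "\<forall>z \<in> - \<real>\<^sub>\<le>\<^sub>0. Im z \<ge> 0 \<longrightarrow> Im (\<psi> z) \<le> 0"
      using psi(1) unfolding stieltjes_def by blast+
    show "hurwitz_stable (multiplier \<psi> f)"
    proof (rule hurwitz_stable_multiplier_stieltjes[OF G C f hol _ _ _ _ stieltjes_nonspecial[OF psi]])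
      show "\<psi> (of_real x) \<in> \<real>" "Re (\<psi> (of_real x)) \<ge> 0" if "x > 0" for x
        using real pos that by (auto intro: less_imp_le)
      show "Re (\<psi> 1) > 0" using pos[rule_format, of 1] by simp
      show "Im (\<psi> z) \<le> 0" if "Im z > 0" for z
        using Im[rule_format, OF Im_pos_slit[OF that]] that by simp
    qed
  next
    fix \<psi> assume psi: "\<psi> \<in> stieltjes_inv" "\<not> special_stieltjes_inv \<psi>" and L0: "value_at_0 \<psi> \<noteq> 0"
    show "hurwitz_stable (multiplier_inv \<psi> f)"
      by (rule hurwitz_stable_multiplier_inv[OF G C f psi(1) L0])
  next
    fix \<psi> assume psi: "\<psi> \<in> stieltjes_inv" "\<not> special_stieltjes_inv \<psi>" and L0: "value_at_0 \<psi> = 0"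
      and nonconst: "\<not> F constant_on UNIV"
    have G1: "deriv G 0 \<noteq> 0"
    proof
      assume "deriv G 0 = 0"
      hence "F z = of_real C * of_real (taylor G 0)" for z
        using sums_unique[OF LPplus_sums[OF G, of z]] LPplus_const_series[OF G, of "\<lambda>_. 1" z] by (simp add: FG)
      thus False using nonconst unfolding constant_on_def by blast
    qed
    note * = multiplier_inv_vanishing[OF G G1 C f psi L0]
    show "simple_root (multiplier_inv \<psi> f) 0" by (rule *(1))
    show "hurwitz_stable (remove_sings (\<lambda>z. multiplier_inv \<psi> f z / z))" by (rule *(2))
  qed
qed

end
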